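(* For each $r\in(\mathbb{N}\setminus\{0\})\cup\{\infty\}$, $\mathbf{PQSym}^{*r}$ is a graded Hopf subalgebra of $\mathbf{PQSym}^*$, and these form an infinite chain of nested graded Hopf subalgebras $$\mathbf{PQSym}^*=\mathbf{PQSym}^{*1}\supseteq\mathbf{PQSym}^{*2}\supseteq\dots\supseteq\mathbf{PQSym}^{*r}\supseteq\dots\supseteq\mathbf{PQSym}^{*\infty},$$ which are noncommutative and noncocommutative, except $\mathbf{PQSym}^{*\infty}$ which is cocommutative.
   Context: Words are finite words on $\mathbb{N}\setminus\{0\}$. A word $u=u_1\dots u_n$ is a parking function if its nondecreasing rearrangement $u'$ satisfies $u'_i\le i$ for all $i$; prime if moreover $u'_i<i$ for $i\ge2$. Parkization: for $w=w_1\dots w_n$ let $d(w)=\min\{i\ge1:\#\{j:w_j\le i\}<i\}$; if $d(w)=n+1$ then $\mathrm{Park}(w)=w$, otherwise $\mathrm{Park}(w)=\mathrm{Park}(w')$ with $w'$ obtained by decreasing by one all letters greater than $d(w)$. $\mathbf{PQSym}^*$ is the span over a field $\mathbb{K}$ of characteristic $0$ of $\mathbf{G}_u=\sum_{\mathrm{Park}(w)=u}w$, $u$ parking function, graded by the length of $u$, with product $\mathbf{G}_u\mathbf{G}_v=\sum \mathbf{G}_w$ over parking functions $w=a\cdot b$ (concatenation) with $\mathrm{Park}(a)=u$, $\mathrm{Park}(b)=v$, and coproduct $\Delta\mathbf{G}_u=\sum\mathbf{G}_a\otimes\mathbf{G}_b$ over pairs of parking functions $(a,b)$ such that $u$ is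 a shuffle of $a$ with the word obtained from $b$ by adding $|a|$ to each letter. $\mathrm{BW}$ is the set of infinite sequences of columns $(L_i,M_i)_{i\ge1}$, $L_i$ finite sets of positive integers, $M_i$ words, such that the nonempty $L_i$ in order form a set composition of $[n]$ ($n$ = length) and each $M_i$ is a prime parking function of length $|L_i|$; columns with $L_i=\emptyset$ are empty. With $\|L\|=|L|$ for $L\neq\emptyset$ and $\|\emptyset\|=1$, the bijection $\Phi:\mathrm{BW}\to$ words sends $m$ to the word $w$ with $w_p=(t\text{-th letter of }M_j)+\sum_{q<j}\|L_q\|$ whenever $p$ is the $t$-th smallest element of $L_j$; words are identified with elements of $\mathrm{BW}$ via $\Phi$. For $r\in(\mathbb{N}\setminus\{0\})\cup\{\infty\}$, the $r$-parking quasi-symmetrizing action of $\mathfrak{S}_\infty=\langle s_i=(i,i+1)\rangle$ on $\mathrm{BW}$ (hence on words, extended linearly): $s_i$ swaps the $i$-th and $(i+1)$-st columns if one of them has words of length strictly smaller than $r$, and does nothing otherwise. $\mathbf{PQSym}^{*r}$ is the subspace of elements of $\mathbf{PQSym}^*$ invariant under the $r$-action. *)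

theory Defs
  imports Complex_Main "HOL-Library.Extended_Nat" "HOL-Library.Function_Algebras"
begin

section \<open>Graded Hopf algebras realised in function spaces\<close>

definition fscale :: "'k::field \<Rightarrow> ('x \<Rightarrow> 'k) \<Rightarrow> 'x \<Rightarrow> 'k" where
  "fscale c f = (\<lambda>x. c * f x)"

global_interpretation fun_vs: vector_space "fscale :: 'k::field \<Rightarrow> ('x \<Rightarrow> 'k) \<Rightarrow> 'x \<Rightarrow> 'k"
  by unfold_locales (auto simp: fscale_def algebra_simps)

text \<open>For subspaces \<open>A\<close>, \<open>B\<close> of function spaces, the canonical map from the tensor product of
  \<open>A\<close> and \<open>B\<close> to functions of two variables is injective; \<open>tensor_space A B\<close> is its image.\<close>

definition tensor :: "('x \<Rightarrow> 'k::field) \<Rightarrow> ('y \<Rightarrow> 'k) \<Rightarrow> 'x \<times> 'y \<Rightarrow> 'k" where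
  "tensor f g = (\<lambda>(x, y). f x * g y)"

definition tensor_space ::
    "('x \<Rightarrow> 'k::field) set \<Rightarrow> ('y \<Rightarrow> 'k) set \<Rightarrow> ('x \<times> 'y \<Rightarrow> 'k) set" where
  "tensor_space A B = fun_vs.span {tensor f g |f g. f \<in> A \<and> g \<in> B}"

text \<open>\<open>tensor_rep A t ps\<close>: the list \<open>ps\<close> of pairs \<open>(a, b)\<close> of elements of \<open>A\<close> is a way of writing
  \<open>t\<close> as a finite sum of pure tensors. A linear map on the tensor square of \<open>A\<close> that is
  induced by a bilinear map \<open>h\<close> takes the value \<open>\<Sum>(a, b)\<leftarrow>ps. h a b\<close> at \<open>t\<close>, for every such
  \<open>ps\<close> (Sweedler notation).\<close>

definition tensor_rep ::
    "('x \<Rightarrow> 'k::field) set \<Rightarrow> ('x \<times> 'x \<Rightarrow> 'k) \<Rightarrow> (('x \<Rightarrow> 'k) \<times> ('x \<Rightarrow> 'k)) list \<Rightarrow> bool" where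
  "tensor_rep A t ps \<longleftrightarrow> set ps \<subseteq> A \<times> A \<and> t = (\<Sum>(a, b)\<leftarrow>ps. tensor a b)"

definition linear_on ::
    "('k::field \<Rightarrow> 'v \<Rightarrow> 'v) \<Rightarrow> ('x \<Rightarrow> 'k) set \<Rightarrow> (('x \<Rightarrow> 'k) \<Rightarrow> 'v::ab_group_add) \<Rightarrow> bool" where
  "linear_on scale A h \<longleftrightarrow>
     (\<forall>f\<in>A. \<forall>g\<in>A. h (f + g) = h f + h g) \<and> (\<forall>c. \<forall>f\<in>A. h (fscale c f) = scale c (h f))"

record ('x, 'k) graded_hopf =
  hcarrier :: "('x \<Rightarrow> 'k) set"
  hcomp :: "nat \<Rightarrow> ('x \<Rightarrow> 'k) set"
  hmult :: "('x \<Rightarrow> 'k) \<Rightarrow> ('x \<Rightarrow> 'k) \<Rightarrow> 'x \<Rightarrow> 'k"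
  hunit :: "'x \<Rightarrow> 'k"
  hcomult :: "('x \<Rightarrow> 'k) \<Rightarrow> 'x \<times> 'x \<Rightarrow> 'k"
  hcounit :: "('x \<Rightarrow> 'k) \<Rightarrow> 'k"

definition unital_algebra :: "('x, 'k::field) graded_hopf \<Rightarrow> bool" where
  "unital_algebra H \<longleftrightarrow>
     fun_vs.subspace (hcarrier H) \<and>
     hunit H \<in> hcarrier H \<and>
     (\<forall>f\<in>hcarrier H. \<forall>g\<in>hcarrier H. hmult H f g \<in> hcarrier H) \<and>
     (\<forall>g\<in>hcarrier H. linear_on fscale (hcarrier H) (\<lambda>f. hmult H f g)) \<and>
     (\<forall>f\<in>hcarrier H. linear_on fscale (hcarrier H) (\<lambda>g. hmult H f g)) \<and>
     (\<forall>f\<in>hcarrier H. \<forall>g\<in>hcarrier H. \<forall>h\<in>hcarrier H.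
        hmult H (hmult H f g) h = hmult H f (hmult H g h)) \<and>
     (\<forall>f\<in>hcarrier H. hmult H (hunit H) f = f \<and> hmult H f (hunit H) = f)"

definition counital_coalgebra :: "('x, 'k::field) graded_hopf \<Rightarrow> bool" where
  "counital_coalgebra H \<longleftrightarrow>
     fun_vs.subspace (hcarrier H) \<and>
     (\<forall>f\<in>hcarrier H. hcomult H f \<in> tensor_space (hcarrier H) (hcarrier H)) \<and>
     linear_on fscale (hcarrier H) (hcomult H) \<and>
     linear_on (*) (hcarrier H) (hcounit H) \<and>
     (\<forall>f\<in>hcarrier H. \<forall>ps. tensor_rep (hcarrier H) (hcomult H f) ps \<longrightarrow>
        (\<forall>x y z. (\<Sum>(a, b)\<leftarrow>ps. hcomult H a (x, y) * b z) =
                 (\<Sum>(a, b)\<leftarrow>ps. a x * hcomult H b (y, z))) \<and>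
        (\<Sum>(a, b)\<leftarrow>ps. fscale (hcounit H a) b) = f \<and>
        (\<Sum>(a, b)\<leftarrow>ps. fscale (hcounit H b) a) = f)"

definition bialgebra :: "('x, 'k::field) graded_hopf \<Rightarrow> bool" where
  "bialgebra H \<longleftrightarrow>
     unital_algebra H \<and> counital_coalgebra H \<and>
     hcomult H (hunit H) = tensor (hunit H) (hunit H) \<and>
     hcounit H (hunit H) = 1 \<and>
     (\<forall>f\<in>hcarrier H. \<forall>g\<in>hcarrier H. hcounit H (hmult H f g) = hcounit H f * hcounit H g) \<and>
     (\<forall>f\<in>hcarrier H. \<forall>g\<in>hcarrier H. \<forall>ps qs.
        tensor_rep (hcarrier H) (hcomult H f) ps \<and> tensor_rep (hcarrier H) (hcomult H g) qs \<longrightarrow>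
        hcomult H (hmult H f g) =
          (\<Sum>(a, b)\<leftarrow>ps. \<Sum>(c, d)\<leftarrow>qs. tensor (hmult H a c) (hmult H b d)))"

definition antipode :: "('x, 'k::field) graded_hopf \<Rightarrow> (('x \<Rightarrow> 'k) \<Rightarrow> 'x \<Rightarrow> 'k) \<Rightarrow> bool" where
  "antipode H S \<longleftrightarrow>
     (\<forall>f\<in>hcarrier H. S f \<in> hcarrier H) \<and>
     linear_on fscale (hcarrier H) S \<and>
     (\<forall>f\<in>hcarrier H. \<forall>ps. tensor_rep (hcarrier H) (hcomult H f) ps \<longrightarrow>
        (\<Sum>(a, b)\<leftarrow>ps. hmult H (S a) b) = fscale (hcounit H f) (hunit H) \<and>
        (\<Sum>(a, b)\<leftarrow>ps. hmult H a (S b)) = fscale (hcounit H f) (hunit H))"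

definition graded_space :: "(nat \<Rightarrow> ('x \<Rightarrow> 'k::field) set) \<Rightarrow> ('x \<Rightarrow> 'k) set \<Rightarrow> bool" where
  "graded_space C A \<longleftrightarrow>
     (\<forall>n. fun_vs.subspace (C n)) \<and>
     fun_vs.span (\<Union>n. C n) = A \<and>
     (\<forall>n. C n \<inter> fun_vs.span (\<Union>m\<in>-{n}. C m) = {0})"

definition graded_hopf_algebra :: "('x, 'k::field) graded_hopf \<Rightarrow> bool" where
  "graded_hopf_algebra H \<longleftrightarrow>
     bialgebra H \<and>
     graded_space (hcomp H) (hcarrier H) \<and>
     hunit H \<in> hcomp H 0 \<and>
     (\<forall>m n. \<forall>f\<in>hcomp H m. \<forall>g\<in>hcomp H n. hmult H f g \<in> hcomp H (m + n)) \<and>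
     (\<forall>n. \<forall>f\<in>hcomp H n. hcomult H f \<in>
        fun_vs.span (\<Union>i\<le>n. tensor_space (hcomp H i) (hcomp H (n - i)))) \<and>
     (\<forall>n>0. \<forall>f\<in>hcomp H n. hcounit H f = 0) \<and>
     (\<exists>S. antipode H S \<and> (\<forall>n. \<forall>f\<in>hcomp H n. S f \<in> hcomp H n))"

definition graded_hopf_subalgebra ::
    "('x \<Rightarrow> 'k) set \<Rightarrow> ('x, 'k::field) graded_hopf \<Rightarrow> bool" where
  "graded_hopf_subalgebra B H \<longleftrightarrow>
     graded_hopf_algebra H \<and>
     B \<subseteq> hcarrier H \<and>
     fun_vs.subspace B \<and>
     graded_space (\<lambda>n. B \<inter> hcomp H n) B \<and>
     hunit H \<in> B \<and>
     (\<forall>f\<in>B. \<forall>g\<in>B. hmult H f g \<in> B) \<and>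
     (\<forall>f\<in>B. hcomult H f \<in> tensor_space B B) \<and>
     (\<exists>S. antipode H S \<and> (\<forall>f\<in>B. S f \<in> B))"

definition commutative_on :: "('x \<Rightarrow> 'k) set \<Rightarrow> ('x, 'k::field) graded_hopf \<Rightarrow> bool" where
  "commutative_on B H \<longleftrightarrow> (\<forall>f\<in>B. \<forall>g\<in>B. hmult H f g = hmult H g f)"

definition cocommutative_on :: "('x \<Rightarrow> 'k) set \<Rightarrow> ('x, 'k::field) graded_hopf \<Rightarrow> bool" where
  "cocommutative_on B H \<longleftrightarrow> (\<forall>f\<in>B. hcomult H f \<circ> prod.swap = hcomult H f)"


section \<open>Parking functions and parkization\<close>

definition words :: "nat list set" where
  "words = lists {0<..}"

definition parking :: "nat list \<Rightarrow> bool" where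
  "parking u \<longleftrightarrow> u \<in> words \<and> (\<forall>i<length u. sort u ! i \<le> i + 1)"

definition prime_parking :: "nat list \<Rightarrow> bool" where
  "prime_parking u \<longleftrightarrow> parking u \<and> (\<forall>i<length u. 1 \<le> i \<longrightarrow> sort u ! i < i + 1)"

definition park_d :: "nat list \<Rightarrow> nat" where
  "park_d w = (LEAST i. 1 \<le> i \<and> card {j. j < length w \<and> w ! j \<le> i} < i)"

lemma park_d:
  shows "1 \<le> park_d w" "card {j. j < length w \<and> w ! j \<le> park_d w} < park_d w"
    and "park_d w \<le> length w + 1"
proof -
  have "card {j. j < length w \<and> w ! j \<le> length w + 1} \<le> card {..<length w}"
    by (intro card_mono) auto
  then have *: "1 \<le> length w + 1 \<and> card {j. j < length w \<and> w ! j \<le> length w + 1} < length w + 1"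
    by simp
  show "1 \<le> park_d w" "card {j. j < length w \<and> w ! j \<le> park_d w} < park_d w"
    using LeastI[where P = "\<lambda>i. 1 \<le> i \<and> card {j. j < length w \<and> w ! j \<le> i} < i", OF *]
    by (simp_all add: park_d_def)
  show "park_d w \<le> length w + 1"
    unfolding park_d_def by (rule Least_le) (rule *)
qed

lemma sum_list_decr:
  fixes d x :: nat
  assumes "x \<in> set w" "x > d"
  shows "sum_list (map (\<lambda>y. if y > d then y - 1 else y) w) < sum_list w"
proof -
  have le: "sum_list (map (\<lambda>y. if y > d then y - 1 else y) v) \<le> sum_list v" for v
    by (induction v) auto
  obtain ys zs where "w = ys @ x # zs"
    using assms(1) by (meson split_list)
  then show ?thesis
    using le[of ys] le[of zs] assms(2) by auto
qed

function Park :: "nat list \<Rightarrow> nat list" where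
  "Park w = (if park_d w = length w + 1 then w
             else Park (map (\<lambda>x. if x > park_d w then x - 1 else x) w))"
  by auto
termination
proof (relation "measure sum_list")
  fix w :: "nat list"
  assume "park_d w \<noteq> length w + 1"
  then have le: "park_d w \<le> length w"
    using park_d(3)[of w] by simp
  have "\<exists>x\<in>set w. x > park_d w"
  proof (rule ccontr)
    assume "\<not> ?thesis"
    then have "{j. j < length w \<and> w ! j \<le> park_d w} = {..<length w}"
      by (auto simp: not_less)
    then show False
      using park_d(2)[of w] le by simp
  qed
  then obtain x where x: "x \<in> set w" "x > park_d w" by blast
  from sum_list_decr[OF this]
  show "(map (\<lambda>x. if x > park_d w then x - 1 else x) w, w) \<in> measure sum_list"
    by simp
qed simp

declare Park.simps [simp del]


section \<open>The Hopf algebra of parking functions\<close>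

text \<open>Formal series \<open>\<Sum>w. f w \<cdot> w\<close> in words are functions \<open>f\<close> on words, extended by \<open>0\<close> to lists
  containing the letter \<open>0\<close>. As \<open>Park u = u\<close> for every parking function \<open>u\<close>, the coefficient of
  \<open>Gser u\<close> in an element \<open>f\<close> of the span of these series is \<open>f u\<close>; the operations below
  are the (bi)linear extensions of their values on the basis.\<close>

definition Gser :: "nat list \<Rightarrow> nat list \<Rightarrow> 'k::field" where
  "Gser u = (\<lambda>w. if w \<in> words \<and> Park w = u then 1 else 0)"

definition Gsupp :: "(nat list \<Rightarrow> 'k::field) \<Rightarrow> nat list set" where
  "Gsupp f = {u. parking u \<and> f u \<noteq> 0}"

definition G_mult :: "nat list \<Rightarrow> nat list \<Rightarrow> nat list \<Rightarrow> 'k::field" where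
  "G_mult u v = (\<Sum>w\<in>{a @ b |a b. parking (a @ b) \<and> Park a = u \<and> Park b = v}. Gser w)"

definition G_comult :: "nat list \<Rightarrow> nat list \<times> nat list \<Rightarrow> 'k::field" where
  "G_comult u =
     (\<Sum>(a, b)\<in>{(a, b). parking a \<and> parking b \<and> u \<in> shuffles a (map (\<lambda>x. x + length a) b)}.
        tensor (Gser a) (Gser b))"

definition PQSym :: "(nat list, 'k::field_char_0) graded_hopf" where
  "PQSym =
     \<lparr>hcarrier = fun_vs.span {Gser u |u. parking u},
      hcomp = (\<lambda>n. fun_vs.span {Gser u |u. parking u \<and> length u = n}),
      hmult = (\<lambda>f g. \<Sum>u\<in>Gsupp f. \<Sum>v\<in>Gsupp g. fscale (f u * g v) (G_mult u v)),
      hunit = Gser [],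
      hcomult = (\<lambda>f. \<Sum>u\<in>Gsupp f. fscale (f u) (G_comult u)),
      hcounit = (\<lambda>f. f [])\<rparr>"


section \<open>The parking quasi-symmetrizing actions\<close>

text \<open>The \<open>(i + 1)\<close>-st column of \<open>m\<close> is \<open>m i\<close>.\<close>

type_synonym columns = "nat \<Rightarrow> nat set \<times> nat list"

definition BW :: "columns set" where
  "BW = {m. (\<exists>n. (\<Union>i. fst (m i)) = {1..n}) \<and>
            (\<forall>i j. i \<noteq> j \<longrightarrow> fst (m i) \<inter> fst (m j) = {}) \<and>
            (\<forall>i. prime_parking (snd (m i)) \<and> length (snd (m i)) = card (fst (m i)))}"

definition col_size :: "nat set \<Rightarrow> nat" where
  "col_size L = (if L = {} then 1 else card L)"

definition Phi :: "columns \<Rightarrow> nat list" where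
  "Phi m = map (\<lambda>p. let j = (THE j. p \<in> fst (m j)) in
                    snd (m j) ! card {q \<in> fst (m j). q < p} + (\<Sum>q<j. col_size (fst (m q))))
             [1..<Suc (card (\<Union>i. fst (m i)))]"

definition col_swap :: "enat \<Rightarrow> nat \<Rightarrow> columns \<Rightarrow> columns" where
  "col_swap r i m =
     (if enat (length (snd (m i))) < r \<or> enat (length (snd (m (Suc i)))) < r
      then m(i := m (Suc i), Suc i := m i) else m)"

definition word_swap :: "enat \<Rightarrow> nat \<Rightarrow> nat list \<Rightarrow> nat list" where
  "word_swap r i w = Phi (col_swap r i (inv_into BW Phi w))"

text \<open>The series \<open>\<Sum>w. f w \<cdot> word_swap r i w\<close>; all fibres of \<open>word_swap r i\<close> on words are singletons.\<close>

definition series_swap :: "enat \<Rightarrow> nat \<Rightarrow> (nat list \<Rightarrow> 'k::field) \<Rightarrow> nat list \<Rightarrow> 'k" where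
  "series_swap r i f = (\<lambda>v. \<Sum>w\<in>{w \<in> words. word_swap r i w = v}. f w)"

text \<open>Invariance under the group is invariance under its generators.\<close>

definition PQSym_inv :: "enat \<Rightarrow> (nat list \<Rightarrow> 'k::field_char_0) set" where
  "PQSym_inv r = {f \<in> hcarrier PQSym. \<forall>i. series_swap r i f = f}"

end

theory Submission
  imports Defs
begin

text \<open>A word is cut at \<open>c\<close> if, for every \<open>a\<close>, it has at most \<open>c - a\<close> letters in \<open>(a, c]\<close>; the cuts
  are exactly the boundaries between the columns of the corresponding element of \<open>BW\<close>. The
  \<open>r\<close>-action swaps two neighbouring blocks of the alphabet between cuts, and a series invariant
  under it is invariant under swapping arbitrary, not only neighbouring, blocks one of which
  carries fewer than \<open>r\<close> letters. Since parkization removes empty columns, the case \<open>r = 1\<close> is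
  invariance under parkization. In this form everything is natural: the product restricts a word
  to a prefix and a suffix, which keeps cuts and does not increase numbers of letters, and the
  coproduct evaluates a series at shuffles of \<open>x\<close> with a shifted \<open>y\<close>, so that a swap in \<open>x\<close> or \<open>y\<close> is
  a swap in the shuffle. The antipode is given by the usual recursion on the degree, along which
  invariance is inherited. For \<open>r = \<infinity>\<close>, swapping the two halves of the alphabet exchanges the
  tensor factors of the coproduct.\<close>

section \<open>Cuts and block swaps\<close>


text \<open>Strictly inside a column a prime parking function has more than \<open>i\<close> letters
  among its first \<open>i\<close> values, so no value there is a cut; at its end the number of
  letters is at most the width. Hence a word alone determines the offsets of its columns, although
  \<open>word_swap\<close> passes through a chosen preimage under \<open>Phi\<close>. Swaps of
  neighbouring columns do not restrict well: deleting letters keeps cuts but can create new ones, so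
  one column of a word may fall apart into several columns of a prefix. Blocks made of arbitrarily
  many columns avoid this. Elements of \<open>PQSym\<close> are functions on words. In these
  coordinates the product at \<open>w\<close> sums over the splittings of \<open>w\<close> into two
  pieces, and the coproduct at \<open>(x, y)\<close> sums over shuffles, so the axioms become
  identities between finite sums. Invariance of the coproduct in each variable separately does not
  by itself place it in the tensor square of the invariant space. That also takes finiteness: in
  bounded length there are only finitely many classes of words that invariant functions can
  distinguish.\<close>

definition cnt :: "nat list \<Rightarrow> nat \<Rightarrow> nat \<Rightarrow> nat" where
  "cnt w a b = length (filter (\<lambda>x. a < x \<and> x \<le> b) w)"

text \<open>This is the parking condition read from above: the letters up to a positive
  \<open>c\<close> can be completed by additional letters \<open>1\<close> to a parking function of
  length \<open>c\<close>. For \<open>c \<le> a\<close> both sides of the inequality are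
  \<open>0\<close>.\<close>

definition is_cut :: "nat list \<Rightarrow> nat \<Rightarrow> bool" where
  "is_cut w c \<longleftrightarrow> (\<forall>a. cnt w a c \<le> c - a)"

text \<open>The intervals \<open>(a, b]\<close> and \<open>(b, c]\<close> trade places, each moved
  rigidly, so the boundary between them moves from \<open>b\<close> to
  \<open>a + (c - b)\<close>.\<close>

definition block_shift :: "nat \<Rightarrow> nat \<Rightarrow> nat \<Rightarrow> nat \<Rightarrow> nat" where
  "block_shift a b c x =
     (if a < x \<and> x \<le> b then x + (c - b) else if b < x \<and> x \<le> c then x - (b - a) else x)"

definition block_swap :: "nat \<Rightarrow> nat \<Rightarrow> nat \<Rightarrow> nat list \<Rightarrow> nat list" where
  "block_swap a b c w = map (block_shift a b c) w"

lemma words_iff: "w \<in> words \<longleftrightarrow> 0 \<notin> set w"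
  by (auto simp: words_def in_lists_conv_set) (metis gr0I)

lemma words_append: "a @ b \<in> words \<longleftrightarrow> a \<in> words \<and> b \<in> words"
  by (auto simp: words_iff)

lemma words_take_drop: "w \<in> words \<longleftrightarrow> take k w \<in> words \<and> drop k w \<in> words"
  by (metis append_take_drop_id words_append)

lemma cnt_append: "cnt (u @ v) a b = cnt u a b + cnt v a b"
  by (simp add: cnt_def)

lemma cnt_split:
  assumes "a \<le> b" "b \<le> c" shows "cnt w a c = cnt w a b + cnt w b c"
  using assms by (induction w) (auto simp: cnt_def)

lemma cnt_le_length: "cnt w a b \<le> length w"
  by (simp add: cnt_def)

lemma cnt_trivial: "b \<le> a \<Longrightarrow> cnt w a b = 0"
  by (simp add: cnt_def)

lemma cnt_mono: "a' \<le> a \<Longrightarrow> b \<le> b' \<Longrightarrow> cnt w a b \<le> cnt w a' b'"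
  by (induction w) (auto simp: cnt_def)

lemma cnt_eq_0_iff: "cnt w a b = 0 \<longleftrightarrow> (\<forall>x\<in>set w. \<not> (a < x \<and> x \<le> b))"
  by (simp add: cnt_def filter_empty_conv)

lemma cnt_eq_length_iff: "cnt w a b = length w \<longleftrightarrow> (\<forall>x\<in>set w. a < x \<and> x \<le> b)"
  unfolding cnt_def by (metis (no_types, lifting) filter_True length_filter_less nat_less_le)

lemma cnt_map_cong:
  assumes "\<And>x. x \<in> set w \<Longrightarrow> (p < h x \<and> h x \<le> q) \<longleftrightarrow> (p' < x \<and> x \<le> q')"
  shows "cnt (map h w) p q = cnt w p' q'"
  using assms by (induction w) (auto simp: cnt_def)

lemma cut_le: "is_cut w c \<Longrightarrow> cnt w a c \<le> c - a"
  by (simp add: is_cut_def)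

lemma cut_0: "is_cut w 0"
  by (simp add: is_cut_def cnt_def)

text \<open>For \<open>p\<close> below the known cut \<open>a\<close> the count is additive at
  \<open>a\<close>, so only intervals starting at or above \<open>a\<close> have to be
  checked.\<close>

lemma cut_extend:
  assumes "is_cut w a" "a \<le> b" "\<And>p. a \<le> p \<Longrightarrow> p \<le> b \<Longrightarrow> cnt w p b \<le> b - p"
  shows "is_cut w b"
  unfolding is_cut_def
proof
  fix p
  consider "p < a" | "a \<le> p" "p \<le> b" | "b < p" by linarith
  then show "cnt w p b \<le> b - p"
  proof cases
    case 1
    then have "cnt w p b = cnt w p a + cnt w a b" using assms(2) by (intro cnt_split) auto
    then show ?thesis using cut_le[OF assms(1), of p] assms(3)[of a] assms(2) 1 by simp
  next
    case 3 then show ?thesis by (simp add: cnt_trivial)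
  qed (use assms in auto)
qed

lemma cut_mono:
  assumes "is_cut w c" "\<And>a. cnt v a c \<le> cnt w a c" shows "is_cut v c"
  using assms unfolding is_cut_def by (meson le_trans)

lemma cut_append: "is_cut (u @ v) c \<Longrightarrow> is_cut u c" "is_cut (u @ v) c \<Longrightarrow> is_cut v c"
  by (erule cut_mono, simp add: cnt_append)+

lemma cut_take_drop: "is_cut w c \<Longrightarrow> is_cut (take k w) c" "is_cut w c \<Longrightarrow> is_cut (drop k w) c"
  by (metis append_take_drop_id cut_append)+

lemma cnt_take_drop_le: "cnt (take k w) a b \<le> cnt w a b" "cnt (drop k w) a b \<le> cnt w a b"
proof -
  have "cnt w a b = cnt (take k w) a b + cnt (drop k w) a b"
    by (metis append_take_drop_id cnt_append)
  then show "cnt (take k w) a b \<le> cnt w a b" "cnt (drop k w) a b \<le> cnt w a b" by auto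
qed

lemma cut_large:
  assumes "\<forall>x\<in>set w. x \<le> M" shows "is_cut w (M + length w + j)"
  unfolding is_cut_def
proof
  fix a
  show "cnt w a (M + length w + j) \<le> M + length w + j - a"
  proof (cases "M \<le> a")
    case True
    then have "cnt w a (M + length w + j) = 0" using assms by (fastforce simp: cnt_eq_0_iff)
    then show ?thesis by simp
  next
    case False then show ?thesis using cnt_le_length[of w a "M + length w + j"] by simp
  qed
qed

text \<open>A cut above all letters serves as the upper end of a block swap that must affect the
  whole rest of the alphabet.\<close>

lemma exists_large_cut:
  obtains c where "c0 \<le> c" "is_cut w c" "\<forall>x\<in>set w. x \<le> c"
proof -
  let ?M = "Max (insert 0 (set w))"
  have M: "\<forall>x\<in>set w. x \<le> ?M" by simp
  show thesis
  proof (rule that)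
    show "c0 \<le> ?M + length w + c0" by simp
    show "is_cut w (?M + length w + c0)" by (rule cut_large[OF M])
    show "\<forall>x\<in>set w. x \<le> ?M + length w + c0" using M by (meson trans_le_add1)
  qed
qed

lemma cut_length_le:
  assumes "is_cut w c" "\<forall>x\<in>set w. x \<le> c" "w \<in> words" shows "length w \<le> c"
proof -
  have "cnt w 0 c = length w" using assms by (auto simp: cnt_eq_length_iff words_iff intro: gr0I)
  then show ?thesis using cut_le[OF assms(1), of 0] by simp
qed

lemma length_block_swap [simp]: "length (block_swap a b c w) = length w"
  by (simp add: block_swap_def)

lemma block_swap_take_drop:
  "take k (block_swap a b c w) = block_swap a b c (take k w)"
  "drop k (block_swap a b c w) = block_swap a b c (drop k w)"
  by (simp_all add: block_swap_def take_map drop_map)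

lemma block_swap_words:
  assumes "a \<le> b" "b \<le> c" "w \<in> words" shows "block_swap a b c w \<in> words"
  using assms by (auto simp: words_iff block_swap_def block_shift_def)

lemma block_swap_trivial: "a \<le> b \<Longrightarrow> block_swap a b b w = w" "block_swap a a c w = w"
  by (auto simp: block_swap_def block_shift_def intro!: map_idI)

lemma block_swap_inverse:
  assumes "a \<le> b" "b \<le> c" shows "block_swap a (a + (c - b)) c (block_swap a b c w) = w"
  using assms by (auto simp: block_swap_def block_shift_def intro!: map_idI)

text \<open>A cut \<open>b'\<close> inside the left block factors the swap: the upper part
  \<open>(b', b]\<close> first passes \<open>(b, c]\<close>, then the lower part
  \<open>(a, b']\<close> does. The next lemma is the mirror image for a cut in the right
  block.\<close>

lemma block_swap_merge_left:
  assumes "a \<le> b'" "b' \<le> b" "b \<le> c"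
  shows "block_swap a b' (b' + (c - b)) (block_swap b' b c w) = block_swap a b c w"
proof -
  obtain i j k where "b' = a + i" "b = a + i + j" "c = a + i + j + k"
    using assms by (metis le_Suc_ex)
  then show ?thesis by (auto simp: block_swap_def block_shift_def)
qed

lemma block_swap_merge_right:
  assumes "a \<le> b" "b \<le> b'" "b' \<le> c"
  shows "block_swap (a + (b' - b)) b' c (block_swap a b b' w) = block_swap a b c w"
proof -
  obtain i j k where "b = a + i" "b' = a + i + j" "c = a + i + j + k"
    using assms by (metis le_Suc_ex)
  then show ?thesis by (auto simp: block_swap_def block_shift_def)
qed

lemma cnt_block_swap:
  assumes "a \<le> b" "b \<le> c"
  shows "q \<le> a \<Longrightarrow> cnt (block_swap a b c w) p q = cnt w p q"
    and "c \<le> p \<Longrightarrow> cnt (block_swap a b c w) p q = cnt w p q"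
    and "p \<le> a \<Longrightarrow> c \<le> q \<Longrightarrow> cnt (block_swap a b c w) p q = cnt w p q"
    and "a \<le> p \<Longrightarrow> q \<le> a + (c - b) \<Longrightarrow>
           cnt (block_swap a b c w) p q = cnt w (p + (b - a)) (q + (b - a))"
    and "a + (c - b) \<le> p \<Longrightarrow> p \<le> q \<Longrightarrow> q \<le> c \<Longrightarrow>
           cnt (block_swap a b c w) p q = cnt w (p - (c - b)) (q - (c - b))"
  unfolding block_swap_def
  by (rule cnt_map_cong; use assms in \<open>auto simp: block_shift_def\<close>)+

text \<open>The cuts are obtained from below by \<open>cut_extend\<close>: nothing changes up to
  \<open>a\<close>, the block moved down inherits its bounds from the cut \<open>c\<close>, the
  block moved up from the cut \<open>b\<close>, and nothing changes above \<open>c\<close>.\<close>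

lemma cut_block_swap:
  assumes "a \<le> b" "b \<le> c" "is_cut w a" "is_cut w b" "is_cut w c"
  shows cut_block_swap_lower: "o' \<le> a \<Longrightarrow> is_cut w o' \<Longrightarrow> is_cut (block_swap a b c w) o'"
    and cut_block_swap_mid: "is_cut (block_swap a b c w) (a + (c - b))"
    and cut_block_swap_upper: "c \<le> o' \<Longrightarrow> is_cut w o' \<Longrightarrow> is_cut (block_swap a b c w) o'"
proof -
  let ?v = "block_swap a b c w"
  show low: "is_cut ?v o'" if "o' \<le> a" "is_cut w o'" for o'
    using that assms by (auto simp: is_cut_def cnt_block_swap(1))
  show mid: "is_cut ?v (a + (c - b))"
  proof (rule cut_extend[OF low[of a]])
    fix p assume "a \<le> p" "p \<le> a + (c - b)"
    then show "cnt ?v p (a + (c - b)) \<le> a + (c - b) - p"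
      using cut_le[OF assms(5), of "p + (b - a)"] assms(1,2) by (simp add: cnt_block_swap(4))
  qed (use assms in auto)
  have c: "is_cut ?v c"
  proof (rule cut_extend[OF mid])
    fix p assume p: "a + (c - b) \<le> p" "p \<le> c"
    have "c - (c - b) = b" using assms by simp
    then have "cnt ?v p c = cnt w (p - (c - b)) b"
      using p assms(1,2) by (simp add: cnt_block_swap(5))
    then show "cnt ?v p c \<le> c - p"
      using cut_le[OF assms(4), of "p - (c - b)"] p assms(2) by simp
  qed (use assms in auto)
  show "is_cut ?v o'" if "c \<le> o'" "is_cut w o'" for o'
    using c that(1)
  proof (rule cut_extend)
    fix p assume "c \<le> p"
    then show "cnt ?v p o' \<le> o' - p"
      using cut_le[OF that(2)] assms(1,2) by (simp add: cnt_block_swap(2))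
  qed
qed

section \<open>Functions invariant under block swaps\<close>

definition block_sym :: "enat \<Rightarrow> (nat list \<Rightarrow> 'b) \<Rightarrow> bool" where
  "block_sym r f \<longleftrightarrow> (\<forall>w a b c. w \<in> words \<longrightarrow> a \<le> b \<longrightarrow> b \<le> c \<longrightarrow> is_cut w a \<longrightarrow> is_cut w b \<longrightarrow> is_cut w c \<longrightarrow>
     enat (cnt w a b) < r \<or> enat (cnt w b c) < r \<longrightarrow> f (block_swap a b c w) = f w)"

lemma block_symI:
  assumes "\<And>w a b c. w \<in> words \<Longrightarrow> a \<le> b \<Longrightarrow> b \<le> c \<Longrightarrow> is_cut w a \<Longrightarrow> is_cut w b \<Longrightarrow> is_cut w c \<Longrightarrow>
     enat (cnt w a b) < r \<or> enat (cnt w b c) < r \<Longrightarrow> f (block_swap a b c w) = f w"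
  shows "block_sym r f"
  using assms unfolding block_sym_def by blast

lemma block_symD:
  assumes "block_sym r f" "w \<in> words" "a \<le> b" "b \<le> c" "is_cut w a" "is_cut w b" "is_cut w c"
     "enat (cnt w a b) < r \<or> enat (cnt w b c) < r"
  shows "f (block_swap a b c w) = f w"
  using assms unfolding block_sym_def by blast

lemma block_sym_antimono: "block_sym s f \<Longrightarrow> r \<le> s \<Longrightarrow> block_sym r f"
  unfolding block_sym_def by (meson order_less_le_trans)

text \<open>It suffices to swap neighbouring blocks: a swap of larger blocks is a product of those.\<close>

lemma block_symI_adjacent:
  assumes adj: "\<And>w a b c. w \<in> words \<Longrightarrow> a < b \<Longrightarrow> b < c \<Longrightarrow> is_cut w a \<Longrightarrow> is_cut w b \<Longrightarrow> is_cut w c \<Longrightarrow>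
     \<forall>x. a < x \<and> x < c \<and> is_cut w x \<longrightarrow> x = b \<Longrightarrow>
     enat (cnt w a b) < r \<or> enat (cnt w b c) < r \<Longrightarrow> f (block_swap a b c w) = f w"
  shows "block_sym r f"
proof (rule block_symI)
  fix w a b c
  assume "w \<in> words" "a \<le> b" "b \<le> c" "is_cut w a" "is_cut w b" "is_cut w c"
     "enat (cnt w a b) < r \<or> enat (cnt w b c) < r"
  then show "f (block_swap a b c w) = f w"
  proof (induction "c - a" arbitrary: w a b c rule: less_induct)
    case less
    note cuts = less.prems(4-6)
    \<comment> \<open>Unless the swap is trivial or its blocks are neighbouring, some cut divides
      one block, and both factors of the swap span a shorter interval.\<close>
    consider "a = b \<or> b = c"
      | b' where "a < b'" "b' < b" "is_cut w b'" "b < c"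
      | b' where "b < b'" "b' < c" "is_cut w b'" "a < b"
      | "a < b" "b < c" "\<forall>x. a < x \<and> x < c \<and> is_cut w x \<longrightarrow> x = b"
      using less.prems(2,3) by (metis linorder_neqE_nat order_le_less)
    then show ?case
    proof cases
      case 1 then show ?thesis using less.prems by (auto simp: block_swap_trivial)
    next
      case (2 b')
      let ?v = "block_swap b' b c w"
      \<comment> \<open>Parts of a block with fewer than \<open>r\<close> letters again have fewer
        than \<open>r\<close> letters, so both factors are admissible.\<close>
      have small: "enat (cnt w a b') < r \<or> enat (cnt w b c) < r"
        "enat (cnt w b' b) < r \<or> enat (cnt w b c) < r"
        using less.prems(7) cnt_mono[of a a b' b w] cnt_mono[of a b' b b w] 2
        by (meson enat_ord_simps(1) le_less_trans less_imp_le order_refl)+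
      have "cnt ?v a b' = cnt w a b'" "cnt ?v b' (b' + (c - b)) = cnt w b c"
        using 2 by (simp_all add: cnt_block_swap(1) cnt_block_swap(4))
      moreover have "is_cut ?v a" by (rule cut_block_swap_lower) (use 2 cuts in simp_all)
      moreover have "is_cut ?v b'" by (rule cut_block_swap_lower) (use 2 cuts in simp_all)
      moreover have "is_cut ?v (b' + (c - b))" by (rule cut_block_swap_mid) (use 2 cuts in simp_all)
      moreover have "?v \<in> words" by (rule block_swap_words) (use 2 less.prems(1) in simp_all)
      ultimately have "f (block_swap a b' (b' + (c - b)) ?v) = f ?v"
        using 2 small by (intro less.hyps) auto
      moreover have "f ?v = f w" using 2 less.prems small by (intro less.hyps) auto
      ultimately show ?thesis using 2 block_swap_merge_left[of a b' b c w] by simp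
    next
      case (3 b')
      let ?v = "block_swap a b b' w"
      have small: "enat (cnt w a b) < r \<or> enat (cnt w b' c) < r"
        "enat (cnt w a b) < r \<or> enat (cnt w b b') < r"
        using less.prems(7) cnt_mono[of b b' c c w] cnt_mono[of b b b' c w] 3
        by (meson enat_ord_simps(1) le_less_trans less_imp_le order_refl)+
      have "b' - (b' - b) = b" "a + (b' - b) - (b' - b) = a" using 3 by auto
      then have "cnt ?v b' c = cnt w b' c" "cnt ?v (a + (b' - b)) b' = cnt w a b"
        using 3 by (simp_all add: cnt_block_swap(2) cnt_block_swap(5))
      moreover have "is_cut ?v c" by (rule cut_block_swap_upper) (use 3 cuts in simp_all)
      moreover have "is_cut ?v b'" by (rule cut_block_swap_upper) (use 3 cuts in simp_all)
      moreover have "is_cut ?v (a + (b' - b))" by (rule cut_block_swap_mid) (use 3 cuts in simp_all)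
      moreover have "?v \<in> words" by (rule block_swap_words) (use 3 less.prems(1) in simp_all)
      ultimately have "f (block_swap (a + (b' - b)) b' c ?v) = f ?v"
        using 3 small by (intro less.hyps) auto
      moreover have "f ?v = f w" using 3 less.prems small by (intro less.hyps) auto
      ultimately show ?thesis using 3 block_swap_merge_right[of a b b' c w] by simp
    next
      case 4 then show ?thesis by (intro adj less.prems(1,7) cuts)
    qed
  qed
qed

section \<open>Parkization\<close>

definition squeeze :: "nat \<Rightarrow> nat \<Rightarrow> nat list \<Rightarrow> nat list" where
  "squeeze a k w = map (\<lambda>x. if a < x then x - k else x) w"

lemma cnt_0: "w \<in> words \<Longrightarrow> cnt w 0 i = card {j. j < length w \<and> w ! j \<le> i}"
proof -
  assume "w \<in> words"
  then have "cnt w 0 i = length (filter (\<lambda>x. x \<le> i) w)"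
    unfolding cnt_def words_iff by (metis (mono_tags, lifting) filter_cong gr0I)
  then show ?thesis by (simp add: length_filter_conv_card)
qed

lemma park_d_less:
  assumes "w \<in> words" "i < park_d w" shows "i \<le> cnt w 0 i"
  using assms not_less_Least[of i "\<lambda>i. 1 \<le> i \<and> card {j. j < length w \<and> w ! j \<le> i} < i"]
  unfolding park_d_def cnt_0[OF assms(1)] by (cases i) auto

lemma park_d_le:
  assumes "w \<in> words" "cnt w 0 i < i" shows "park_d w \<le> i"
  using park_d_less[OF assms(1), of i] assms(2) by linarith

lemma park_d_eqI:
  assumes "w \<in> words" "cnt w 0 d < d" "\<And>i. i < d \<Longrightarrow> i \<le> cnt w 0 i"
  shows "park_d w = d"
proof (rule antisym)
  show "park_d w \<le> d" by (rule park_d_le) (use assms in auto)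
  have "cnt w 0 (park_d w) < park_d w" using park_d(2)[of w] assms(1) by (simp add: cnt_0)
  then show "d \<le> park_d w" using assms(3)[of "park_d w"] by linarith
qed

text \<open>A gap at \<open>a\<close> is an empty column occupying the single value
  \<open>Suc a\<close>.\<close>

definition gap :: "nat list \<Rightarrow> nat \<Rightarrow> bool" where
  "gap w a \<longleftrightarrow> is_cut w a \<and> cnt w a (Suc a) = 0"

lemma gap_park_d:
  assumes "w \<in> words" obtains a where "park_d w = Suc a" "gap w a" "cnt w 0 a = a"
proof -
  obtain a where a: "park_d w = Suc a" using park_d(1)[of w] by (cases "park_d w") auto
  have "cnt w 0 (Suc a) \<le> a" using park_d(2)[of w] assms by (simp add: cnt_0 a)
  moreover have "cnt w 0 (Suc a) = cnt w 0 a + cnt w a (Suc a)" by (intro cnt_split) auto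
  moreover have ge: "i \<le> a \<Longrightarrow> i \<le> cnt w 0 i" for i using park_d_less[OF assms, of i] a by simp
  ultimately have *: "cnt w 0 a = a" "cnt w a (Suc a) = 0" using ge[of a] by linarith+
  have "cnt w p a \<le> a - p" for p
  proof (cases "p \<le> a")
    case True
    then show ?thesis using cnt_split[of 0 p a w] ge[of p] * by simp
  qed (simp add: cnt_trivial)
  then show thesis using that[OF a] * by (simp add: gap_def is_cut_def)
qed

lemma squeeze_words: "w \<in> words \<Longrightarrow> 0 < k \<Longrightarrow> cnt w a (a + k) = 0 \<Longrightarrow> squeeze a k w \<in> words"
  by (auto simp: words_iff squeeze_def cnt_eq_0_iff)

lemma length_squeeze [simp]: "length (squeeze a k w) = length w"
  by (simp add: squeeze_def)

lemma squeeze_eq_block_swap: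
  assumes "cnt w a b = 0" "\<forall>x\<in>set w. x \<le> c" "a \<le> b"
  shows "squeeze a (b - a) w = block_swap a b c w"
  using assms by (auto simp: squeeze_def block_swap_def block_shift_def cnt_eq_0_iff)

lemma cnt_squeeze_lower:
  assumes "cnt w a (a + k) = 0" "q \<le> a" shows "cnt (squeeze a k w) p q = cnt w p q"
  unfolding squeeze_def by (rule cnt_map_cong) (use assms in \<open>auto simp: cnt_eq_0_iff\<close>)

lemma cnt_squeeze_upper:
  assumes "cnt w a (a + k) = 0" "a \<le> p" shows "cnt (squeeze a k w) p q = cnt w (p + k) (q + k)"
  unfolding squeeze_def by (rule cnt_map_cong) (use assms in \<open>auto simp: cnt_eq_0_iff\<close>)

lemma cut_squeeze:
  assumes "is_cut w a" "cnt w a (a + k) = 0"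
  shows "is_cut (squeeze a k w) a" "a \<le> b \<Longrightarrow> is_cut w (b + k) \<Longrightarrow> is_cut (squeeze a k w) b"
proof -
  show *: "is_cut (squeeze a k w) a" using assms by (simp add: is_cut_def cnt_squeeze_lower)
  show "is_cut (squeeze a k w) b" if "a \<le> b" "is_cut w (b + k)"
    using * that(1)
  proof (rule cut_extend)
    fix p assume "a \<le> p"
    then show "cnt (squeeze a k w) p b \<le> b - p"
      using cut_le[OF that(2), of "p + k"] assms by (simp add: cnt_squeeze_upper)
  qed
qed

lemma Park_unfold:
  "Park w = (if park_d w = length w + 1 then w else Park (squeeze (park_d w) 1 w))"
  unfolding squeeze_def by (rule Park.simps)

text \<open>\<open>Park\<close> decreases the letters above \<open>park_d w = Suc a\<close>; as
  \<open>Suc a\<close> does not occur, the threshold \<open>a\<close> does the same, which is the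
  form that block swaps produce.\<close>

lemma squeeze_gap: "gap w a \<Longrightarrow> squeeze (Suc a) k w = squeeze a k w"
  by (auto simp: squeeze_def gap_def cnt_eq_0_iff)

lemma Park_step:
  assumes "w \<in> words" "park_d w = Suc a" "a \<noteq> length w" shows "Park w = Park (squeeze a 1 w)"
proof -
  obtain a' where "park_d w = Suc a'" "gap w a'" using gap_park_d[OF assms(1)] .
  then have "gap w a" using assms(2) by simp
  then show ?thesis using assms Park_unfold[of w] squeeze_gap[of w a 1] by simp
qed

text \<open>The recursion of \<open>Park\<close> restated as deletion of the leftmost empty
  column.\<close>

lemma Park_induct [consumes 1, case_names parked step]:
  assumes "w \<in> words"
    and "\<And>w. w \<in> words \<Longrightarrow> park_d w = length w + 1 \<Longrightarrow> P w"
    and "\<And>w a. w \<in> words \<Longrightarrow> park_d w = Suc a \<Longrightarrow> a < length w \<Longrightarrow> gap w a \<Longrightarrow> cnt w 0 a = a \<Longrightarrow>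
           squeeze a 1 w \<in> words \<Longrightarrow> P (squeeze a 1 w) \<Longrightarrow> P w"
  shows "P w"
  using assms(1)
proof (induction w rule: Park.induct)
  case (1 w)
  obtain a where a: "park_d w = Suc a" "gap w a" "cnt w 0 a = a"
    using gap_park_d[OF 1(2)] by blast
  show ?case
  proof (cases "park_d w = length w + 1")
    case False
    have "squeeze a 1 w = map (\<lambda>x. if x > park_d w then x - 1 else x) w"
      unfolding squeeze_gap[OF a(2), of 1, symmetric] a(1) by (simp add: squeeze_def)
    moreover have sq: "squeeze a 1 w \<in> words" using 1(2) a by (intro squeeze_words) (auto simp: gap_def)
    ultimately have "P (squeeze a 1 w)" using 1(1)[OF False] by simp
    moreover have "a < length w" using False park_d(3)[of w] a by simp
    ultimately show ?thesis using assms(3) 1(2) a sq by blast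
  qed (use assms(2) 1 in blast)
qed

text \<open>\<open>Park\<close> always deletes the leftmost gap, but the order of deletion is
  immaterial. A gap at \<open>e\<close> makes \<open>Suc e\<close> deficient, so the leftmost gap
  \<open>a\<close> satisfies \<open>a \<le> e\<close>; if \<open>a < e\<close>, it survives the
  deletion at \<open>e\<close>, and the two deletions commute up to lowering \<open>e\<close> by
  one.\<close>

lemma Park_squeeze_gap:
  assumes "w \<in> words" "gap w e" shows "Park (squeeze e 1 w) = Park w"
  using assms
proof (induction w arbitrary: e rule: Park_induct)
  case (parked w)
  have "cnt w 0 (Suc e) = cnt w 0 e + cnt w e (Suc e)" by (intro cnt_split) auto
  then have "cnt w 0 (Suc e) < Suc e"
    using parked(3) cut_le[of w e 0] by (simp add: gap_def)
  \<comment> \<open>In a parking function every gap lies beyond all letters, so the deletion changes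
    nothing.\<close>
  then have "length w \<le> e" using park_d_le[OF parked(1)] parked(2) by fastforce
  moreover have "length w \<le> cnt w 0 (length w)" using park_d_less[OF parked(1)] parked(2) by simp
  then have "\<forall>x\<in>set w. x \<le> length w"
    using cnt_le_length[of w 0 "length w"] cnt_eq_length_iff[of w 0 "length w"] by auto
  ultimately have "squeeze e 1 w = w" by (auto simp: squeeze_def intro!: map_idI)
  then show ?case by simp
next
  case (step w a)
  have "cnt w 0 (Suc e) = cnt w 0 e + cnt w e (Suc e)" by (intro cnt_split) auto
  then have "cnt w 0 (Suc e) < Suc e"
    using step.prems cut_le[of w e 0] by (simp add: gap_def)
  then have "a \<le> e" using park_d_le[OF step(1)] step(2) by fastforce
  show ?case
  proof (cases "a = e")
    case True
    then show ?thesis using Park_step[OF step(1,2)] step(3) by simp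
  next
    case False
    then obtain e' where e': "e = Suc e'" "a \<le> e'" using \<open>a \<le> e\<close> by (cases e) auto
    have g: "is_cut w a" "cnt w a (a + 1) = 0" "is_cut w (e' + 1)" "cnt w (e' + 1) (Suc e' + 1) = 0"
      using step(4) step.prems e' by (auto simp: gap_def)
    have "gap (squeeze a 1 w) e'"
      unfolding gap_def using cut_squeeze(2)[OF g(1,2) e'(2) g(3)] e' g
      by (simp add: cnt_squeeze_upper)
    then have IH: "Park (squeeze e' 1 (squeeze a 1 w)) = Park w"
      using step.IH Park_step[OF step(1,2)] step(3) by simp
    let ?v = "squeeze e 1 w"
    have v: "?v \<in> words" using step(1) step.prems by (intro squeeze_words) (auto simp: gap_def)
    have low: "cnt ?v 0 i = cnt w 0 i" if "i \<le> e" for i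
      using that step.prems by (intro cnt_squeeze_lower) (auto simp: gap_def)
    have "cnt w 0 (Suc a) < Suc a"
      using park_d(2)[of w] step(1,2) by (simp add: cnt_0)
    then have "park_d ?v = Suc a"
      using e' park_d_less[OF step(1)] step(2) low by (intro park_d_eqI[OF v]) simp_all
    then have "Park ?v = Park (squeeze a 1 ?v)" using Park_step[OF v] step(3) by simp
    moreover have "squeeze a 1 ?v = squeeze e' 1 (squeeze a 1 w)"
      using e' g by (auto simp: squeeze_def cnt_eq_0_iff)
    ultimately show ?thesis using IH by simp
  qed
qed

lemma Park_squeeze:
  assumes "w \<in> words" "is_cut w a" "cnt w a (a + k) = 0" shows "Park (squeeze a k w) = Park w"
  using assms
proof (induction k arbitrary: w)
  case 0
  then show ?case by (simp add: squeeze_def cong: if_cong)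
next
  case (Suc k)
  have g: "cnt w a (a + 1) = 0" using Suc.prems(3) by (auto simp: cnt_eq_0_iff)
  let ?v = "squeeze a 1 w"
  have "Park (squeeze a k ?v) = Park ?v"
    using Suc.prems g cnt_mono[of a "Suc a" "a + Suc k" "a + Suc k" w]
    by (intro Suc.IH) (auto simp: cut_squeeze cnt_squeeze_upper squeeze_words)
  moreover have "squeeze a k ?v = squeeze a (Suc k) w"
    using Suc.prems(3) by (auto simp: squeeze_def cnt_eq_0_iff)
  moreover have "Park ?v = Park w"
    using Park_squeeze_gap[OF Suc.prems(1)] g Suc.prems(2) by (simp add: gap_def)
  ultimately show ?case by simp
qed

lemma Park_block_swap:
  assumes "w \<in> words" "a \<le> b" "b \<le> c" "is_cut w a" "is_cut w b" "is_cut w c" "cnt w a b = 0 \<or> cnt w b c = 0"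
  shows "Park (block_swap a b c w) = Park w"
proof -
  have *: "Park (block_swap a b c w) = Park w"
    if w: "w \<in> words" and abc: "a \<le> b" "b \<le> c" and cuts: "is_cut w a" "is_cut w b" "is_cut w c"
      and 0: "cnt w a b = 0" for w a b c
  proof -
    let ?v = "block_swap a b c w"
    have "c - (c - b) = b" using abc by simp
    then have "cnt ?v (a + (c - b)) c = 0"
      using abc 0 by (simp add: cnt_block_swap(5))
    then have "Park (squeeze (a + (c - b)) (b - a) ?v) = Park ?v"
      using abc cut_block_swap_mid[OF abc cuts] block_swap_words[OF abc w] by (intro Park_squeeze) auto
    moreover have "squeeze (a + (c - b)) (b - a) ?v = squeeze a (b - a) w"
      using 0 abc by (auto simp: squeeze_def block_swap_def block_shift_def cnt_eq_0_iff)
    moreover have "Park (squeeze a (b - a) w) = Park w"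
      using abc 0 cuts w by (intro Park_squeeze) auto
    ultimately show ?thesis by simp
  qed
  show ?thesis
  proof (cases "cnt w a b = 0")
    case False
    let ?v = "block_swap a b c w"
    have "cnt ?v a (a + (c - b)) = 0" using assms False by (simp add: cnt_block_swap(4))
    \<comment> \<open>If the right block is empty, the inverse swap has an empty left block.\<close>
    then have "Park (block_swap a (a + (c - b)) c ?v) = Park ?v"
      using assms cut_block_swap[OF assms(2-6)]
      by (intro *) (auto intro: block_swap_words)
    then show ?thesis using assms block_swap_inverse[of a b c w] by simp
  qed (use * assms in blast)
qed

text \<open>Each step of parkization is an admissible swap: the empty block
  \<open>(a, Suc a]\<close> is exchanged with everything above it, up to a cut beyond all
  letters.\<close>

lemma block_sym_Park:
  assumes "block_sym 1 f" "w \<in> words" shows "f (Park w) = f w"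
  using assms(2)
proof (induction w rule: Park_induct)
  case (parked w)
  then show ?case by (simp add: Park_unfold[of w])
next
  case (step w a)
  obtain c where c: "Suc a \<le> c" "is_cut w c" "\<forall>x\<in>set w. x \<le> c" by (rule exists_large_cut)
  have "is_cut w (Suc a)"
    using step(4) by (intro cut_extend[of w a "Suc a"]) (auto simp: gap_def cnt_trivial le_Suc_eq)
  then have "f (block_swap a (Suc a) c w) = f w"
    using step c by (intro block_symD[OF assms(1)]) (auto simp: gap_def one_enat_def)
  then show ?case using step c squeeze_eq_block_swap[of w a "Suc a" c]
    Park_step[OF step(1,2)] by (simp add: gap_def)
qed

text \<open>For \<open>r = 1\<close> an admissible swap has an empty block. The functions so
  characterised are those constant on parkization classes, as the series in \<open>PQSym\<close>
  are.\<close>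

lemma block_sym_1_iff:
  "block_sym 1 f \<longleftrightarrow> (\<forall>w\<in>words. f (Park w) = f w)"
proof
  assume *: "\<forall>w\<in>words. f (Park w) = f w"
  show "block_sym 1 f"
  proof (rule block_symI)
    fix w a b c
    assume w: "w \<in> words" "a \<le> b" "b \<le> c" "is_cut w a" "is_cut w b" "is_cut w c"
      and small: "enat (cnt w a b) < 1 \<or> enat (cnt w b c) < 1"
    from small have "cnt w a b = 0 \<or> cnt w b c = 0"
      by (metis enat_ord_simps(2) less_one one_enat_def)
    then have "Park (block_swap a b c w) = Park w" using w by (intro Park_block_swap)
    then show "f (block_swap a b c w) = f w" using * w block_swap_words by metis
  qed
qed (simp add: block_sym_Park)

section \<open>Parking functions\<close>

lemma sorted_nth_le_iff:
  fixes xs :: "'a::linorder list"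
  assumes "sorted xs" "i < length xs"
  shows "xs ! i \<le> k \<longleftrightarrow> i < length (filter (\<lambda>x. x \<le> k) xs)"
  using assms
proof (induction xs arbitrary: i)
  case (Cons x xs)
  show ?case
  proof (cases "x \<le> k")
    case True
    then show ?thesis using Cons by (cases i) auto
  next
    case False
    then have "\<forall>y\<in>set (x # xs). \<not> y \<le> k" using Cons.prems(1) by auto
    then show ?thesis using Cons.prems(2) by (metis filter_False list.size(3) not_less_zero nth_mem)
  qed
qed simp

lemma sort_nth_le_iff:
  assumes "u \<in> words" "i < length u"
  shows "sort u ! i \<le> k \<longleftrightarrow> i < cnt u 0 k"
proof -
  have "length (filter (\<lambda>x. x \<le> k) (sort u)) = length (filter (\<lambda>x. x \<le> k) u)"
    by (simp add: filter_sort)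
  also have "\<dots> = cnt u 0 k"
    using assms(1) by (simp add: cnt_0 length_filter_conv_card)
  finally show ?thesis using sorted_nth_le_iff[of "sort u" i k] assms(2) by simp
qed

lemma parking_iff_cnt: "parking u \<longleftrightarrow> u \<in> words \<and> (\<forall>i\<le>length u. i \<le> cnt u 0 i)"
proof -
  have "(\<forall>i<length u. i < cnt u 0 (i + 1)) \<longleftrightarrow> (\<forall>i\<le>length u. i \<le> cnt u 0 i)"
    by (metis Suc_eq_plus1 Suc_leI Suc_le_lessD le0 not0_implies_Suc le_simps(2) less_Suc_eq_le)
  then show ?thesis unfolding parking_def using sort_nth_le_iff by auto
qed

lemma prime_parking_iff_cnt:
  "prime_parking u \<longleftrightarrow> parking u \<and> (\<forall>i. 1 \<le> i \<longrightarrow> i < length u \<longrightarrow> i < cnt u 0 i)"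
proof (cases "u \<in> words")
  case True
  have "sort u ! i < i + 1 \<longleftrightarrow> i < cnt u 0 i" if "i < length u" for i
    using sort_nth_le_iff[OF True that, of i] by auto
  then show ?thesis unfolding prime_parking_def by auto
qed (simp add: prime_parking_def parking_def)

lemma parking_iff_park_d: "parking u \<longleftrightarrow> u \<in> words \<and> park_d u = length u + 1"
proof
  assume u: "parking u"
  then have "u \<in> words" "cnt u 0 (length u + 1) < length u + 1"
    by (auto simp: parking_def le_imp_less_Suc cnt_le_length)
  then show "u \<in> words \<and> park_d u = length u + 1"
    using u by (auto intro!: park_d_eqI simp: parking_iff_cnt less_Suc_eq_le)
next
  assume "u \<in> words \<and> park_d u = length u + 1"
  then show "parking u" using park_d_less[of u] by (auto simp: parking_iff_cnt)
qed

text \<open>Complementary counting: when all \<open>n\<close> letters are at most \<open>n\<close>,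
  having at least \<open>p\<close> letters up to \<open>p\<close> means having at most
  \<open>n - p\<close> letters in \<open>(p, n]\<close>.\<close>

lemma parking_iff_cut:
  "parking u \<longleftrightarrow> u \<in> words \<and> (\<forall>x\<in>set u. x \<le> length u) \<and> is_cut u (length u)"
proof -
  let ?n = "length u"
  show ?thesis
  proof (cases "u \<in> words \<and> (\<forall>x\<in>set u. x \<le> ?n)")
    case True
    then have n: "cnt u 0 ?n = ?n" by (auto simp: cnt_eq_length_iff words_iff intro: gr0I)
    have "cnt u p ?n \<le> ?n - p \<longleftrightarrow> p \<le> cnt u 0 p" if "p \<le> ?n" for p
      using cnt_split[of 0 p ?n u] that n by auto
    moreover have "is_cut u ?n \<longleftrightarrow> (\<forall>p\<le>?n. cnt u p ?n \<le> ?n - p)"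
      unfolding is_cut_def by (metis cnt_trivial linorder_linear zero_le)
    ultimately show ?thesis using True by (simp add: parking_iff_cnt)
  next
    case False
    have "\<forall>x\<in>set u. x \<le> ?n" if "parking u"
    proof -
      have "cnt u 0 ?n = ?n"
        using that cnt_le_length[of u 0 ?n] by (auto simp: parking_iff_cnt intro: antisym)
      then show ?thesis by (simp add: cnt_eq_length_iff)
    qed
    then show ?thesis using False by (auto simp: parking_def)
  qed
qed

lemma parking_words: "parking u \<Longrightarrow> u \<in> words"
  by (simp add: parking_def)

lemma Park_parking: "parking u \<Longrightarrow> Park u = u"
  by (simp add: parking_iff_park_d Park_unfold[of u])

lemma parking_Park: "w \<in> words \<Longrightarrow> parking (Park w)"
proof (induction w rule: Park_induct)
  case (parked w)
  then show ?case using Park_parking[of w] by (simp add: parking_iff_park_d)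
next
  case (step w a)
  then show ?case using Park_step[OF step(1,2)] by simp
qed

lemma length_Park [simp]: "length (Park w) = length w"
proof (induction w rule: Park.induct)
  case (1 w)
  then show ?case by (subst Park.simps) auto
qed

lemma Park_words: "w \<in> words \<Longrightarrow> Park w \<in> words"
  by (simp add: parking_Park parking_words)

lemma finite_parking: "finite {u. parking u \<and> length u \<le> n}"
  by (rule finite_subset[OF _ finite_lists_length_le[of "{..n}" n]])
     (auto simp: parking_iff_cut dest: order_trans)


section \<open>Columns\<close>

text \<open>Column \<open>j\<close>, counted from \<open>0\<close>, carries exactly the letters in
  \<open>(offset m j, offset m (Suc j)]\<close>.\<close>

definition offset :: "columns \<Rightarrow> nat \<Rightarrow> nat" where
  "offset m j = (\<Sum>q<j. col_size (fst (m q)))"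

lemma bij_betw_rank:
  fixes L :: "nat set"
  assumes "finite L"
  shows "bij_betw (\<lambda>p. card {q \<in> L. q < p}) L {..<card L}"
proof -
  let ?r = "\<lambda>p. card {q \<in> L. q < p}"
  have less: "?r p < ?r p'" if "p \<in> L" "p < p'" for p p'
    by (rule psubset_card_mono) (use assms that in auto)
  then have inj: "inj_on ?r L"
    by (metis (no_types, lifting) inj_onI linorder_neqE_nat nat_neq_iff)
  have "?r p < card L" if "p \<in> L" for p
    by (rule psubset_card_mono) (use assms that in auto)
  then have "?r ` L \<subseteq> {..<card L}" by auto
  then have "?r ` L = {..<card L}"
    by (rule card_subset_eq[rotated]) (simp_all add: card_image[OF inj])
  with inj show ?thesis by (simp add: bij_betw_def)
qed

text \<open>Columns contain positions counted from \<open>1\<close>, lists are indexed from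
  \<open>0\<close>; this is where the two conventions meet.\<close>

lemma cnt_eq_card: "cnt w a b = card {p \<in> {1..length w}. a < w ! (p - 1) \<and> w ! (p - 1) \<le> b}"
proof -
  have "{p \<in> {1..length w}. a < w ! (p - 1) \<and> w ! (p - 1) \<le> b} =
      Suc ` {p. p < length w \<and> a < w ! p \<and> w ! p \<le> b}"
    by (auto simp: image_iff) (metis Suc_le_eq Suc_pred)
  then show ?thesis by (simp add: cnt_def length_filter_conv_card card_image)
qed

lemma BW_D:
  assumes "m \<in> BW"
  shows "fst (m i) \<inter> fst (m j) \<noteq> {} \<Longrightarrow> i = j"
    and "prime_parking (snd (m i))" "length (snd (m i)) = card (fst (m i))" "finite (fst (m i))"
proof -
  from assms obtain n where n: "(\<Union>i. fst (m i)) = {1..n}" by (auto simp: BW_def)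
  show "fst (m i) \<inter> fst (m j) \<noteq> {} \<Longrightarrow> i = j" using assms by (auto simp: BW_def)
  show "prime_parking (snd (m i))" "length (snd (m i)) = card (fst (m i))"
    using assms by (auto simp: BW_def)
  show "finite (fst (m i))" by (rule finite_subset[of _ "{1..n}"]) (use n in auto)
qed

lemma prime_parking_letter: "prime_parking M \<Longrightarrow> x \<in> set M \<Longrightarrow> 0 < x \<and> x \<le> length M"
  by (auto simp: prime_parking_def parking_iff_cut words_iff intro: gr0I)

lemma BW_words_UN:
  assumes "m \<in> BW" shows "(\<Union>i. fst (m i)) = {1..length (Phi m)}"
proof -
  obtain n where "(\<Union>i. fst (m i)) = {1..n}" using assms by (auto simp: BW_def)
  then show ?thesis by (simp add: Phi_def)
qed

lemma Phi_nth:
  assumes "m \<in> BW" "p \<in> fst (m j)"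
  shows "Phi m ! (p - 1) = snd (m j) ! card {q \<in> fst (m j). q < p} + offset m j"
proof -
  have p: "1 \<le> p" "p \<le> length (Phi m)" using BW_words_UN[OF assms(1)] assms(2) by auto
  have "(THE j. p \<in> fst (m j)) = j"
    using assms BW_D(1)[OF assms(1)] by (intro the_equality) blast+
  moreover have "[1..<Suc (card (\<Union>i. fst (m i)))] ! (p - 1) = p"
    using p by (subst nth_upt) (simp_all add: Phi_def del: upt_Suc)
  ultimately show ?thesis
    using p unfolding Phi_def length_map length_upt offset_def Let_def by (subst nth_map) simp_all
qed

lemma rank_less:
  assumes "m \<in> BW" "p \<in> fst (m j)"
  shows "card {q \<in> fst (m j). q < p} < length (snd (m j))"
  using bij_betw_rank[OF BW_D(4)[OF assms(1)], of j] assms(2) BW_D(3)[OF assms(1), of j]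
  by (auto simp: bij_betw_def)

lemma offset_Suc: "offset m (Suc j) = offset m j + col_size (fst (m j))"
  by (simp add: offset_def)

lemma Phi_bounds:
  assumes "m \<in> BW" "p \<in> fst (m j)"
  shows "offset m j < Phi m ! (p - 1)" "Phi m ! (p - 1) \<le> offset m (Suc j)"
proof -
  let ?x = "snd (m j) ! card {q \<in> fst (m j). q < p}"
  have "?x \<in> set (snd (m j))" using rank_less[OF assms] by simp
  then have "0 < ?x" "?x \<le> card (fst (m j))"
    using prime_parking_letter[OF BW_D(2)[OF assms(1)], of ?x j] BW_D(3)[OF assms(1), of j] by auto
  moreover have "col_size (fst (m j)) = card (fst (m j))" using assms(2) by (auto simp: col_size_def)
  ultimately show "offset m j < Phi m ! (p - 1)" "Phi m ! (p - 1) \<le> offset m (Suc j)"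
    using Phi_nth[OF assms] by (auto simp: offset_Suc)
qed

text \<open>Strictness relies on the convention that an empty column has size
  \<open>1\<close>.\<close>

lemma strict_mono_offset:
  assumes "m \<in> BW" shows "strict_mono (offset m)"
  unfolding strict_mono_Suc_iff
proof
  fix j
  have "0 < col_size (fst (m j))" using BW_D(4)[OF assms, of j] by (auto simp: col_size_def card_gt_0_iff)
  then show "offset m j < offset m (Suc j)" by (simp add: offset_Suc)
qed

lemma strict_mono_interval_unique:
  fixes h :: "nat \<Rightarrow> nat"
  assumes "strict_mono h" "h i < x" "x \<le> h (Suc i)" "h j < x" "x \<le> h (Suc j)"
  shows "i = j"
proof (rule ccontr)
  assume "i \<noteq> j"
  then consider "Suc i \<le> j" | "Suc j \<le> i" by linarith
  then show False
    using assms by cases (meson leD le_less_trans monoD strict_mono_mono order_less_le_trans)+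
qed

lemma Phi_words: "m \<in> BW \<Longrightarrow> Phi m \<in> words"
proof -
  assume m: "m \<in> BW"
  have "0 < Phi m ! k" if "k < length (Phi m)" for k
  proof -
    have "Suc k \<in> (\<Union>i. fst (m i))" using that BW_words_UN[OF m] by auto
    then show ?thesis using Phi_bounds(1)[OF m, of "Suc k"] by force
  qed
  then show ?thesis by (auto simp: words_iff in_set_conv_nth)
qed

lemma Phi_interval_iff:
  assumes "m \<in> BW" "p \<in> {1..length (Phi m)}"
  shows "offset m j < Phi m ! (p - 1) \<and> Phi m ! (p - 1) \<le> offset m (Suc j) \<longleftrightarrow> p \<in> fst (m j)"
proof -
  obtain j' where j': "p \<in> fst (m j')" using assms BW_words_UN by blast
  show ?thesis
    using Phi_bounds[OF assms(1)] j' strict_mono_interval_unique[OF strict_mono_offset[OF assms(1)]]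
    by metis
qed

text \<open>Within its interval the word is the word of column \<open>j\<close> raised by the
  offset, and the rank function is a bijection from the positions of the column to the indices of
  that word.\<close>

lemma cnt_Phi:
  assumes "m \<in> BW" "i \<le> col_size (fst (m j))"
  shows "cnt (Phi m) (offset m j) (offset m j + i) = cnt (snd (m j)) 0 i"
proof -
  let ?L = "fst (m j)" and ?M = "snd (m j)" and ?w = "Phi m"
  let ?r = "\<lambda>p. card {q \<in> ?L. q < p}"
  note bij = bij_betw_rank[OF BW_D(4)[OF assms(1)], of j]
  have le: "offset m j + i \<le> offset m (Suc j)" using assms(2) by (simp add: offset_Suc)
  have "{p \<in> {1..length ?w}. offset m j < ?w ! (p - 1) \<and> ?w ! (p - 1) \<le> offset m j + i} =
      {p \<in> ?L. ?M ! ?r p \<le> i}" (is "?A = ?B")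
  proof (rule set_eqI)
    fix p
    show "p \<in> ?A \<longleftrightarrow> p \<in> ?B"
    proof (cases "p \<in> ?L")
      case True
      then have "p \<in> {1..length ?w}" using BW_words_UN[OF assms(1)] by blast
      then show ?thesis using True Phi_nth[OF assms(1) True] Phi_bounds[OF assms(1) True] by simp
    next
      case False
      then show ?thesis using Phi_interval_iff[OF assms(1), of p j] le by auto
    qed
  qed
  then have "cnt ?w (offset m j) (offset m j + i) = card ?B" by (simp add: cnt_eq_card)
  also have "\<dots> = card (?r ` ?B)"
    by (rule card_image[symmetric]) (rule inj_on_subset[OF bij_betw_imp_inj_on[OF bij]], auto)
  also have "?r ` ?B = {t. t < length ?M \<and> ?M ! t \<le> i}"
  proof -
    have "?r ` ?L = {..<length ?M}" using bij BW_D(3)[OF assms(1), of j] by (simp add: bij_betw_def)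
    moreover have "?r ` ?B = {t \<in> ?r ` ?L. ?M ! t \<le> i}" by auto
    ultimately show ?thesis by auto
  qed
  also have "card \<dots> = cnt ?M 0 i"
    using BW_D(2)[OF assms(1), of j] by (simp add: cnt_0 prime_parking_def parking_words)
  finally show ?thesis .
qed

lemma col_size_eq:
  assumes "m \<in> BW"
  shows "length (snd (m j)) = 0 \<and> col_size (fst (m j)) = 1 \<or>
         length (snd (m j)) = col_size (fst (m j))"
  using BW_D(3,4)[OF assms, of j] by (auto simp: col_size_def)

lemma cnt_Phi_column:
  assumes "m \<in> BW"
  shows "cnt (Phi m) (offset m j) (offset m (Suc j)) = length (snd (m j))"
proof -
  have "cnt (snd (m j)) 0 (col_size (fst (m j))) = length (snd (m j))"
    using col_size_eq[OF assms, of j] prime_parking_letter[OF BW_D(2)[OF assms], of _ j]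
    by (auto simp: cnt_eq_length_iff)
  then show ?thesis using cnt_Phi[OF assms order_refl, of j] by (simp add: offset_Suc)
qed

text \<open>Induction along the columns: the parking condition bounds the letters among the first
  \<open>i\<close> values of a column from below, hence those among the remaining values from
  above.\<close>

lemma cut_offset:
  assumes "m \<in> BW" shows "is_cut (Phi m) (offset m j)"
proof (induction j)
  case 0
  show ?case by (simp add: offset_def cut_0)
next
  case (Suc j)
  let ?o = "offset m j" and ?s = "col_size (fst (m j))"
  show ?case
  proof (rule cut_extend[OF Suc])
    show "?o \<le> offset m (Suc j)" by (simp add: offset_Suc)
    fix p assume p: "?o \<le> p" "p \<le> offset m (Suc j)"
    then obtain i where i: "p = ?o + i" "i \<le> ?s" by (auto simp: offset_Suc le_iff_add)
    have "cnt (Phi m) ?o (offset m (Suc j)) = cnt (Phi m) ?o p + cnt (Phi m) p (offset m (Suc j))"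
      using p by (intro cnt_split)
    then have *: "length (snd (m j)) = cnt (snd (m j)) 0 i + cnt (Phi m) p (offset m (Suc j))"
      using cnt_Phi_column[OF assms, of j] cnt_Phi[OF assms i(2)] i(1) by simp
    have "parking (snd (m j))" using BW_D(2)[OF assms] by (simp add: prime_parking_def)
    then have "i \<le> length (snd (m j)) \<Longrightarrow> i \<le> cnt (snd (m j)) 0 i" by (simp add: parking_iff_cnt)
    then show "cnt (Phi m) p (offset m (Suc j)) \<le> offset m (Suc j) - p"
      using * col_size_eq[OF assms, of j] i by (auto simp: offset_Suc)
  qed
qed

lemma strict_mono_interval_ex:
  fixes h :: "nat \<Rightarrow> nat"
  assumes "strict_mono h" "h 0 \<le> x"
  obtains j where "h j \<le> x" "x < h (Suc j)"
proof -
  have "x < h (Suc x)" using strict_mono_imp_increasing[OF assms(1), of "Suc x"] by simp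
  define j where "j = (LEAST j. x < h (Suc j))"
  have "x < h (Suc j)" unfolding j_def by (rule LeastI) fact
  moreover have "h j \<le> x"
  proof (cases j)
    case (Suc i)
    then show ?thesis using not_less_Least[of i "\<lambda>j. x < h (Suc j)"] by (auto simp: j_def)
  qed (use assms in simp)
  ultimately show thesis using that by blast
qed

text \<open>Here primality enters: at an inner value \<open>i\<close> of a column there are already
  more than \<open>i\<close> letters of that column, which contradicts a cut there. The offsets are
  thus recovered from the word.\<close>

lemma range_offset:
  assumes "m \<in> BW" shows "range (offset m) = {c. is_cut (Phi m) c}"
proof safe
  fix c assume c: "is_cut (Phi m) c"
  obtain j where j: "offset m j \<le> c" "c < offset m (Suc j)"
    by (rule strict_mono_interval_ex[OF strict_mono_offset[OF assms], of c]) (simp_all add: offset_def)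
  have "c = offset m j"
  proof (rule ccontr)
    assume "c \<noteq> offset m j"
    define i where "i = c - offset m j"
    have i: "1 \<le> i" "i < col_size (fst (m j))" "c = offset m j + i"
      using j \<open>c \<noteq> offset m j\<close> by (auto simp: i_def offset_Suc)
    then have "i < cnt (snd (m j)) 0 i"
      using BW_D(2)[OF assms, of j] col_size_eq[OF assms, of j] by (auto simp: prime_parking_iff_cnt)
    then show False
      using cnt_Phi[OF assms, of i j] i cut_le[OF c, of "offset m j"] by simp
  qed
  then show "c \<in> range (offset m)" by simp
qed (rule cut_offset[OF assms])

lemma strict_mono_range_unique:
  fixes g h :: "nat \<Rightarrow> nat"
  assumes "strict_mono g" "strict_mono h" "range g = range h" shows "g = h"
proof
  have *: "g n \<le> h n" if gh: "strict_mono g" "strict_mono h" "range h = range g"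
    and IH: "\<And>m. m < n \<Longrightarrow> g m = h m" for g h :: "nat \<Rightarrow> nat" and n
  proof -
    obtain k where k: "h n = g k" using gh(3) by (metis rangeE rangeI)
    have "\<not> k < n" using IH[of k] k gh(2) by (metis order_less_irrefl strict_mono_less)
    then show ?thesis using k gh(1) by (simp add: strict_mono_less_eq)
  qed
  fix n show "g n = h n"
    by (induction n rule: less_induct) (metis * assms antisym)
qed

section \<open>Column decomposition of a word\<close>

text \<open>Between neighbouring cuts lies either an empty column or the counting pattern of a prime
  parking function. A value \<open>i\<close> that is no cut has some \<open>p\<close> with too many
  letters in \<open>(p, i]\<close>; if \<open>p \<le> a\<close>, the cut at \<open>a\<close> forces
  the excess into \<open>(a, i]\<close>, and otherwise the claim for the smaller value
  \<open>p\<close> adds its own surplus.\<close>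

lemma adjacent_cuts:
  assumes cuts: "is_cut w a" "is_cut w b" "a < b" and adj: "\<And>x. a < x \<Longrightarrow> x < b \<Longrightarrow> \<not> is_cut w x"
  shows "\<And>i. a < i \<Longrightarrow> i < b \<Longrightarrow> i - a < cnt w a i"
    and "cnt w a b = 0 \<and> b = Suc a \<or> cnt w a b = b - a"
proof -
  show *: "i - a < cnt w a i" if "a < i" "i < b" for i
    using that
  proof (induction i rule: less_induct)
    case (less i)
    obtain p where p: "i - p < cnt w p i"
      using adj[OF less.prems] by (auto simp: is_cut_def not_le)
    then have "p < i" by (metis cnt_trivial not_less not_less_zero)
    consider "p \<le> a" | "a < p" by linarith
    then show ?case
    proof cases
      case 1
      then have "cnt w p i = cnt w p a + cnt w a i" using less by (intro cnt_split) auto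
      then show ?thesis using p cut_le[OF cuts(1), of p] 1 less by simp
    next
      case 2
      then have "cnt w a i = cnt w a p + cnt w p i" using \<open>p < i\<close> by (intro cnt_split) auto
      moreover have "p - a < cnt w a p" using less \<open>p < i\<close> 2 by simp
      ultimately show ?thesis using p 2 \<open>p < i\<close> by simp
    qed
  qed
  have le: "cnt w a b \<le> b - a" by (rule cut_le[OF cuts(2)])
  show "cnt w a b = 0 \<and> b = Suc a \<or> cnt w a b = b - a"
  proof (cases "b = Suc a")
    case False
    then have "b - 1 - a < cnt w a (b - 1)" using cuts(3) by (intro *) auto
    moreover have "cnt w a (b - 1) \<le> cnt w a b" by (rule cnt_mono) auto
    ultimately show ?thesis using le by simp
  qed (use le in auto)
qed

lemma nth_filter_rank:
  assumes "p < length w" "P (w ! p)"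
  shows "filter P w ! card {q. q < p \<and> P (w ! q)} = w ! p"
proof -
  have "{q. q < p \<and> P (w ! q)} = {q. q < length (take p w) \<and> P (take p w ! q)}"
    using assms(1) by auto
  then have "card {q. q < p \<and> P (w ! q)} = length (filter P (take p w))"
    by (simp add: length_filter_conv_card)
  moreover have "filter P w = filter P (take p w) @ w ! p # filter P (drop (Suc p) w)"
    using assms by (metis filter.simps(2) filter_append id_take_nth_drop)
  ultimately show ?thesis by simp
qed

text \<open>The columns of the preimage are delimited by consecutive cuts of \<open>w\<close>, and
  \<open>adjacent_cuts\<close> makes them prime or empty.\<close>

lemma Phi_surj:
  assumes "w \<in> words" shows "\<exists>m\<in>BW. Phi m = w"
proof -
  define C where "C = {x. is_cut w x}"
  \<comment> \<open>There are arbitrarily large cuts, so they can be enumerated as an infinite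
    increasing sequence; the surplus ones yield the infinitely many empty columns.\<close>
  have "\<exists>y>x. y \<in> C" for x
    using exists_large_cut[of "Suc x" w] unfolding C_def by (metis Suc_le_lessD mem_Collect_eq)
  then have inf: "infinite C" by (simp add: infinite_nat_iff_unbounded)
  define c where "c = enumerate C"
  have c: "strict_mono c" "range c = C"
    using inf by (simp_all add: c_def strict_mono_enumerate range_enumerate)
  have c0: "c 0 = 0"
    using cut_0[of w] c unfolding C_def
    by (metis (no_types, lifting) UNIV_I image_iff le_zero_eq mem_Collect_eq strict_mono_less_eq zero_le)
  have cut: "is_cut w (c j)" for j using c(2) by (auto simp: C_def)
  have adj: "\<not> is_cut w x" if "c j < x" "x < c (Suc j)" for j x
  proof
    assume "is_cut w x"
    then obtain k where "x = c k" using c(2) by (auto simp: C_def)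
    then show False using that c(1) by (auto simp: strict_mono_less)
  qed
  have lt: "c j < c (Suc j)" for j using c(1) by (simp add: strict_mono_Suc_iff)
  have col: "c j < i \<Longrightarrow> i < c (Suc j) \<Longrightarrow> i - c j < cnt w (c j) i"
    "cnt w (c j) (c (Suc j)) = 0 \<and> c (Suc j) = Suc (c j) \<or> cnt w (c j) (c (Suc j)) = c (Suc j) - c j"
    for i j
    using adjacent_cuts[OF cut cut lt, of j] adj[of j] by blast+
  define P where "P j x \<longleftrightarrow> c j < x \<and> x \<le> c (Suc j)" for j x
  define m :: columns where
    "m j = ({p \<in> {1..length w}. P j (w ! (p - 1))}, map (\<lambda>x. x - c j) (filter (P j) w))" for j
  have len: "length (snd (m j)) = cnt w (c j) (c (Suc j))" for j
    by (simp add: m_def cnt_def P_def[abs_def])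
  have card: "card (fst (m j)) = cnt w (c j) (c (Suc j))" for j
    by (simp add: m_def cnt_eq_card P_def)
  have ex: "\<exists>j. P j x" if "0 < x" for x
  proof -
    obtain j where "c j \<le> x - 1" "x - 1 < c (Suc j)"
      by (rule strict_mono_interval_ex[OF c(1), of "x - 1"]) (simp_all add: c0)
    then show ?thesis using that by (intro exI[of _ j]) (auto simp: P_def)
  qed
  have uniq: "P i x \<Longrightarrow> P j x \<Longrightarrow> i = j" for i j x
    using strict_mono_interval_unique[OF c(1)] by (auto simp: P_def)
  have M: "cnt (snd (m j)) 0 i = cnt w (c j) (c j + i)" if "i \<le> c (Suc j) - c j" for i j
  proof -
    have "cnt (snd (m j)) 0 i = cnt (filter (P j) w) (c j) (c j + i)"
      unfolding m_def snd_conv by (rule cnt_map_cong) (auto simp: P_def)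
    also have "\<dots> = cnt w (c j) (c j + i)"
      using that lt[of j] by (simp add: cnt_def P_def) (intro arg_cong[where f = length] filter_cong, auto)
    finally show ?thesis .
  qed
  have prime: "prime_parking (snd (m j))" for j
  proof -
    have w: "snd (m j) \<in> words" by (auto simp: m_def words_iff P_def)
    have small: "i < cnt (snd (m j)) 0 i" if "1 \<le> i" "i < length (snd (m j))" for i
    proof -
      have i: "i < c (Suc j) - c j" using that col(2)[of j] len[of j] by auto
      then have "c j + i - c j < cnt w (c j) (c j + i)" using that by (intro col(1)) auto
      then show ?thesis using M[of i j] i by simp
    qed
    have "i \<le> cnt (snd (m j)) 0 i" if le: "i \<le> length (snd (m j))" for i
    proof -
      consider "i = 0" | "1 \<le> i" "i < length (snd (m j))" | "1 \<le> i" "i = length (snd (m j))"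
        using le by linarith
      then show ?thesis
      proof cases
        case 3
        then have "i = c (Suc j) - c j" using col(2)[of j] len[of j] by auto
        then show ?thesis using M[of i j] 3 len[of j] lt[of j] by simp
      qed (use small in \<open>auto intro: less_imp_le\<close>)
    qed
    then show ?thesis using w small by (simp add: prime_parking_iff_cnt parking_iff_cnt)
  qed
  have un: "(\<Union>j. fst (m j)) = {1..length w}"
  proof -
    have "\<exists>j. P j (w ! (p - 1))" if "1 \<le> p" "p \<le> length w" for p
      using that assms by (intro ex) (metis One_nat_def Suc_le_eq Suc_pred gr0I nth_mem words_iff)
    then show ?thesis by (auto simp: m_def)
  qed
  have disj: "fst (m i) \<inter> fst (m j) = {}" if "i \<noteq> j" for i j
    using that uniq by (auto simp: m_def)
  have BW: "m \<in> BW"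
    unfolding BW_def mem_Collect_eq using un disj prime len card by (intro conjI exI[of _ "length w"]) simp_all
  \<comment> \<open>An empty interval between neighbouring cuts has width \<open>1\<close>, in
    agreement with \<open>col_size {} = 1\<close>.\<close>
  have size: "col_size (fst (m j)) = c (Suc j) - c j" for j
  proof -
    have "fst (m j) = {} \<longleftrightarrow> card (fst (m j)) = 0" using BW_D(4)[OF BW] by simp
    then show ?thesis using col(2)[of j] card[of j] lt[of j] by (auto simp: col_size_def)
  qed
  have off: "offset m j = c j" for j
  proof (induction j)
    case 0 then show ?case by (simp add: offset_def c0)
  next
    case (Suc j) then show ?case using lt[of j] by (simp add: offset_Suc size)
  qed
  have "length (Phi m) = length w"
    using BW_words_UN[OF BW] un by auto
  moreover have "Phi m ! k = w ! k" if k: "k < length w" for k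
  proof -
    have "0 < w ! k" using assms k by (metis gr0I nth_mem words_iff)
    then obtain j where j: "P j (w ! k)" using ex by blast
    then have p: "Suc k \<in> fst (m j)" using k by (simp add: m_def)
    \<comment> \<open>\<open>Suc\<close> translates indices into positions and preserves
      ranks.\<close>
    have "{q \<in> fst (m j). q < Suc k} = Suc ` {q. q < k \<and> P j (w ! q)}"
      using k by (auto simp: m_def image_iff) (metis Suc_le_D Suc_less_eq diff_Suc_1 One_nat_def)
    then have r: "card {q \<in> fst (m j). q < Suc k} = card {q. q < k \<and> P j (w ! q)}"
      by (simp add: card_image)
    have "card {q. q < k \<and> P j (w ! q)} < length (filter (P j) w)"
      using rank_less[OF BW p] r by (simp add: m_def)
    then have "snd (m j) ! card {q \<in> fst (m j). q < Suc k} = w ! k - c j"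
      using nth_filter_rank[OF k, of "P j"] j unfolding r by (simp add: m_def)
    then show ?thesis using Phi_nth[OF BW p] j by (simp add: off P_def)
  qed
  ultimately show ?thesis using BW by (metis nth_equalityI)
qed

section \<open>The swaps\<close>

definition column_swap :: "nat \<Rightarrow> columns \<Rightarrow> columns" where
  "column_swap i m = m(i := m (Suc i), Suc i := m i)"

lemma column_swap_eq: "column_swap i m = (\<lambda>j. m (if j = i then Suc i else if j = Suc i then i else j))"
  by (auto simp: column_swap_def)

lemma column_swap_BW:
  assumes "m \<in> BW" shows "column_swap i m \<in> BW"
proof -
  define t where "t j = (if j = i then Suc i else if j = Suc i then i else j)" for j
  have "surj t" by (rule surjI[of t t]) (auto simp: t_def)
  moreover have "(\<Union>j. fst (m (t j))) = (\<Union>j\<in>range t. fst (m j))" by auto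
  ultimately have "(\<Union>j. fst (m (t j))) = (\<Union>j. fst (m j))" by simp
  moreover have "inj t" by (auto simp: inj_def t_def)
  moreover have "column_swap i m = (\<lambda>j. m (t j))" by (simp add: column_swap_eq t_def)
  ultimately show ?thesis using assms by (simp add: BW_def inj_eq)
qed

lemma offset_column_swap:
  "offset (column_swap i m) j =
     (if j = Suc i then offset m i + (offset m (Suc (Suc i)) - offset m (Suc i)) else offset m j)"
proof -
  have low: "offset (column_swap i m) j = offset m j" if "j \<le> i" for j
    unfolding offset_def by (rule sum.cong) (use that in \<open>auto simp: column_swap_def\<close>)
  have "offset (column_swap i m) (Suc (Suc i) + k) = offset m (Suc (Suc i) + k)" for k
    by (induction k) (simp_all add: offset_Suc low, simp_all add: column_swap_def)
  then have "offset (column_swap i m) j = offset m j" if "Suc (Suc i) \<le> j" for j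
    using that le_Suc_ex by blast
  then show ?thesis
    using low low[of i]
    by (cases "j \<le> i"; cases "j = Suc i") (auto simp: offset_Suc, simp add: column_swap_def)
qed

text \<open>The bridge from columns to words: exchanging neighbouring columns exchanges the
  corresponding intervals of the alphabet.\<close>

lemma Phi_column_swap:
  assumes "m \<in> BW"
  shows "Phi (column_swap i m) =
    block_swap (offset m i) (offset m (Suc i)) (offset m (Suc (Suc i))) (Phi m)"
proof (rule nth_equalityI)
  let ?m = "column_swap i m" and ?a = "offset m i" and ?b = "offset m (Suc i)"
    and ?c = "offset m (Suc (Suc i))"
  note BW' = column_swap_BW[OF assms, of i]
  have "(\<Union>j. fst (?m j)) = (\<Union>j. fst (m j))"
    by (auto simp: column_swap_def split: if_splits) (metis n_not_Suc_n)
  then have "{1..length (Phi ?m)} = {1..length (Phi m)}"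
    using BW_words_UN[OF assms] BW_words_UN[OF BW'] by simp
  then show len: "length (Phi ?m) = length (block_swap ?a ?b ?c (Phi m))"
    by (metis card_atLeastAtMost diff_Suc_1 length_block_swap)
  fix k assume "k < length (Phi ?m)"
  then have k: "k < length (Phi m)" using len by simp
  then have "Suc k \<in> (\<Union>j. fst (m j))" using BW_words_UN[OF assms] by auto
  then obtain j where j: "Suc k \<in> fst (m j)" by blast
  \<comment> \<open>\<open>j'\<close> is the new index of the column containing the position. Its
    content is unchanged, so the letter changes by the difference of the two offsets.\<close>
  define j' where "j' = (if j = i then Suc i else if j = Suc i then i else j)"
  have mj: "?m j' = m j" by (simp add: column_swap_eq j'_def)
  then have "Suc k \<in> fst (?m j')" using j by simp
  from Phi_nth[OF BW' this] Phi_nth[OF assms j]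
  have 1: "Phi ?m ! k + offset m j = Phi m ! k + offset ?m j'" by (simp add: mj)
  have bnd: "offset m j < Phi m ! k" "Phi m ! k \<le> offset m (Suc j)"
    using Phi_bounds[OF assms j] by auto
  note sm = strict_mono_offset[OF assms]
  have abc: "?a < ?b" "?b < ?c" using sm by (simp_all add: strict_mono_less)
  consider "j < i" | "j = i" | "j = Suc i" | "Suc (Suc i) \<le> j" by linarith
  then have "Phi ?m ! k = block_shift ?a ?b ?c (Phi m ! k)"
  proof cases
    case 1
    then have "offset m (Suc j) \<le> ?a" using sm by (simp add: strict_mono_less_eq)
    then show ?thesis using 1 \<open>Phi ?m ! k + offset m j = _\<close> bnd abc
      by (simp add: block_shift_def j'_def offset_column_swap)
  next
    case 2
    then show ?thesis using 1 bnd abc by (simp add: block_shift_def j'_def offset_column_swap)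
  next
    case 3
    then show ?thesis using 1 bnd abc by (simp add: block_shift_def j'_def offset_column_swap)
  next
    case 4
    then have "?c \<le> offset m j" using sm by (simp add: strict_mono_less_eq)
    then show ?thesis using 1 4 bnd abc by (simp add: block_shift_def j'_def offset_column_swap)
  qed
  then show "Phi ?m ! k = block_swap ?a ?b ?c (Phi m) ! k" using k by (simp add: block_swap_def)
qed

lemma Phi_col_swap:
  assumes "m \<in> BW"
  shows "Phi (col_swap r i m) =
    (if enat (cnt (Phi m) (offset m i) (offset m (Suc i))) < r \<or>
        enat (cnt (Phi m) (offset m (Suc i)) (offset m (Suc (Suc i)))) < r
     then block_swap (offset m i) (offset m (Suc i)) (offset m (Suc (Suc i))) (Phi m) else Phi m)"
  using Phi_column_swap[OF assms, of i]
  by (simp add: col_swap_def cnt_Phi_column[OF assms] column_swap_def)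

text \<open>The preimage chosen by \<open>inv_into\<close> and \<open>m\<close> have the same
  offsets, since both sequences enumerate the cuts of the same word, and the swapped word depends
  only on the word and the offsets.\<close>

lemma word_swap_Phi:
  assumes "m \<in> BW" shows "word_swap r i (Phi m) = Phi (col_swap r i m)"
proof -
  let ?m = "inv_into BW Phi (Phi m)"
  have m: "?m \<in> BW" "Phi ?m = Phi m"
    using assms by (simp_all add: inv_into_into f_inv_into_f)
  then have "offset ?m = offset m"
    using assms by (intro strict_mono_range_unique) (simp_all add: strict_mono_offset range_offset)
  then show ?thesis unfolding word_swap_def Phi_col_swap[OF m(1)] Phi_col_swap[OF assms] m(2) by simp
qed

lemma word_swap_involution:
  assumes "w \<in> words"
  shows "word_swap r i w \<in> words" "word_swap r i (word_swap r i w) = w"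
proof -
  obtain m where m: "m \<in> BW" "Phi m = w" using Phi_surj[OF assms] by blast
  have 1: "col_swap r i m \<in> BW"
    using column_swap_BW[OF m(1), of i] m(1) by (simp add: col_swap_def column_swap_def)
  have 2: "col_swap r i (col_swap r i m) = m" by (auto simp: col_swap_def)
  show "word_swap r i w \<in> words" using Phi_words[OF 1] word_swap_Phi[OF m(1)] m(2) by simp
  show "word_swap r i (word_swap r i w) = w"
    using word_swap_Phi[OF m(1)] word_swap_Phi[OF 1] m(2) 2 by simp
qed

lemma series_swap_apply:
  "series_swap r i f v = (if v \<in> words then f (word_swap r i v) else 0)"
proof (cases "v \<in> words")
  case True
  then have "{w \<in> words. word_swap r i w = v} = {word_swap r i v}"
    by (auto simp: word_swap_involution)
  then show ?thesis using True by (simp add: series_swap_def)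
next
  case False
  then have "{w \<in> words. word_swap r i w = v} = {}"
    by (auto simp: word_swap_involution)
  then show ?thesis unfolding series_swap_def using False by (simp only: sum.empty if_False)
qed

text \<open>Neighbouring cuts are consecutive offsets, so a swap of neighbouring blocks is a
  \<open>word_swap\<close>; \<open>block_symI_adjacent\<close> supplies the larger blocks.\<close>

lemma word_swap_invariant_iff:
  "(\<forall>i. \<forall>w\<in>words. f (word_swap r i w) = f w) \<longleftrightarrow> block_sym r f"
proof
  assume inv: "\<forall>i. \<forall>w\<in>words. f (word_swap r i w) = f w"
  show "block_sym r f"
  proof (rule block_symI_adjacent)
    fix w a b c
    assume w: "w \<in> words" "a < b" "b < c" and cuts: "is_cut w a" "is_cut w b" "is_cut w c"
      and adj: "\<forall>x. a < x \<and> x < c \<and> is_cut w x \<longrightarrow> x = b"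
      and small: "enat (cnt w a b) < r \<or> enat (cnt w b c) < r"
    obtain m where m: "m \<in> BW" "Phi m = w" using Phi_surj[OF w(1)] by blast
    note sm = strict_mono_offset[OF m(1)]
    have "\<exists>i. x = offset m i" if "is_cut w x" for x
      using that range_offset[OF m(1)] m(2) by (simp add: set_eq_iff image_iff)
    then obtain i j k where ijk: "a = offset m i" "b = offset m j" "c = offset m k"
      using cuts by metis
    have between: "l = j" if "i < l" "l < k" for l
    proof -
      have "is_cut w (offset m l)" using cut_offset[OF m(1), of l] m(2) by simp
      then have "offset m l = b" using adj that sm ijk by (simp add: strict_mono_less)
      then show ?thesis using ijk sm by (simp add: strict_mono_eq)
    qed
    have "i < j" "j < k" using w(2,3) ijk sm by (simp_all add: strict_mono_less)
    then have "j = Suc i" using between[of "Suc i"] by simp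
    moreover have "k = Suc j" using between[of "Suc j"] \<open>i < j\<close> \<open>j < k\<close> by (cases "Suc j < k") auto
    ultimately have "j = Suc i" "k = Suc (Suc i)" by simp_all
    then have "word_swap r i w = block_swap a b c w"
      using word_swap_Phi[OF m(1), of r i] Phi_col_swap[OF m(1), of r i] small m(2) ijk by simp
    then show "f (block_swap a b c w) = f w" using inv w(1) by metis
  qed
next
  assume sym: "block_sym r f"
  show "\<forall>i. \<forall>w\<in>words. f (word_swap r i w) = f w"
  proof (intro allI ballI)
    fix i w assume w: "w \<in> words"
    obtain m where m: "m \<in> BW" "Phi m = w" using Phi_surj[OF w] by blast
    have "offset m i \<le> offset m (Suc i)" "offset m (Suc i) \<le> offset m (Suc (Suc i))"
      by (simp_all add: offset_Suc)
    then have "f (block_swap (offset m i) (offset m (Suc i)) (offset m (Suc (Suc i))) w) = f w"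
      if "enat (cnt w (offset m i) (offset m (Suc i))) < r \<or>
          enat (cnt w (offset m (Suc i)) (offset m (Suc (Suc i)))) < r"
      using that cut_offset[OF m(1)] m(2) by (intro block_symD[OF sym w]) auto
    then show "f (word_swap r i w) = f w"
      using word_swap_Phi[OF m(1), of r i] Phi_col_swap[OF m(1), of r i] m(2) by metis
  qed
qed


section \<open>Shuffles of a word with a shifted word\<close>

definition low :: "nat \<Rightarrow> nat list \<Rightarrow> nat list" where
  "low k v = filter (\<lambda>x. x \<le> k) v"

definition high :: "nat \<Rightarrow> nat list \<Rightarrow> nat list" where
  "high k v = map (\<lambda>x. x - k) (filter (\<lambda>x. k < x) v)"

text \<open>For letters of \<open>x\<close> at most \<open>k\<close> and positive letters of
  \<open>y\<close>, these are the shuffles of \<open>x\<close> with \<open>y\<close> raised by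
  \<open>k\<close>. Describing them by two restrictions makes nested shuffles easy to compare, and
  \<open>k\<close> is free to exceed the length of \<open>x\<close>.\<close>

definition mix :: "nat \<Rightarrow> nat list \<Rightarrow> nat list \<Rightarrow> nat list set" where
  "mix k x y = {v. low k v = x \<and> high k v = y}"

lemma low_high_append [simp]:
  "low k (u @ v) = low k u @ low k v" "high k (u @ v) = high k u @ high k v"
  by (simp_all add: low_def high_def)

lemma length_low_high: "length (low k v) + length (high k v) = length v"
  by (induction v) (auto simp: low_def high_def)

lemma cnt_low: "q \<le> k \<Longrightarrow> cnt (low k v) p q = cnt v p q"
  by (induction v) (auto simp: low_def cnt_def)

lemma cnt_high: "cnt (high k v) p q = cnt v (k + p) (k + q)"
  by (induction v) (auto simp: high_def cnt_def)

lemma cut_low: "c \<le> k \<Longrightarrow> is_cut (low k v) c \<longleftrightarrow> is_cut v c"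
  by (simp add: is_cut_def cnt_low)

lemma cut_high:
  assumes "is_cut v k" "is_cut (high k v) c" shows "is_cut v (k + c)"
proof (rule cut_extend[OF assms(1)])
  fix p assume "k \<le> p"
  then obtain i where "p = k + i" by (auto simp: le_iff_add)
  then show "cnt v p (k + c) \<le> k + c - p"
    using cut_le[OF assms(2), of i] by (simp add: cnt_high)
qed simp

lemma low_low: "low a (low (a + b) v) = low a v"
  by (induction v) (auto simp: low_def)

lemma high_low: "high a (low (a + b) v) = low b (high a v)"
  by (induction v) (auto simp: low_def high_def)

lemma high_high: "high b (high a v) = high (a + b) v"
  by (induction v) (auto simp: high_def)

lemma low_block_swap:
  assumes "a \<le> b" "b \<le> c" "c \<le> k"
  shows "low k (block_swap a b c v) = block_swap a b c (low k v)"
    and "high k (block_swap a b c v) = high k v"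
  using assms by (induction v) (auto simp: low_def high_def block_swap_def block_shift_def)

lemma high_block_swap:
  assumes "a \<le> b" "b \<le> c"
  shows "low k (block_swap (k + a) (k + b) (k + c) v) = low k v"
    and "high k (block_swap (k + a) (k + b) (k + c) v) = block_swap a b c (high k v)"
  using assms by (induction v) (auto simp: low_def high_def block_swap_def block_shift_def)

lemma set_mix: "v \<in> mix k x y \<Longrightarrow> set v \<subseteq> set x \<union> (\<lambda>z. z + k) ` set y"
proof
  fix z assume v: "v \<in> mix k x y" "z \<in> set v"
  show "z \<in> set x \<union> (\<lambda>z. z + k) ` set y"
  proof (cases "z \<le> k")
    case True then show ?thesis using v by (auto simp: mix_def low_def)
  next
    case False
    then have "z - k \<in> set y" "z = z - k + k" using v by (auto simp: mix_def high_def)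
    then show ?thesis by blast
  qed
qed

lemma length_mix: "v \<in> mix k x y \<Longrightarrow> length v = length x + length y"
  using length_low_high[of k v] by (auto simp: mix_def)

lemma finite_mix [simp]: "finite (mix k x y)"
proof (rule finite_subset)
  let ?A = "set x \<union> (\<lambda>z. z + k) ` set y"
  show "mix k x y \<subseteq> {v. set v \<subseteq> ?A \<and> length v = length x + length y}"
    using set_mix length_mix by blast
  show "finite {v. set v \<subseteq> ?A \<and> length v = length x + length y}"
    by (rule finite_lists_length_eq) simp
qed

lemma mix_words: "v \<in> mix k x y \<Longrightarrow> x \<in> words \<Longrightarrow> y \<in> words \<Longrightarrow> v \<in> words"
  using set_mix[of v k x y] by (auto simp: words_iff)

lemma mix_Nil:
  assumes "\<forall>z\<in>set x. z \<le> k" shows "mix k x [] = {x}"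
proof -
  have "v = x" if "low k v = x" "high k v = []" for v
  proof -
    have "\<forall>z\<in>set v. z \<le> k" using that(2) by (auto simp: high_def filter_empty_conv)
    then show ?thesis using that(1) by (simp add: low_def)
  qed
  moreover have "low k x = x" "high k x = []"
    using assms by (auto simp: low_def high_def filter_empty_conv)
  ultimately show ?thesis by (auto simp: mix_def)
qed

lemma mix_0_Nil:
  assumes "y \<in> words" shows "mix 0 [] y = {y}"
proof -
  have "v = y" if "low 0 v = []" "high 0 v = y" for v
    using that by (auto simp: low_def high_def filter_empty_conv)
  moreover have "low 0 y = []" "high 0 y = y"
    using assms by (auto simp: low_def high_def filter_empty_conv words_iff intro!: filter_True gr0I)
  ultimately show ?thesis by (auto simp: mix_def)
qed

lemma parking_mix:
  assumes "parking x" "parking y" "v \<in> mix (length x) x y" shows "parking v"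
proof -
  have len: "length v = length x + length y" using length_mix[OF assms(3)] .
  have v: "low (length x) v = x" "high (length x) v = y" using assms(3) by (auto simp: mix_def)
  have "is_cut v (length x)"
    using assms(1) cut_low[of "length x" "length x" v] v by (simp add: parking_iff_cut)
  then have "is_cut v (length v)"
    using cut_high[of v "length x" "length y"] assms(2) v len by (simp add: parking_iff_cut)
  moreover have "v \<in> words" using mix_words[OF assms(3)] assms by (simp add: parking_words)
  moreover have "\<forall>z\<in>set v. z \<le> length v"
    using set_mix[OF assms(3)] assms(1,2) len by (fastforce simp: parking_iff_cut)
  ultimately show ?thesis by (simp add: parking_iff_cut)
qed

lemma block_swap_inverse':
  assumes "a \<le> b" "b \<le> c" shows "block_swap a b c (block_swap a (a + (c - b)) c w) = w"
proof -
  have "a + (c - (a + (c - b))) = b" using assms by simp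
  then show ?thesis using block_swap_inverse[of a "a + (c - b)" c w] assms by simp
qed

text \<open>The swap acts below \<open>k\<close> and commutes with restriction, so applying it to
  the whole shuffle is a bijection between the two index sets. It is admissible there because cuts
  and counts below \<open>k\<close> are those of \<open>x\<close>.\<close>

lemma sum_mix_block_swap_left:
  fixes f :: "nat list \<Rightarrow> 'b::comm_monoid_add"
  assumes "block_sym r f" "x \<in> words" "y \<in> words" "a \<le> b" "b \<le> c" "c \<le> k"
    "is_cut x a" "is_cut x b" "is_cut x c" "enat (cnt x a b) < r \<or> enat (cnt x b c) < r"
  shows "sum f (mix k (block_swap a b c x) y) = sum f (mix k x y)"
proof (rule sum.reindex_bij_witness[where i = "block_swap a b c" and j = "block_swap a (a + (c - b)) c"])
  note abc = assms(4-6)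
  show inv: "block_swap a b c (block_swap a (a + (c - b)) c v) = v" for v
    using abc by (intro block_swap_inverse')
  show "block_swap a (a + (c - b)) c (block_swap a b c v) = v" for v
    using block_swap_inverse[OF abc(1,2)] .
  show "block_swap a b c v \<in> mix k (block_swap a b c x) y" if "v \<in> mix k x y" for v
    using that abc by (simp add: mix_def low_block_swap)
  fix v assume v: "v \<in> mix k (block_swap a b c x) y"
  let ?u = "block_swap a (a + (c - b)) c v"
  have "a \<le> a + (c - b)" "a + (c - b) \<le> c" using abc by auto
  then have "low k ?u = block_swap a (a + (c - b)) c (block_swap a b c x)" "high k ?u = y"
    using v low_block_swap[of a "a + (c - b)" c k v] abc by (simp_all add: mix_def)
  then have u: "low k ?u = x" "high k ?u = y" using block_swap_inverse[OF abc(1,2), of x] by auto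
  then show um: "?u \<in> mix k x y" by (simp add: mix_def)
  have "f (block_swap a b c ?u) = f ?u"
  proof (rule block_symD[OF assms(1)])
    show "?u \<in> words" using mix_words[OF um] assms by simp
    show "is_cut ?u a" "is_cut ?u b" "is_cut ?u c"
      using cut_low[of _ k ?u] u(1) abc assms(7-9) by auto
    show "enat (cnt ?u a b) < r \<or> enat (cnt ?u b c) < r"
      using cnt_low[of _ k ?u] u(1) abc assms(10) by auto
  qed (use abc in auto)
  then show "f ?u = f v" using inv by simp
qed

text \<open>As before, with the swap raised by \<open>k\<close>; the cut at \<open>k\<close> turns
  cuts of \<open>y\<close> into cuts of the shuffle.\<close>

lemma sum_mix_block_swap_right:
  fixes f :: "nat list \<Rightarrow> 'b::comm_monoid_add"
  assumes "block_sym r f" "x \<in> words" "y \<in> words" "a \<le> b" "b \<le> c" "is_cut x k"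
    "is_cut y a" "is_cut y b" "is_cut y c" "enat (cnt y a b) < r \<or> enat (cnt y b c) < r"
  shows "sum f (mix k x (block_swap a b c y)) = sum f (mix k x y)"
proof (rule sum.reindex_bij_witness[where i = "block_swap (k + a) (k + b) (k + c)"
      and j = "block_swap (k + a) (k + (a + (c - b))) (k + c)"])
  note abc = assms(4,5)
  have eq: "k + (a + (c - b)) = k + a + ((k + c) - (k + b))" by simp
  show inv: "block_swap (k + a) (k + b) (k + c) (block_swap (k + a) (k + (a + (c - b))) (k + c) v) = v" for v
    unfolding eq by (rule block_swap_inverse') (use abc in auto)
  show "block_swap (k + a) (k + (a + (c - b))) (k + c) (block_swap (k + a) (k + b) (k + c) v) = v" for v
    unfolding eq by (rule block_swap_inverse) (use abc in auto)
  show "block_swap (k + a) (k + b) (k + c) v \<in> mix k x (block_swap a b c y)" if "v \<in> mix k x y" for v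
    using that abc by (simp add: mix_def high_block_swap)
  fix v assume v: "v \<in> mix k x (block_swap a b c y)"
  let ?u = "block_swap (k + a) (k + (a + (c - b))) (k + c) v"
  have "a \<le> a + (c - b)" "a + (c - b) \<le> c" using abc by auto
  then have "low k ?u = x" "high k ?u = block_swap a (a + (c - b)) c (block_swap a b c y)"
    using v high_block_swap[of a "a + (c - b)" c k v] by (simp_all add: mix_def)
  then have u: "low k ?u = x" "high k ?u = y" using block_swap_inverse[OF abc, of y] by auto
  then show um: "?u \<in> mix k x y" by (simp add: mix_def)
  have uk: "is_cut ?u k" using cut_low[of k k ?u] u(1) assms(6) by simp
  have "f (block_swap (k + a) (k + b) (k + c) ?u) = f ?u"
  proof (rule block_symD[OF assms(1)])
    show "?u \<in> words" using mix_words[OF um] assms by simp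
    show "is_cut ?u (k + a)" "is_cut ?u (k + b)" "is_cut ?u (k + c)"
      by (rule cut_high[OF uk], use u(2) assms(7-9) in simp)+
    show "enat (cnt ?u (k + a) (k + b)) < r \<or> enat (cnt ?u (k + b) (k + c)) < r"
      using cnt_high[of k ?u] u(2) assms(10) by auto
  qed (use abc in auto)
  then show "f ?u = f v" using inv by simp
qed

lemma Park_map_add:
  assumes "y \<in> words" shows "Park (map (\<lambda>z. z + j) y) = Park y"
proof -
  have "map (\<lambda>z. z + j) y \<in> words" using assms by (auto simp: words_iff)
  moreover have "cnt (map (\<lambda>z. z + j) y) 0 (0 + j) = 0"
    using assms by (auto simp: cnt_eq_0_iff words_iff)
  ultimately have "Park (squeeze 0 j (map (\<lambda>z. z + j) y)) = Park (map (\<lambda>z. z + j) y)"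
    by (intro Park_squeeze cut_0)
  moreover have "squeeze 0 j (map (\<lambda>z. z + j) y) = y"
    using assms by (auto simp: squeeze_def words_iff intro!: map_idI)
  ultimately show ?thesis by simp
qed

text \<open>With nothing in \<open>(n, k]\<close>, the shift can be transferred from the threshold
  to \<open>y\<close>, where parkization will absorb it.\<close>

lemma mix_lower_cut:
  assumes "\<forall>z\<in>set x. z \<le> n" "n \<le> k" "y \<in> words"
  shows "mix k x y = mix n x (map (\<lambda>z. z + (k - n)) y)"
proof -
  have *: "low k v = low n v" "high n v = map (\<lambda>z. z + (k - n)) (high k v)"
    if "\<forall>z\<in>set v. \<not> (n < z \<and> z \<le> k)" for v
    using that assms(2) by (induction v) (auto simp: low_def high_def)
  have inj: "map (\<lambda>z. z + (k - n)) u = map (\<lambda>z. z + (k - n)) y \<longleftrightarrow> u = y" for u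
    by (rule inj_map_eq_map) (simp add: inj_def)
  have 1: "\<forall>z\<in>set v. \<not> (n < z \<and> z \<le> k)" if "v \<in> mix k x y" for v
    using that assms(1) by (force simp: mix_def low_def)
  have 2: "\<forall>z\<in>set v. \<not> (n < z \<and> z \<le> k)" if v: "v \<in> mix n x (map (\<lambda>z. z + (k - n)) y)" for v
  proof (intro ballI notI)
    fix z assume z: "z \<in> set v" "n < z \<and> z \<le> k"
    then have "z - n \<in> set (high n v)" by (auto simp: high_def)
    then obtain t where "t \<in> set y" "z - n = t + (k - n)" using v by (auto simp: mix_def)
    moreover from this have "t \<noteq> 0" using assms(3) by (metis words_iff)
    ultimately show False using z(2) assms(2) by linarith
  qed
  show ?thesis
  proof (rule set_eqI)
    fix v
    have "v \<in> mix k x y \<longleftrightarrow> v \<in> mix n x (map (\<lambda>z. z + (k - n)) y)"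
      if "\<forall>z\<in>set v. \<not> (n < z \<and> z \<le> k)"
      unfolding mix_def mem_Collect_eq *[OF that] inj ..
    then show "v \<in> mix k x y \<longleftrightarrow> v \<in> mix n x (map (\<lambda>z. z + (k - n)) y)"
      using 1 2 by blast
  qed
qed

text \<open>The transpose of the shuffle description: the coefficient at a pair of parking functions
  collects \<open>f\<close> over all their shuffles. Other arguments are parkized first, since a
  series \<open>Gser a\<close> cannot distinguish a word from its parkization.\<close>

definition coprod :: "(nat list \<Rightarrow> 'k::field) \<Rightarrow> nat list \<times> nat list \<Rightarrow> 'k" where
  "coprod f = (\<lambda>(x, y). if x \<in> words \<and> y \<in> words
     then sum f (mix (length x) (Park x) (Park y)) else 0)"

text \<open>Parkizing \<open>x\<close> and \<open>y\<close> and lowering \<open>k\<close> to the length of \<open>x\<close> are all removals of empty columns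
  from the shuffles, to which \<open>f\<close> is blind.\<close>

lemma coprod_eq_sum_mix:
  assumes f: "block_sym 1 f" and y: "y \<in> words"
    and x: "x \<in> words" "is_cut x k" "\<forall>z\<in>set x. z \<le> k"
  shows "coprod f (x, y) = sum f (mix k x y)"
proof -
  \<comment> \<open>For fixed parking \<open>x\<close> the sum is itself an invariant function of
    \<open>y\<close>, so it does not notice the parkization of \<open>y\<close>.\<close>
  have fixed: "sum f (mix (length x) x (Park y)) = sum f (mix (length x) x y)"
    if "parking x" "y \<in> words" for x y
  proof (rule block_sym_Park[where f = "\<lambda>y. sum f (mix (length x) x y)"])
    have "is_cut x (length x)" "x \<in> words" using that(1) by (auto simp: parking_iff_cut)
    then show "block_sym 1 (\<lambda>y. sum f (mix (length x) x y))"
      by (intro block_symI sum_mix_block_swap_right[OF f]) auto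
  qed (use that in simp)
  have "sum f (mix k x y) = sum f (mix (length x) (Park x) (Park y))"
    using x
  proof (induction x rule: Park_induct)
    case (parked w)
    then have w: "parking w" by (simp add: parking_iff_park_d)
    have "mix k w y = mix (length w) w (map (\<lambda>z. z + (k - length w)) y)"
      using w y parked(1,3,4) by (intro mix_lower_cut cut_length_le) (auto simp: parking_iff_cut)
    also have "sum f \<dots> = sum f (mix (length w) w (Park (map (\<lambda>z. z + (k - length w)) y)))"
      using y by (intro fixed[symmetric] w) (auto simp: words_iff)
    finally show ?case using w y by (simp add: Park_map_add Park_parking)
  next
    case (step w a)
    have k: "Suc a \<le> k" using cut_length_le[of w k] step by simp
    have cuts: "is_cut w a" "cnt w a (Suc a) = 0" using step(4) by (auto simp: gap_def)
    have cut': "is_cut w (Suc a)"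
      using cuts by (intro cut_extend[of w a "Suc a"]) (auto simp: cnt_trivial le_Suc_eq)
    have sq: "squeeze a 1 w = block_swap a (Suc a) k w"
      using squeeze_eq_block_swap[of w a "Suc a" k] cuts step.prems by simp
    have "sum f (mix k (squeeze a 1 w) y) = sum f (mix k w y)"
      unfolding sq using step k cuts cut' y
      by (intro sum_mix_block_swap_left[OF f]) (auto simp: one_enat_def)
    moreover have "is_cut (squeeze a 1 w) k"
      unfolding sq using step k cuts cut' by (intro cut_block_swap_upper) auto
    moreover have "\<forall>z\<in>set (squeeze a 1 w). z \<le> k"
      using step.prems(2) by (fastforce simp: squeeze_def)
    moreover have "Park w = Park (squeeze a 1 w)" using Park_step[OF step(1,2)] step(3) by simp
    ultimately show ?case using step.IH by simp
  qed
  then show ?thesis using x y by (simp add: coprod_def)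
qed

lemma coprod_eq_sum_mix_Park:
  assumes "block_sym 1 f" "x \<in> words" "y \<in> words"
  shows "coprod f (x, y) = sum f (mix (length x) (Park x) y)"
proof -
  have "coprod f (Park x, y) = sum f (mix (length x) (Park x) y)"
    using parking_Park[OF assms(2)]
    by (intro coprod_eq_sum_mix assms) (auto simp: parking_iff_cut)
  moreover have "coprod f (Park x, y) = coprod f (x, y)"
    using assms Park_parking[OF parking_Park] by (simp add: coprod_def Park_words)
  ultimately show ?thesis by simp
qed

lemma block_sym_coprod_right:
  assumes "block_sym r f" "1 \<le> r" shows "block_sym r (\<lambda>y. coprod f (x, y))"
proof (cases "x \<in> words")
  case True
  note f1 = block_sym_antimono[OF assms]
  have "is_cut (Park x) (length x)"
    using parking_Park[OF True] by (simp add: parking_iff_cut)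
  then show ?thesis
    by (intro block_symI)
      (simp add: coprod_eq_sum_mix_Park[OF f1 True] block_swap_words
        sum_mix_block_swap_right[OF assms(1) Park_words[OF True]])
qed (simp add: coprod_def block_sym_def)

text \<open>The blocks may reach beyond the length of \<open>x\<close>, so the shuffles are formed
  over a cut \<open>k\<close> above both \<open>c\<close> and all letters of
  \<open>x\<close>.\<close>

lemma block_sym_coprod_left:
  assumes "block_sym r f" "1 \<le> r" shows "block_sym r (\<lambda>x. coprod f (x, y))"
proof (cases "y \<in> words")
  case True
  note f1 = block_sym_antimono[OF assms]
  show ?thesis
  proof (rule block_symI)
    fix x a b c
    assume x: "x \<in> words" and abc: "a \<le> b" "b \<le> c" and cuts: "is_cut x a" "is_cut x b" "is_cut x c"
      and small: "enat (cnt x a b) < r \<or> enat (cnt x b c) < r"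
    obtain k where k: "c \<le> k" "is_cut x k" "\<forall>z\<in>set x. z \<le> k" by (rule exists_large_cut)
    have "coprod f (block_swap a b c x, y) = sum f (mix k (block_swap a b c x) y)"
    proof (rule coprod_eq_sum_mix[OF f1 True])
      show "is_cut (block_swap a b c x) k" by (rule cut_block_swap_upper[OF abc cuts k(1,2)])
      show "\<forall>z\<in>set (block_swap a b c x). z \<le> k"
        using k(1,3) abc by (auto simp: block_swap_def block_shift_def)
    qed (rule block_swap_words[OF abc x])
    also have "\<dots> = sum f (mix k x y)"
      by (rule sum_mix_block_swap_left[OF assms(1) x True abc k(1) cuts small])
    also have "\<dots> = coprod f (x, y)" using coprod_eq_sum_mix[OF f1 True x k(2,3)] by simp
    finally show "coprod f (block_swap a b c x, y) = coprod f (x, y)" .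
  qed
qed (simp add: coprod_def block_sym_def)

lemma sum_UN_mix_left:
  fixes f :: "nat list \<Rightarrow> 'b::comm_monoid_add"
  assumes "finite U"
  shows "(\<Sum>u\<in>U. sum f (mix k u z)) = sum f {v. low k v \<in> U \<and> high k v = z}"
proof -
  have "(\<Sum>u\<in>U. sum f (mix k u z)) = sum f (\<Union>u\<in>U. mix k u z)"
    by (rule sum.UNION_disjoint[symmetric]) (use assms in simp, simp, auto simp: mix_def)
  also have "(\<Union>u\<in>U. mix k u z) = {v. low k v \<in> U \<and> high k v = z}" by (auto simp: mix_def)
  finally show ?thesis .
qed

lemma sum_UN_mix_right:
  fixes f :: "nat list \<Rightarrow> 'b::comm_monoid_add"
  assumes "finite U"
  shows "(\<Sum>u\<in>U. sum f (mix k x u)) = sum f {v. low k v = x \<and> high k v \<in> U}"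
proof -
  have "(\<Sum>u\<in>U. sum f (mix k x u)) = sum f (\<Union>u\<in>U. mix k x u)"
    by (rule sum.UNION_disjoint[symmetric]) (use assms in simp, simp, auto simp: mix_def)
  also have "(\<Union>u\<in>U. mix k x u) = {v. low k v = x \<and> high k v \<in> U}" by (auto simp: mix_def)
  finally show ?thesis .
qed

text \<open>Both sides sum \<open>f\<close> over the same words: those whose restrictions to the
  three consecutive intervals of the alphabet are the parkizations of \<open>x\<close>,
  \<open>y\<close> and \<open>z\<close>.\<close>

lemma coprod_coassoc:
  "coprod (\<lambda>x. coprod f (x, z)) (x, y) = coprod (\<lambda>y. coprod f (x, y)) (y, z)"
proof (cases "x \<in> words \<and> y \<in> words \<and> z \<in> words")
  case True
  note P = parking_Park
  let ?X = "Park x" and ?Y = "Park y" and ?Z = "Park z" and ?a = "length x" and ?b = "length y"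
  have "coprod (\<lambda>x. coprod f (x, z)) (x, y) = (\<Sum>u\<in>mix ?a ?X ?Y. coprod f (u, z))"
    using True by (simp add: coprod_def)
  also have "\<dots> = (\<Sum>u\<in>mix ?a ?X ?Y. sum f (mix (?a + ?b) u ?Z))"
  proof (rule sum.cong[OF refl])
    fix u assume u: "u \<in> mix ?a ?X ?Y"
    have "parking u" using parking_mix[OF P P, of x y u] u True by simp
    then show "coprod f (u, z) = sum f (mix (?a + ?b) u ?Z)"
      using True length_mix[OF u] by (simp add: coprod_def Park_parking parking_words)
  qed
  also have "\<dots> = sum f {v. low (?a + ?b) v \<in> mix ?a ?X ?Y \<and> high (?a + ?b) v = ?Z}"
    by (rule sum_UN_mix_left) simp
  also have "{v. low (?a + ?b) v \<in> mix ?a ?X ?Y \<and> high (?a + ?b) v = ?Z} =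
      {v. low ?a v = ?X \<and> high ?a v \<in> mix ?b ?Y ?Z}"
    by (auto simp: mix_def low_low high_low high_high)
  also have "sum f \<dots> = (\<Sum>u\<in>mix ?b ?Y ?Z. sum f (mix ?a ?X u))"
    by (rule sum_UN_mix_right[symmetric]) simp
  also have "\<dots> = (\<Sum>u\<in>mix ?b ?Y ?Z. coprod f (x, u))"
  proof (rule sum.cong[OF refl])
    fix u assume u: "u \<in> mix ?b ?Y ?Z"
    have "parking u" using parking_mix[OF P P, of y z u] u True by simp
    then show "sum f (mix ?a ?X u) = coprod f (x, u)"
      using True by (simp add: coprod_def Park_parking parking_words)
  qed
  also have "\<dots> = coprod (\<lambda>y. coprod f (x, y)) (y, z)"
    using True by (simp add: coprod_def)
  finally show ?thesis .
qed (auto simp: coprod_def)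

definition on_words :: "(nat list \<Rightarrow> 'k::zero) \<Rightarrow> bool" where
  "on_words f \<longleftrightarrow> (\<forall>w. w \<notin> words \<longrightarrow> f w = 0)"

lemma coprod_Nil_right:
  assumes "block_sym 1 f" "on_words f" shows "coprod f (x, []) = f x"
proof (cases "x \<in> words")
  case True
  have Nil: "[] \<in> words" by (simp add: words_iff)
  have "\<forall>z\<in>set (Park x). z \<le> length x" using parking_Park[OF True] by (simp add: parking_iff_cut)
  then show ?thesis
    using coprod_eq_sum_mix_Park[OF assms(1) True Nil] block_sym_Park[OF assms(1) True]
    by (simp add: mix_Nil)
qed (use assms in \<open>simp add: coprod_def on_words_def\<close>)

lemma coprod_Nil_left:
  assumes "block_sym 1 f" "on_words f" shows "coprod f ([], y) = f y"
proof (cases "y \<in> words")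
  case True
  have Nil: "[] \<in> words" "Park [] = []" by (simp_all add: words_iff Park_parking parking_def)
  then show ?thesis
    using coprod_eq_sum_mix_Park[OF assms(1) Nil(1) True] Nil(2) True
    by (simp add: mix_0_Nil)
qed (use assms in \<open>simp add: coprod_def on_words_def\<close>)

lemma coprod_add: "coprod (\<lambda>x. f x + g x) p = coprod f p + coprod g p"
  by (simp add: coprod_def sum.distrib split: prod.split)

lemma coprod_scale: "coprod (\<lambda>x. c * f x) p = c * coprod f p"
  by (simp add: coprod_def sum_distrib_left split: prod.split)

lemma coprod_length:
  assumes "\<And>w. length w = length x + length y \<Longrightarrow> f w = 0" shows "coprod f (x, y) = 0"
  by (auto simp: coprod_def intro!: sum.neutral assms dest!: length_mix)

section \<open>Concatenation product\<close>

text \<open>This is the Cauchy product of noncommutative formal series.\<close>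

definition conv :: "(nat list \<Rightarrow> 'k::field) \<Rightarrow> (nat list \<Rightarrow> 'k) \<Rightarrow> nat list \<Rightarrow> 'k" where
  "conv f g w = (\<Sum>k\<le>length w. f (take k w) * g (drop k w))"

lemma block_sym_conv:
  assumes "block_sym r f" "block_sym r g" shows "block_sym r (conv f g)"
proof (rule block_symI)
  fix w a b c
  assume w: "w \<in> words" and abc: "a \<le> b" "b \<le> c" and cuts: "is_cut w a" "is_cut w b" "is_cut w c"
    and small: "enat (cnt w a b) < r \<or> enat (cnt w b c) < r"
  have small': "enat (cnt v a b) < r \<or> enat (cnt v b c) < r"
    if "cnt v a b \<le> cnt w a b" "cnt v b c \<le> cnt w b c" for v
    using small that by (meson enat_ord_simps(1) le_less_trans)
  have "f (block_swap a b c (take k w)) = f (take k w)" for k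
    using w cuts abc by (intro block_symD[OF assms(1)] cut_take_drop small' cnt_take_drop_le)
      (simp_all add: words_take_drop[of w k])
  moreover have "g (block_swap a b c (drop k w)) = g (drop k w)" for k
    using w cuts abc by (intro block_symD[OF assms(2)] cut_take_drop small' cnt_take_drop_le)
      (simp_all add: words_take_drop[of w k])
  ultimately show "conv f g (block_swap a b c w) = conv f g w"
    by (simp add: conv_def block_swap_take_drop)
qed

lemma on_words_conv: "on_words f \<Longrightarrow> on_words g \<Longrightarrow> on_words (conv f g)"
  unfolding on_words_def conv_def
  by (auto intro!: sum.neutral) (metis words_take_drop)

lemma sum_triangle:
  fixes F :: "nat \<Rightarrow> nat \<Rightarrow> 'b::comm_monoid_add"
  shows "(\<Sum>k\<le>n. \<Sum>j\<le>k. F j k) = (\<Sum>j\<le>n. \<Sum>i\<le>n - j. F j (j + i))"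
  unfolding sum.Sigma[OF finite_atMost ballI[OF finite_atMost]]
  by (rule sum.reindex_bij_witness[where i = "\<lambda>(j, i). (j + i, j)" and j = "\<lambda>(k, j). (j, k - j)"]) auto

lemma conv_assoc: "conv (conv f g) h = conv f (conv g h)"
proof
  fix w :: "nat list"
  let ?n = "length w"
  let ?F = "\<lambda>j k. f (take j w) * g (drop j (take k w)) * h (drop k w)"
  have "conv (conv f g) h w = (\<Sum>k\<le>?n. \<Sum>j\<le>k. ?F j k)"
    by (auto simp: conv_def sum_distrib_right min_def intro!: sum.cong)
  also have "\<dots> = (\<Sum>j\<le>?n. \<Sum>i\<le>?n - j. ?F j (j + i))" by (rule sum_triangle)
  also have "\<dots> = conv f (conv g h) w"
    by (auto simp: conv_def sum_distrib_left take_drop add.commute mult.assoc drop_drop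
        intro!: sum.cong)
  finally show "conv (conv f g) h w = conv f (conv g h) w" .
qed

text \<open>Cutting a shuffle of \<open>x\<close> and \<open>y\<close> in two amounts to cutting
  \<open>x\<close> and \<open>y\<close> and shuffling the pieces separately; the cutting points are
  the numbers of low and high letters in the prefix.\<close>

lemma coprod_conv:
  assumes "block_sym 1 f" "block_sym 1 g"
  shows "coprod (conv f g) (x, y) =
    (\<Sum>i\<le>length x. \<Sum>j\<le>length y. coprod f (take i x, take j y) * coprod g (drop i x, drop j y))"
proof (cases "x \<in> words \<and> y \<in> words")
  case True
  \<comment> \<open>One threshold serves all pieces: a cut above the letters of \<open>x\<close>
    remains one for every prefix and suffix of \<open>x\<close>, whereas their lengths vary.\<close>
  obtain k where k: "0 \<le> k" "is_cut x k" "\<forall>z\<in>set x. z \<le> k" by (rule exists_large_cut)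
  let ?S = "SIGMA v:mix k x y. {..length v}"
  let ?A = "\<lambda>(i, j). mix k (take i x) (take j y) \<times> mix k (drop i x) (drop j y)"
  let ?T = "SIGMA ij:{..length x} \<times> {..length y}. ?A ij"
  have "coprod (conv f g) (x, y) = (\<Sum>v\<in>mix k x y. \<Sum>n\<le>length v. f (take n v) * g (drop n v))"
    using True k by (simp add: coprod_eq_sum_mix block_sym_conv assms conv_def)
  also have "\<dots> = (\<Sum>(v, n)\<in>?S. f (take n v) * g (drop n v))"
    by (rule sum.Sigma) auto
  also have "\<dots> = (\<Sum>(ij, u, v)\<in>?T. f u * g v)"
  proof (rule sum.reindex_bij_witness[where
        i = "\<lambda>(ij, u, v). (u @ v, length u)" and
        j = "\<lambda>(v, n). ((length (low k (take n v)), length (high k (take n v))), take n v, drop n v)"])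
    fix p assume "p \<in> ?S"
    then obtain v n where p: "p = (v, n)" "low k v = x" "high k v = y" "n \<le> length v"
      by (auto simp: mix_def)
    have "x = low k (take n v) @ low k (drop n v)" "y = high k (take n v) @ high k (drop n v)"
      using p(2,3) low_high_append[of k "take n v" "drop n v"] by auto
    then have "take (length (low k (take n v))) x = low k (take n v)"
      "drop (length (low k (take n v))) x = low k (drop n v)"
      "take (length (high k (take n v))) y = high k (take n v)"
      "drop (length (high k (take n v))) y = high k (drop n v)"
      "length (low k (take n v)) \<le> length x" "length (high k (take n v)) \<le> length y"
      by (metis append_eq_conv_conj length_append le_add1)+
    then show "(case p of (v, n) \<Rightarrow> ((length (low k (take n v)), length (high k (take n v))), take n v, drop n v)) \<in> ?T"
      by (auto simp: p(1) mix_def)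
  qed (auto simp: mix_def)
  also have "\<dots> = (\<Sum>ij\<in>{..length x} \<times> {..length y}. \<Sum>(u, v)\<in>?A ij. f u * g v)"
    by (subst sum.Sigma) (auto simp: case_prod_unfold)
  also have "\<dots> = (\<Sum>(i, j)\<in>{..length x} \<times> {..length y}.
      sum f (mix k (take i x) (take j y)) * sum g (mix k (drop i x) (drop j y)))"
    by (rule sum.cong) (auto simp: sum_product sum.cartesian_product)
  also have "\<dots> = (\<Sum>(i, j)\<in>{..length x} \<times> {..length y}.
      coprod f (take i x, take j y) * coprod g (drop i x, drop j y))"
  proof (rule sum.cong[OF refl], clarify)
    fix i j
    have "take i x \<in> words" "drop i x \<in> words" "take j y \<in> words" "drop j y \<in> words"
      using True words_take_drop by auto
    moreover have "\<forall>z\<in>set (take i x). z \<le> k" "\<forall>z\<in>set (drop i x). z \<le> k"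
      using k(3) by (auto dest: in_set_takeD in_set_dropD)
    ultimately show "sum f (mix k (take i x) (take j y)) * sum g (mix k (drop i x) (drop j y)) =
        coprod f (take i x, take j y) * coprod g (drop i x, drop j y)"
      using coprod_eq_sum_mix[OF assms(1), of "take j y" "take i x" k]
        coprod_eq_sum_mix[OF assms(2), of "drop j y" "drop i x" k] cut_take_drop[OF k(2)] by simp
  qed
  finally show ?thesis by (simp add: sum.cartesian_product)
next
  case False
  then have "coprod f (take i x, take j y) * coprod g (drop i x, drop j y) = 0" for i j
    using words_take_drop[of x i] words_take_drop[of y j] by (auto simp: coprod_def)
  moreover have "coprod (conv f g) (x, y) = 0" using False by (auto simp: coprod_def)
  ultimately show ?thesis by (simp only: sum.neutral_const)
qed

section \<open>Antipode\<close>

text \<open>The recursion solves \<open>S * id = \<eta> \<epsilon>\<close> for the top term in each degree.\<close>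

function anti :: "(nat list \<Rightarrow> 'k::field) \<Rightarrow> nat list \<Rightarrow> 'k" where
  "anti f w = (if w = [] then f []
     else - (\<Sum>k<length w. anti (\<lambda>x. coprod f (x, drop k w)) (take k w)))"
  by auto
termination by (relation "measure (\<lambda>(f, w). length w)") auto

declare anti.simps [simp del]

lemma anti_Nil [simp]: "anti f [] = f []"
  by (simp add: anti.simps)

lemma anti_add: "anti (\<lambda>x. f x + g x) w = anti f w + anti g w"
proof (induction "length w" arbitrary: w f g rule: less_induct)
  case less
  show ?case
  proof (cases "w = []")
    case False
    then show ?thesis
      by (simp add: anti.simps[of _ w] coprod_add less sum.distrib)
  qed simp
qed

lemma anti_scale: "anti (\<lambda>x. c * f x) w = c * anti f w"
proof (induction "length w" arbitrary: w f rule: less_induct)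
  case less
  show ?case
  proof (cases "w = []")
    case False
    then show ?thesis
      by (simp add: anti.simps[of _ w] coprod_scale less sum_distrib_left)
  qed simp
qed

lemma anti_zero: "anti (\<lambda>x. 0) w = 0"
  using anti_scale[of 0 "\<lambda>x. 0" w] by simp

text \<open>\<open>coprod\<close> only evaluates \<open>f\<close> at words of the total length, so
  the recursion never leaves the degree of \<open>w\<close>. This makes the antipode
  homogeneous.\<close>

lemma anti_length:
  assumes "\<And>v. length v = length w \<Longrightarrow> f v = 0" shows "anti f w = 0"
  using assms
proof (induction "length w" arbitrary: w f rule: less_induct)
  case less
  show ?case
  proof (cases "w = []")
    case False
    have "anti (\<lambda>x. coprod f (x, drop k w)) (take k w) = 0" if "k < length w" for k
      using that by (intro less(1) coprod_length less(2)) auto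
    then show ?thesis using False by (simp add: anti.simps[of f w])
  qed (use less in simp)
qed

lemma on_words_coprod: "on_words (\<lambda>x. coprod f (x, y))" "on_words (\<lambda>y. coprod f (x, y))"
  by (simp_all add: on_words_def coprod_def)

lemma on_words_anti:
  assumes "on_words f" shows "on_words (anti f)"
proof -
  have "anti f w = 0" if "on_words f" "w \<notin> words" for w
    using that
  proof (induction "length w" arbitrary: w f rule: less_induct)
    case less
    have "anti (\<lambda>x. coprod f (x, drop k w)) (take k w) = 0" if "k < length w" for k
    proof (cases "drop k w \<in> words")
      case True
      then have "take k w \<notin> words" using less.prems(2) words_take_drop by blast
      then show ?thesis using that by (intro less(1) on_words_coprod) auto
    next
      case False
      then have "(\<lambda>x. coprod f (x, drop k w)) = (\<lambda>x. 0)" by (simp add: coprod_def)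
      then show ?thesis by (simp add: anti_zero)
    qed
    moreover have "w \<noteq> []" using less.prems by (auto simp: words_iff)
    ultimately show ?case by (simp add: anti.simps[of f w])
  qed
  then show ?thesis using assms by (simp add: on_words_def)
qed

text \<open>A swap of \<open>w\<close> restricts to both pieces of each splitting. On the suffix it
  is absorbed by the invariance of \<open>coprod f\<close> in its second argument, on the prefix by
  the induction hypothesis for a slice of \<open>coprod f\<close>.\<close>

lemma block_sym_anti:
  assumes "block_sym r f" "1 \<le> r" shows "block_sym r (anti f)"
proof (rule block_symI)
  fix w a b c
  assume "w \<in> words" "a \<le> b" "b \<le> c" "is_cut w a" "is_cut w b" "is_cut w c"
    "enat (cnt w a b) < r \<or> enat (cnt w b c) < r"
  then show "anti f (block_swap a b c w) = anti f w"
    using assms(1)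
  proof (induction "length w" arbitrary: w f rule: less_induct)
    case less
    note abc = less.prems(2,3) and cuts = less.prems(4-6)
    have small: "enat (cnt v a b) < r \<or> enat (cnt v b c) < r"
      if "cnt v a b \<le> cnt w a b" "cnt v b c \<le> cnt w b c" for v
      using less.prems(7) that by (meson enat_ord_simps(1) le_less_trans)
    have "anti (\<lambda>x. coprod f (x, block_swap a b c (drop k w))) (block_swap a b c (take k w)) =
        anti (\<lambda>x. coprod f (x, drop k w)) (take k w)" if "k < length w" for k
    proof -
      have words: "take k w \<in> words" "drop k w \<in> words"
        using less.prems(1) words_take_drop by auto
      have "coprod f (x, block_swap a b c (drop k w)) = coprod f (x, drop k w)" for x
        by (rule block_symD[OF block_sym_coprod_right[OF less.prems(8) assms(2)] words(2) abc])
          (intro cut_take_drop cuts small cnt_take_drop_le)+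
      moreover have "anti (\<lambda>x. coprod f (x, drop k w)) (block_swap a b c (take k w)) =
          anti (\<lambda>x. coprod f (x, drop k w)) (take k w)"
        using that by (intro less(1) words abc cut_take_drop cuts small cnt_take_drop_le
            block_sym_coprod_left less.prems(8) assms(2)) simp
      ultimately show ?thesis by simp
    qed
    then show ?case
      by (cases "w = []")
        (simp_all add: anti.simps[of f w] anti.simps[of f "block_swap a b c w"]
          block_swap_take_drop, simp_all add: block_swap_def)
  qed
qed

lemma anti_left:
  assumes "block_sym 1 f" "on_words f"
  shows "(\<Sum>k\<le>length w. anti (\<lambda>x. coprod f (x, drop k w)) (take k w)) = (if w = [] then f [] else 0)"
proof -
  have "(\<lambda>x. coprod f (x, [])) = f" using coprod_Nil_right[OF assms] by auto
  then show ?thesis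
    by (simp add: lessThan_Suc_atMost[symmetric] anti.simps[of f w])
qed

lemma sum_triangle_strict:
  fixes F :: "nat \<Rightarrow> nat \<Rightarrow> 'b::comm_monoid_add"
  shows "(\<Sum>k\<in>{1..<n}. \<Sum>j\<in>{1..k}. F j k) = (\<Sum>j\<in>{1..<n}. \<Sum>i<n - j. F j (j + i))"
proof -
  have "(\<Sum>k\<in>{1..<n}. \<Sum>j\<in>{1..k}. F j k) = (\<Sum>(k, j)\<in>(SIGMA k:{1..<n}. {1..k}). F j k)"
    by (rule sum.Sigma) auto
  also have "\<dots> = (\<Sum>(j, i)\<in>(SIGMA j:{1..<n}. {..<n - j}). F j (j + i))"
    by (rule sum.reindex_bij_witness[where i = "\<lambda>(j, i). (j + i, j)" and j = "\<lambda>(k, j). (j, k - j)"]) auto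
  also have "\<dots> = (\<Sum>j\<in>{1..<n}. \<Sum>i<n - j. F j (j + i))"
    by (rule sum.Sigma[symmetric]) auto
  finally show ?thesis .
qed

text \<open>Unfolding the last factor by the left recursion and the first one by the induction hypothesis
  leads to the same sum over three-part splittings of \<open>w\<close>.\<close>

lemma anti_right_recursion:
  assumes "block_sym 1 f" "on_words f" "w \<noteq> []"
  shows "anti f w = - (\<Sum>j\<in>{1..length w}. anti (\<lambda>y. coprod f (take j w, y)) (drop j w))"
  using assms
proof (induction "length w" arbitrary: w f rule: less_induct)
  case less
  let ?n = "length w"
  let ?G = "\<lambda>j k. anti (\<lambda>y. coprod (\<lambda>x. coprod f (x, drop k w)) (take j w, y)) (drop j (take k w))"
  have n: "1 \<le> ?n" using less.prems(3) by (simp add: Suc_le_eq)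
  \<comment> \<open>The terms \<open>k = 0\<close> and \<open>j = length w\<close> are split off; by
    the counit laws both equal \<open>f w\<close>.\<close>
  have eq0: "{..<?n} = insert 0 {1..<?n}" and eqn: "{1..?n} = insert ?n {1..<?n}"
    using n by (auto simp del: length_greater_0_conv)
  have left: "anti (\<lambda>x. coprod f (x, drop k w)) (take k w) = - (\<Sum>j\<in>{1..k}. ?G j k)"
    if "k \<in> {1..<?n}" for k
  proof -
    have "anti (\<lambda>x. coprod f (x, drop k w)) (take k w) =
        - (\<Sum>j\<in>{1..length (take k w)}.
            anti (\<lambda>y. coprod (\<lambda>x. coprod f (x, drop k w)) (take j (take k w), y)) (drop j (take k w)))"
      using that less.prems n
      by (intro less(1) block_sym_coprod_left on_words_coprod) auto
    then show ?thesis using that by (simp add: min_def)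
  qed
  have right: "anti (\<lambda>y. coprod f (take j w, y)) (drop j w) = - (\<Sum>i<?n - j. ?G j (j + i))"
    if "j \<in> {1..<?n}" for j
    using that
    by (simp add: anti.simps[of _ "drop j w"] take_drop drop_drop add.commute coprod_coassoc)
  have "anti f w = - (anti (\<lambda>x. coprod f (x, w)) [] +
      (\<Sum>k\<in>{1..<?n}. anti (\<lambda>x. coprod f (x, drop k w)) (take k w)))"
    unfolding anti.simps[of f w] eq0 using less.prems(3) by simp
  also have "\<dots> = - (f w - (\<Sum>k\<in>{1..<?n}. \<Sum>j\<in>{1..k}. ?G j k))"
    by (simp add: left sum_negf coprod_Nil_left less.prems)
  also have "\<dots> = - (f w - (\<Sum>j\<in>{1..<?n}. \<Sum>i<?n - j. ?G j (j + i)))"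
    unfolding sum_triangle_strict ..
  also have "\<dots> = - (anti (\<lambda>y. coprod f (take ?n w, y)) (drop ?n w) +
      (\<Sum>j\<in>{1..<?n}. anti (\<lambda>y. coprod f (take j w, y)) (drop j w)))"
    by (simp add: right sum_negf coprod_Nil_right less.prems)
  also have "\<dots> = - (\<Sum>j\<in>{1..?n}. anti (\<lambda>y. coprod f (take j w, y)) (drop j w))"
    unfolding eqn by simp
  finally show ?case .
qed

lemma anti_right:
  assumes "block_sym 1 f" "on_words f"
  shows "(\<Sum>k\<le>length w. anti (\<lambda>y. coprod f (take k w, y)) (drop k w)) = (if w = [] then f [] else 0)"
proof (cases "w = []")
  case True
  then show ?thesis using coprod_Nil_left[OF assms] by simp
next
  case False
  have "(\<lambda>y. coprod f ([], y)) = f" using coprod_Nil_left[OF assms] by auto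
  moreover have "{..length w} = insert 0 {1..length w}" by (auto simp: not_less_eq_eq)
  ultimately show ?thesis using anti_right_recursion[OF assms False] False by simp
qed


section \<open>Spaces of series\<close>

lemma sum_fun_apply: "sum F A x = (\<Sum>a\<in>A. F a x)"
  by (induction A rule: infinite_finite_induct) auto

lemma sum_list_fun_apply: "sum_list fs x = (\<Sum>f\<leftarrow>fs. f x)"
  by (induction fs) auto

text \<open>The concrete description of the invariant subspaces; bounded length expresses that
  elements are finite combinations of the \<open>Gser u\<close>.\<close>

definition series :: "enat \<Rightarrow> (nat list \<Rightarrow> 'k::field) set" where
  "series r = {f. on_words f \<and> block_sym r f \<and> (\<exists>N. \<forall>w. N < length w \<longrightarrow> f w = 0)}"

definition homogeneous :: "nat \<Rightarrow> (nat list \<Rightarrow> 'k::field) set" where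
  "homogeneous n = {f. \<forall>w. length w \<noteq> n \<longrightarrow> f w = 0}"

lemma seriesD: "f \<in> series r \<Longrightarrow> on_words f" "f \<in> series r \<Longrightarrow> block_sym r f"
  by (simp_all add: series_def)

lemma series_antimono: "r \<le> s \<Longrightarrow> series s \<subseteq> series r"
  by (auto simp: series_def intro: block_sym_antimono)

lemma subspace_series: "fun_vs.subspace (series r)"
proof (rule fun_vs.subspaceI)
  show "0 \<in> series r" by (simp add: series_def on_words_def block_sym_def)
next
  fix f g :: "nat list \<Rightarrow> 'a" assume fg: "f \<in> series r" "g \<in> series r"
  then obtain M N where "\<forall>w. M < length w \<longrightarrow> f w = 0" "\<forall>w. N < length w \<longrightarrow> g w = 0"
    by (auto simp: series_def)
  then have "\<forall>w. max M N < length w \<longrightarrow> (f + g) w = 0" by simp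
  moreover have "on_words (f + g)" "block_sym r (f + g)"
    using fg by (auto simp: series_def on_words_def block_sym_def)
  ultimately show "f + g \<in> series r" unfolding series_def by blast
next
  fix c and f :: "nat list \<Rightarrow> 'a" assume "f \<in> series r"
  then show "fscale c f \<in> series r" by (auto simp: series_def on_words_def block_sym_def fscale_def)
qed

lemma subspace_homogeneous: "fun_vs.subspace (homogeneous n)"
  by (rule fun_vs.subspaceI) (auto simp: homogeneous_def fscale_def)

lemma graded_space_series: "graded_space (\<lambda>n. series r \<inter> homogeneous n) (series r :: (nat list \<Rightarrow> 'k::field) set)"
  unfolding graded_space_def
proof (intro conjI allI)
  let ?C = "\<lambda>n. series r \<inter> homogeneous n :: (nat list \<Rightarrow> 'k) set"
  show "fun_vs.subspace (?C n)" for n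
    using subspace_series subspace_homogeneous by (rule fun_vs.subspace_inter)
  show "fun_vs.span (\<Union>n. ?C n) = series r"
  proof
    show "fun_vs.span (\<Union>n. ?C n) \<subseteq> series r"
      by (rule fun_vs.span_minimal[OF _ subspace_series]) auto
    show "series r \<subseteq> fun_vs.span (\<Union>n. ?C n)"
    proof
      fix f :: "nat list \<Rightarrow> 'k" assume f: "f \<in> series r"
      then obtain N where N: "\<forall>w. N < length w \<longrightarrow> f w = 0" by (auto simp: series_def)
      define p where "p n w = (if length w = n then f w else 0)" for n w
      have "p n \<in> ?C n" for n
        using f by (auto simp: p_def series_def on_words_def block_sym_def homogeneous_def)
      then have "(\<Sum>n\<le>N. p n) \<in> fun_vs.span (\<Union>n. ?C n)"
        by (intro fun_vs.span_sum fun_vs.span_base) auto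
      moreover have "(\<Sum>n\<le>N. p n) = f"
        using N by (auto simp: sum_fun_apply p_def not_le)
      ultimately show "f \<in> fun_vs.span (\<Union>n. ?C n)" by simp
    qed
  qed
  fix n
  \<comment> \<open>A subspace that contains all components other than the \<open>n\<close>-th and
    meets the \<open>n\<close>-th one only in \<open>0\<close>.\<close>
  let ?S = "{f :: nat list \<Rightarrow> 'k. \<forall>w. length w = n \<longrightarrow> f w = 0}"
  have "fun_vs.subspace ?S" by (rule fun_vs.subspaceI) (auto simp: fscale_def)
  then have "fun_vs.span (\<Union>m\<in>- {n}. ?C m) \<subseteq> ?S"
    by (rule fun_vs.span_minimal[rotated]) (auto simp: homogeneous_def)
  moreover have "f = 0" if "f \<in> homogeneous n" "f \<in> ?S" for f :: "nat list \<Rightarrow> 'k"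
    using that by (auto simp: homogeneous_def fun_eq_iff)
  moreover have "0 \<in> ?C n"
    using subspace_series subspace_homogeneous by (metis fun_vs.subspace_0 Int_iff)
  ultimately show "?C n \<inter> fun_vs.span (\<Union>m\<in>- {n}. ?C m) = {0}"
    using fun_vs.span_zero by blast
qed

section \<open>The basis of the series \<open>Gser u\<close>\<close>

lemma Gser_apply: "w \<in> words \<Longrightarrow> Gser u w = (if Park w = u then 1 else 0)"
  by (simp add: Gser_def)

lemma Gser_parking: "parking w \<Longrightarrow> Gser u w = (if w = u then 1 else 0)"
  by (simp add: Gser_apply parking_words Park_parking)

lemma Gser_series: "Gser u \<in> series 1 \<inter> homogeneous (length u)"
proof -
  have "Park (Park w) = Park w" if "w \<in> words" for w
    by (rule Park_parking[OF parking_Park[OF that]])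
  then have "block_sym 1 (Gser u)"
    unfolding block_sym_1_iff by (simp add: Gser_apply Park_words)
  moreover have "Gser u \<in> homogeneous (length u)"
    by (auto simp: homogeneous_def Gser_def)
  ultimately show ?thesis
    by (auto simp: series_def on_words_def homogeneous_def Gser_def intro!: exI[of _ "length u"])
qed

lemma finite_Gsupp:
  assumes "f \<in> series 1" shows "finite (Gsupp f)"
proof -
  obtain N where "\<forall>w. N < length w \<longrightarrow> f w = 0" using assms by (auto simp: series_def)
  then have "Gsupp f \<subseteq> {u. parking u \<and> length u \<le> N}"
    by (auto simp: Gsupp_def) (meson linorder_not_le)
  then show ?thesis using finite_parking finite_subset by blast
qed

text \<open>At \<open>w\<close> only \<open>u = Park w\<close> contributes, with coefficient
  \<open>f (Park w) = f w\<close>.\<close>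

lemma Gser_expansion:
  assumes "f \<in> series 1" shows "f w = (\<Sum>u\<in>Gsupp f. f u * Gser u w)"
proof (cases "w \<in> words")
  case True
  have "(\<Sum>u\<in>Gsupp f. f u * Gser u w) = (\<Sum>u\<in>Gsupp f. if Park w = u then f u else 0)"
    using True by (intro sum.cong) (auto simp: Gser_apply)
  also have "\<dots> = f (Park w)"
    using finite_Gsupp[OF assms] parking_Park[OF True] by (simp add: Gsupp_def)
  also have "\<dots> = f w" by (rule block_sym_Park[OF seriesD(2)[OF assms] True])
  finally show ?thesis by simp
next
  case False
  then show ?thesis using seriesD(1)[OF assms] by (simp add: Gser_def on_words_def)
qed

lemma span_Gser:
  "fun_vs.span {Gser u |u. parking u} = (series 1 :: (nat list \<Rightarrow> 'k::field) set)"
  "fun_vs.span {Gser u |u. parking u \<and> length u = n} = (series 1 \<inter> homogeneous n :: (nat list \<Rightarrow> 'k) set)"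
proof -
  have expand: "f = (\<Sum>u\<in>Gsupp f. fscale (f u) (Gser u))" if "f \<in> series 1" for f :: "nat list \<Rightarrow> 'k"
    by (rule ext, unfold sum_fun_apply fscale_def, rule Gser_expansion[OF that])
  show "fun_vs.span {Gser u |u. parking u} = (series 1 :: (nat list \<Rightarrow> 'k) set)"
  proof
    show "fun_vs.span {Gser u |u. parking u} \<subseteq> (series 1 :: (nat list \<Rightarrow> 'k) set)"
      using Gser_series by (intro fun_vs.span_minimal[OF _ subspace_series]) auto
    show "(series 1 :: (nat list \<Rightarrow> 'k) set) \<subseteq> fun_vs.span {Gser u |u. parking u}"
    proof
      fix f :: "nat list \<Rightarrow> 'k" assume f: "f \<in> series 1"
      have "(\<Sum>u\<in>Gsupp f. fscale (f u) (Gser u)) \<in> fun_vs.span {Gser u |u. parking u}"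
        by (intro fun_vs.span_sum fun_vs.span_scale fun_vs.span_base) (auto simp: Gsupp_def)
      then show "f \<in> fun_vs.span {Gser u |u. parking u}" using f by (simp only: expand[symmetric])
    qed
  qed
  show "fun_vs.span {Gser u |u. parking u \<and> length u = n} = (series 1 \<inter> homogeneous n :: (nat list \<Rightarrow> 'k) set)"
  proof
    show "fun_vs.span {Gser u |u. parking u \<and> length u = n} \<subseteq> (series 1 \<inter> homogeneous n :: (nat list \<Rightarrow> 'k) set)"
      using Gser_series
      by (intro fun_vs.span_minimal fun_vs.subspace_inter subspace_series subspace_homogeneous) auto
    show "(series 1 \<inter> homogeneous n :: (nat list \<Rightarrow> 'k) set) \<subseteq> fun_vs.span {Gser u |u. parking u \<and> length u = n}"
    proof
      fix f :: "nat list \<Rightarrow> 'k" assume f: "f \<in> series 1 \<inter> homogeneous n"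
      have "(\<Sum>u\<in>Gsupp f. fscale (f u) (Gser u)) \<in> fun_vs.span {Gser u |u. parking u \<and> length u = n}"
        using f by (intro fun_vs.span_sum fun_vs.span_scale fun_vs.span_base)
          (auto simp: Gsupp_def homogeneous_def)
      then show "f \<in> fun_vs.span {Gser u |u. parking u \<and> length u = n}"
        using f by (simp only: expand[symmetric] Int_iff)
    qed
  qed
qed

section \<open>Structure maps\<close>

lemma series_conv:
  assumes "f \<in> series r" "g \<in> series r" shows "conv f g \<in> series r"
proof -
  obtain M N where MN: "\<forall>w. M < length w \<longrightarrow> f w = 0" "\<forall>w. N < length w \<longrightarrow> g w = 0"
    using assms by (auto simp: series_def)
  have "conv f g w = 0" if "M + N < length w" for w
    unfolding conv_def
  proof (rule sum.neutral, safe)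
    fix k assume "k \<le> length w"
    then have "M < length (take k w) \<or> N < length (drop k w)" using that by auto
    then show "f (take k w) * g (drop k w) = 0" using MN by auto
  qed
  then show ?thesis
    using assms by (auto simp: series_def intro!: on_words_conv block_sym_conv)
qed

lemma conv_homogeneous:
  assumes "f \<in> homogeneous m" "g \<in> homogeneous n" shows "conv f g \<in> homogeneous (m + n)"
proof -
  have "conv f g w = 0" if "length w \<noteq> m + n" for w
    unfolding conv_def
  proof (rule sum.neutral, safe)
    fix k assume "k \<le> length w"
    then have "length (take k w) \<noteq> m \<or> length (drop k w) \<noteq> n" using that by auto
    then show "f (take k w) * g (drop k w) = 0" using assms by (auto simp: homogeneous_def)
  qed
  then show ?thesis by (simp add: homogeneous_def)
qed

lemma Gser_Nil: "Gser [] w = (if w = [] then 1 else 0)"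
proof -
  have "Park w = [] \<longleftrightarrow> w = []" for w using length_Park[of w] by (metis length_0_conv)
  then show ?thesis by (auto simp: Gser_def words_iff)
qed

lemma conv_unit: "conv (Gser []) f = f" "conv f (Gser []) = f"
proof -
  have "conv (Gser []) f w = f w" for w
  proof -
    have "conv (Gser []) f w = (\<Sum>k\<le>length w. if k = 0 then f w else 0)"
      unfolding conv_def by (intro sum.cong) (auto simp: Gser_Nil)
    then show ?thesis by simp
  qed
  then show "conv (Gser []) f = f" by auto
  have "conv f (Gser []) w = f w" for w
  proof -
    have "conv f (Gser []) w = (\<Sum>k\<le>length w. if k = length w then f w else 0)"
      unfolding conv_def by (intro sum.cong) (auto simp: Gser_Nil)
    then show ?thesis by simp
  qed
  then show "conv f (Gser []) = f" by auto
qed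

lemma conv_Gser:
  assumes "p \<in> words"
  shows "conv (Gser u) (Gser v) p =
    (if Park (take (length u) p) = u \<and> Park (drop (length u) p) = v then 1 else 0)"
proof -
  have pw: "take k p \<in> words" "drop k p \<in> words" for k using assms words_take_drop by auto
  have "conv (Gser u) (Gser v) p =
      (\<Sum>k\<le>length p. if k = length u then
         (if Park (take (length u) p) = u \<and> Park (drop (length u) p) = v then 1 else 0) else 0)"
    unfolding conv_def
  proof (rule sum.cong[OF refl])
    fix k assume k: "k \<in> {..length p}"
    have neq: "Park (take k p) \<noteq> u" if "k \<noteq> length u" using that k length_Park[of "take k p"] by auto
    show "Gser u (take k p) * Gser v (drop k p) = (if k = length u then
         (if Park (take (length u) p) = u \<and> Park (drop (length u) p) = v then 1 else 0) else 0)"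
      by (cases "k = length u") (simp_all add: Gser_apply pw neq)
  qed
  also have "\<dots> = (if Park (take (length u) p) = u \<and> Park (drop (length u) p) = v then 1 else 0)"
  proof -
    have "length u \<le> length p" if "Park (take (length u) p) = u"
      using that length_Park[of "take (length u) p"] by auto
    then show ?thesis by auto
  qed
  finally show ?thesis .
qed

text \<open>Both sides are constant on parkization classes, so they may be compared at parking
  functions, where each is an indicator of the same splitting.\<close>

lemma G_mult_eq_conv: "G_mult u v = (conv (Gser u) (Gser v) :: _ \<Rightarrow> 'k::field)"
proof
  fix w
  let ?S = "{a @ b |a b. parking (a @ b) \<and> Park a = u \<and> Park b = v}"
  have fin: "finite ?S"
    by (rule finite_subset[OF _ finite_parking[of "length u + length v"]]) auto
  show "G_mult u v w = (conv (Gser u) (Gser v) w :: 'k)"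
  proof (cases "w \<in> words")
    case True
    let ?p = "Park w"
    have p: "parking ?p" by (rule parking_Park[OF True])
    have "G_mult u v w = (\<Sum>w'\<in>?S. if ?p = w' then 1 else 0 :: 'k)"
      using True by (simp add: G_mult_def sum_fun_apply Gser_apply)
    also have "\<dots> = (if ?p \<in> ?S then 1 else 0)" using fin by simp
    also have "?p \<in> ?S \<longleftrightarrow> Park (take (length u) ?p) = u \<and> Park (drop (length u) ?p) = v"
    proof
      assume "?p \<in> ?S"
      then obtain a b where ab: "?p = a @ b" "Park a = u" "Park b = v" by blast
      then have "length u = length a" by auto
      then show "Park (take (length u) ?p) = u \<and> Park (drop (length u) ?p) = v" using ab by simp
    next
      assume "Park (take (length u) ?p) = u \<and> Park (drop (length u) ?p) = v"
      then show "?p \<in> ?S"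
        using p by (intro CollectI exI[of _ "take (length u) ?p"] exI[of _ "drop (length u) ?p"]) simp
    qed
    also have "(if Park (take (length u) ?p) = u \<and> Park (drop (length u) ?p) = v then 1 else 0) =
        (conv (Gser u) (Gser v) ?p :: 'k)"
      by (rule conv_Gser[OF Park_words[OF True], symmetric])
    also have "\<dots> = conv (Gser u) (Gser v) w"
      by (intro block_sym_Park block_sym_conv True seriesD(2) IntD1[OF Gser_series])
    finally show ?thesis .
  next
    case False
    have "on_words (conv (Gser u) (Gser v) :: _ \<Rightarrow> 'k)"
      by (intro on_words_conv) (simp_all add: on_words_def Gser_def)
    then show ?thesis using False by (simp add: G_mult_def sum_fun_apply Gser_def on_words_def)
  qed
qed

lemma mem_shuffles_iff_mix:
  assumes "parking a" "parking b"
  shows "u \<in> shuffles a (map (\<lambda>x. x + length a) b) \<longleftrightarrow> u \<in> mix (length a) a b"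
proof -
  let ?k = "length a" and ?b = "map (\<lambda>x. x + length a) b"
  have a: "\<forall>x\<in>set a. x \<le> ?k" using assms(1) by (simp add: parking_iff_cut)
  have b: "\<forall>x\<in>set ?b. \<not> x \<le> ?k"
    using parking_words[OF assms(2)] by (auto simp: words_iff intro: gr0I)
  have *: "map (\<lambda>x. x + ?k) (high ?k u) = filter (\<lambda>x. \<not> x \<le> ?k) u"
    by (induction u) (auto simp: high_def)
  have inj: "map (\<lambda>x. x + ?k) c = ?b \<longleftrightarrow> c = b" for c
    by (rule inj_map_eq_map) (simp add: inj_def)
  have "u \<in> shuffles a ?b \<longleftrightarrow> u \<in> partition (\<lambda>x. x \<le> ?k) -` {(a, ?b)}"
    by (subst inv_image_partition) (use a b in auto)
  also have "\<dots> \<longleftrightarrow> low ?k u = a \<and> filter (\<lambda>x. \<not> x \<le> ?k) u = ?b"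
    by (auto simp: low_def o_def)
  also have "\<dots> \<longleftrightarrow> u \<in> mix ?k a b"
    unfolding *[symmetric] inj by (simp add: mix_def)
  finally show ?thesis .
qed

lemma G_comult_eq:
  "G_comult u = (\<Sum>(a, b)\<in>{(a, b). parking a \<and> parking b \<and> u \<in> mix (length a) a b}. tensor (Gser a) (Gser b))"
  unfolding G_comult_def
  by (rule arg_cong[where f = "sum _"]) (auto simp: mem_shuffles_iff_mix)

text \<open>A pair \<open>(a, b)\<close> is determined by the length of \<open>a\<close>, through
  the two restrictions of \<open>u\<close>.\<close>

lemma finite_G_comult: "finite {(a, b). parking a \<and> parking b \<and> u \<in> mix (length a) a b}"
proof (rule finite_subset)
  show "{(a, b). parking a \<and> parking b \<and> u \<in> mix (length a) a b} \<subseteq>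
      (\<lambda>k. (low k u, high k u)) ` {..length u}"
  proof clarify
    fix a b assume "u \<in> mix (length a) a b"
    then have "(a, b) = (low (length a) u, high (length a) u)" "length a \<le> length u"
      using length_mix[of u "length a" a b] by (auto simp: mix_def)
    then show "(a, b) \<in> (\<lambda>k. (low k u, high k u)) ` {..length u}" by blast
  qed
qed simp

text \<open>At \<open>(x, y)\<close> only the pair of parkizations can contribute on the left. On
  the right all shuffles of parking functions are parking, so only \<open>u\<close> itself
  counts.\<close>

lemma G_comult_eq_coprod:
  assumes "parking u" shows "G_comult u = (coprod (Gser u) :: _ \<Rightarrow> 'k::field)"
proof
  fix xy :: "nat list \<times> nat list"
  obtain x y where xy: "xy = (x, y)" by (cases xy)
  let ?S = "{(a, b). parking a \<and> parking b \<and> u \<in> mix (length a) a b}"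
  have G: "G_comult u (x, y) = (\<Sum>(a, b)\<in>?S. Gser a x * Gser b y :: 'k)"
    unfolding G_comult_eq sum_fun_apply by (intro sum.cong) (auto simp: tensor_def)
  show "G_comult u xy = (coprod (Gser u) xy :: 'k)"
  proof (cases "x \<in> words \<and> y \<in> words")
    case True
    let ?X = "Park x" and ?Y = "Park y"
    have p: "parking ?X" "parking ?Y" using True parking_Park by auto
    have "G_comult u (x, y) = (\<Sum>ab\<in>?S. if (?X, ?Y) = ab then 1 else 0 :: 'k)"
      unfolding G by (intro sum.cong) (auto simp: Gser_apply True split: if_splits)
    also have "\<dots> = (if (?X, ?Y) \<in> ?S then 1 else 0)" using finite_G_comult by simp
    also have "\<dots> = (\<Sum>v\<in>mix (length x) ?X ?Y. if v = u then 1 else 0)"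
      using p by simp
    also have "\<dots> = (\<Sum>v\<in>mix (length x) ?X ?Y. Gser u v)"
      using parking_mix[OF p] by (intro sum.cong) (auto simp: Gser_parking)
    also have "\<dots> = coprod (Gser u) (x, y)" using True by (simp add: coprod_def)
    finally show ?thesis by (simp add: xy)
  next
    case False
    then have "G_comult u (x, y) = (0 :: 'k)" unfolding G by (intro sum.neutral) (auto simp: Gser_def)
    then show ?thesis using False by (auto simp: xy coprod_def)
  qed
qed

section \<open>The structure maps in coordinates\<close>

lemma PQSym_simps:
  "hcarrier PQSym = series 1" "hcomp PQSym n = series 1 \<inter> homogeneous n"
  "hunit PQSym = Gser []" "hcounit PQSym f = f []"
  by (simp_all add: PQSym_def span_Gser)

lemma hmult_eq_conv:
  assumes "f \<in> series 1" "g \<in> series 1" shows "hmult PQSym f g = conv f g"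
proof
  fix w
  have "conv f g w = (\<Sum>k\<le>length w. \<Sum>u\<in>Gsupp f. \<Sum>v\<in>Gsupp g.
      f u * g v * (Gser u (take k w) * Gser v (drop k w)))"
    unfolding conv_def
  proof (rule sum.cong[OF refl])
    fix k
    show "f (take k w) * g (drop k w) = (\<Sum>u\<in>Gsupp f. \<Sum>v\<in>Gsupp g.
        f u * g v * (Gser u (take k w) * Gser v (drop k w)))"
      unfolding Gser_expansion[OF assms(1), of "take k w"] Gser_expansion[OF assms(2), of "drop k w"]
        sum_product by (simp add: ac_simps)
  qed
  also have "\<dots> = (\<Sum>u\<in>Gsupp f. \<Sum>v\<in>Gsupp g. \<Sum>k\<le>length w.
      f u * g v * (Gser u (take k w) * Gser v (drop k w)))"
    by (subst sum.swap) (intro sum.cong refl sum.swap)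
  also have "\<dots> = hmult PQSym f g w"
    by (simp add: PQSym_def sum_fun_apply fscale_def G_mult_eq_conv conv_def sum_distrib_left)
  finally show "hmult PQSym f g w = conv f g w" by simp
qed

lemma hcomult_eq_coprod:
  assumes "f \<in> series 1" shows "hcomult PQSym f = coprod f"
proof
  fix p :: "nat list \<times> nat list"
  obtain x y where p: "p = (x, y)" by (cases p)
  have "coprod (\<lambda>w. \<Sum>u\<in>Gsupp f. f u * Gser u w) (x, y) = (\<Sum>u\<in>Gsupp f. f u * coprod (Gser u) (x, y))"
  proof (cases "x \<in> words \<and> y \<in> words")
    case True
    then show ?thesis by (simp add: coprod_def sum_distrib_left) (rule sum.swap)
  next
    case False
    then have "coprod h (x, y) = 0" for h :: "nat list \<Rightarrow> 'a" by (auto simp: coprod_def)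
    then show ?thesis by simp
  qed
  moreover have "(\<lambda>w. \<Sum>u\<in>Gsupp f. f u * Gser u w) = f"
    by (rule ext, rule Gser_expansion[OF assms, symmetric])
  ultimately have "coprod f p = (\<Sum>u\<in>Gsupp f. f u * coprod (Gser u) p)"
    unfolding p by (simp only:)
  also have "\<dots> = (\<Sum>u\<in>Gsupp f. f u * G_comult u p)"
    by (rule sum.cong[OF refl]) (simp add: G_comult_eq_coprod Gsupp_def)
  finally have "coprod f p = (\<Sum>u\<in>Gsupp f. f u * G_comult u p)" .
  then show "hcomult PQSym f p = coprod f p" by (simp add: PQSym_def sum_fun_apply fscale_def)
qed

lemma series_coprod:
  assumes "f \<in> series r" "1 \<le> r"
  shows "(\<lambda>x. coprod f (x, y)) \<in> series r" "(\<lambda>y. coprod f (x, y)) \<in> series r"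
proof -
  obtain N where N: "\<forall>w. N < length w \<longrightarrow> f w = 0" using assms by (auto simp: series_def)
  then have "N < length x + length y \<Longrightarrow> coprod f (x, y) = 0" for x y by (intro coprod_length) auto
  then have "\<exists>N. \<forall>x. N < length x \<longrightarrow> coprod f (x, y) = 0" "\<exists>N. \<forall>y. N < length y \<longrightarrow> coprod f (x, y) = 0"
    for x y by (auto intro!: exI[of _ N])
  then show "(\<lambda>x. coprod f (x, y)) \<in> series r" "(\<lambda>y. coprod f (x, y)) \<in> series r"
    using assms seriesD[OF assms(1)]
    by (simp_all add: series_def on_words_coprod block_sym_coprod_left block_sym_coprod_right)
qed

lemma series_anti:
  assumes "f \<in> series r" "1 \<le> r" shows "anti f \<in> series r"
proof -
  obtain N where N: "\<forall>w. N < length w \<longrightarrow> f w = 0" using assms by (auto simp: series_def)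
  then have "\<forall>w. N < length w \<longrightarrow> anti f w = 0" by (auto intro: anti_length)
  then show ?thesis
    using seriesD[OF assms(1)] assms(2) by (auto simp: series_def on_words_anti block_sym_anti)
qed

section \<open>Tensor squares\<close>

text \<open>The indicator functions of these classes play the role of a monomial basis.\<close>

definition sym_class :: "enat \<Rightarrow> nat list \<Rightarrow> nat list set" where
  "sym_class r w = {v \<in> words. \<forall>P :: nat list \<Rightarrow> bool. block_sym r P \<longrightarrow> P v = P w}"

lemma sym_class_length: "v \<in> sym_class r w \<Longrightarrow> length v = length w"
proof -
  have "block_sym r (\<lambda>u. length u = length w)" by (simp add: block_sym_def)
  then show "v \<in> sym_class r w \<Longrightarrow> length v = length w" by (auto simp: sym_class_def)
qed

lemma sym_class_eq:
  assumes "v \<in> sym_class r w" shows "sym_class r v = sym_class r w"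
  using assms by (auto simp: sym_class_def)

lemma sym_class_indicator: "(\<lambda>v. if v \<in> sym_class r w then 1 else 0) \<in> series r"
proof -
  have "block_swap a b c v \<in> sym_class r w \<longleftrightarrow> v \<in> sym_class r w"
    if "v \<in> words" "a \<le> b" "b \<le> c" "is_cut v a" "is_cut v b" "is_cut v c"
      "enat (cnt v a b) < r \<or> enat (cnt v b c) < r" for v a b c
  proof -
    have "P (block_swap a b c v) = P v" if "block_sym r P" for P :: "nat list \<Rightarrow> bool"
      by (rule block_symD[OF that]) fact+
    then show ?thesis
      using that block_swap_words[of a b c v] unfolding sym_class_def mem_Collect_eq by metis
  qed
  then have "block_sym r (\<lambda>v. if v \<in> sym_class r w then 1 else 0)" by (intro block_symI) simp
  moreover have "length v \<le> length w" if "v \<in> sym_class r w" for v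
    using sym_class_length[OF that] by simp
  ultimately show ?thesis
    by (auto simp: series_def on_words_def sym_class_def intro!: exI[of _ "length w"] dest: leD)
qed

text \<open>For each \<open>x\<close> the slice in \<open>y\<close> is constant on classes and
  vanishes on long words. Every class of bounded length contains a parking function, so finitely
  many indicators suffice, and each is paired with the slice at a representative, which is invariant
  in \<open>x\<close>.\<close>

lemma coprod_tensor_space:
  assumes f: "f \<in> series r" and r: "1 \<le> r"
  shows "coprod f \<in> tensor_space (series r) (series r)"
proof -
  obtain N where N: "\<forall>w. N < length w \<longrightarrow> f w = 0" using f by (auto simp: series_def)
  define rep where "rep C = (SOME u. u \<in> C)" for C :: "nat list set"
  let ?ind = "\<lambda>C v. if v \<in> C then 1 else 0 :: 'a"
  let ?K = "sym_class r ` {u. parking u \<and> length u \<le> N}"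
  have finK: "finite ?K" using finite_parking by simp
  have rep: "sym_class r (rep (sym_class r u)) = sym_class r u" if "u \<in> words" for u
  proof -
    have "u \<in> sym_class r u" using that by (simp add: sym_class_def)
    then have "rep (sym_class r u) \<in> sym_class r u" unfolding rep_def by (rule someI)
    then show ?thesis by (rule sym_class_eq)
  qed
  have const: "coprod f (x, v) = coprod f (x, w)" if "v \<in> sym_class r w" for x v w
  proof -
    \<comment> \<open>Classes are tested on predicates; equality with a fixed value turns the
      invariant slice into one.\<close>
    have "block_sym r (\<lambda>u. coprod f (x, u) = coprod f (x, w))"
      using block_sym_coprod_right[OF seriesD(2)[OF f] r, of x] by (simp add: block_sym_def)
    then show ?thesis using that by (auto simp: sym_class_def)
  qed
  have zero: "coprod f (x, y) = 0" if "N < length y" for x y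
    using N that by (intro coprod_length) auto
  have expand: "coprod f (x, y) = (\<Sum>C\<in>?K. coprod f (x, rep C) * ?ind C y)" for x y
  proof (cases "y \<in> words \<and> length y \<le> N")
    case True
    have self: "y \<in> sym_class r y" using True by (simp add: sym_class_def)
    have "P (Park y) = P y" if "block_sym r P" for P :: "nat list \<Rightarrow> bool"
      using block_sym_Park[OF block_sym_antimono[OF that r]] True by simp
    then have "Park y \<in> sym_class r y" using True by (simp add: sym_class_def Park_words)
    then have "sym_class r y = sym_class r (Park y)" by (simp add: sym_class_eq)
    then have yK: "sym_class r y \<in> ?K" using parking_Park[of y] True by simp
    have "?ind C y = (if C = sym_class r y then 1 else 0)" if "C \<in> ?K" for C
    proof -
      obtain u where "C = sym_class r u" using \<open>C \<in> ?K\<close> by blast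
      then have "y \<in> C \<longleftrightarrow> C = sym_class r y" using self sym_class_eq by metis
      then show ?thesis by simp
    qed
    then have "(\<Sum>C\<in>?K. coprod f (x, rep C) * ?ind C y) =
        (\<Sum>C\<in>?K. if C = sym_class r y then coprod f (x, rep C) else 0)"
      by (intro sum.cong) auto
    also have "\<dots> = coprod f (x, rep (sym_class r y))" using finK yK by simp
    also have "\<dots> = coprod f (x, y)"
      using const[of y "rep (sym_class r y)" x] rep[of y] True self by simp
    finally show ?thesis by simp
  next
    case False
    have "?ind C y = 0" if "C \<in> ?K" for C
    proof -
      obtain u where "C = sym_class r u" "length u \<le> N" using \<open>C \<in> ?K\<close> by blast
      moreover have "v \<in> words" if "v \<in> sym_class r u" for v using that by (simp add: sym_class_def)
      ultimately have "y \<notin> C" using False sym_class_length[of y r u] by auto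
      then show ?thesis by simp
    qed
    moreover have "coprod f (x, y) = 0"
    proof (cases "y \<in> words")
      case True
      then show ?thesis using False by (intro zero) simp
    qed (simp add: coprod_def)
    ultimately show ?thesis by simp
  qed
  have "coprod f = (\<Sum>C\<in>?K. tensor (\<lambda>x. coprod f (x, rep C)) (?ind C))"
    by (intro ext, clarify) (simp only: sum_fun_apply tensor_def prod.case, rule expand)
  also have "\<dots> \<in> tensor_space (series r) (series r)"
    unfolding tensor_space_def
  proof (intro fun_vs.span_sum fun_vs.span_base)
    fix C assume "C \<in> ?K"
    then have "?ind C \<in> series r" using sym_class_indicator by blast
    then show "tensor (\<lambda>x. coprod f (x, rep C)) (?ind C) \<in>
        {tensor f g |f g. f \<in> series r \<and> g \<in> series r}"
      using series_coprod(1)[OF f r] by blast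
  qed
  finally show ?thesis .
qed

lemma tensor_rep_apply:
  "tensor_rep A t ps \<Longrightarrow> t (x, y) = (\<Sum>(a, b)\<leftarrow>ps. a x * b y)"
  by (auto simp: tensor_rep_def sum_list_fun_apply tensor_def o_def case_prod_unfold)

lemma coprod_sum_list:
  "coprod (\<lambda>x. \<Sum>q\<leftarrow>qs. h q x * c q) p = (\<Sum>q\<leftarrow>qs. coprod (h q) p * c q)"
proof (induction qs)
  case Nil
  show ?case by (simp add: coprod_def split: prod.split)
next
  case (Cons q qs)
  then show ?case using coprod_scale[of "c q" "h q" p] by (simp add: coprod_add mult.commute)
qed

lemma anti_sum_list:
  "anti (\<lambda>x. \<Sum>q\<leftarrow>qs. h q x * c q) w = (\<Sum>q\<leftarrow>qs. anti (h q) w * c q)"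
proof (induction qs)
  case Nil
  show ?case by (simp add: anti_zero)
next
  case (Cons q qs)
  then show ?case using anti_scale[of "c q" "h q" w] by (simp add: anti_add mult.commute)
qed

lemma sum_list_sum: "(\<Sum>q\<leftarrow>qs. \<Sum>k\<in>A. F q k) = (\<Sum>k\<in>A. \<Sum>q\<leftarrow>qs. F q k)"
  for F :: "'a \<Rightarrow> 'b \<Rightarrow> 'c::comm_monoid_add"
  by (induction qs) (simp_all add: sum.distrib)

section \<open>Hopf algebra axioms\<close>


lemma tensor_rep_memD: "tensor_rep A t ps \<Longrightarrow> (a, b) \<in> set ps \<Longrightarrow> a \<in> A \<and> b \<in> A"
  by (auto simp: tensor_rep_def)

lemma sum_list_pair_cong:
  "(\<And>a b. (a, b) \<in> set ps \<Longrightarrow> F a b = G a b) \<Longrightarrow> (\<Sum>(a, b)\<leftarrow>ps. F a b) = (\<Sum>(a, b)\<leftarrow>ps. G a b)"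
  by (rule arg_cong[where f = sum_list]) (auto intro!: map_cong)

lemma conv_linear:
  "conv (f + g) h = conv f h + conv g h" "conv (fscale c f) h = fscale c (conv f h)"
  "conv h (f + g) = conv h f + conv h g" "conv h (fscale c f) = fscale c (conv h f)"
  by (auto simp: conv_def fun_eq_iff fscale_def sum.distrib sum_distrib_left algebra_simps)

lemma unital_algebra_PQSym: "unital_algebra (PQSym :: (nat list, 'k::field_char_0) graded_hopf)"
proof -
  note sp = subspace_series[of 1, where 'a = 'k]
  have unit: "Gser [] \<in> (series 1 :: (nat list \<Rightarrow> 'k) set)" using Gser_series by blast
  have lin: "linear_on fscale (series 1) (\<lambda>f. hmult PQSym f g)"
    "linear_on fscale (series 1) (\<lambda>f. hmult PQSym g f)"
    if "g \<in> series 1" for g :: "nat list \<Rightarrow> 'k"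
    unfolding linear_on_def using that
    by (simp_all add: hmult_eq_conv fun_vs.subspace_add[OF sp] fun_vs.subspace_scale[OF sp] conv_linear)
  show ?thesis
    unfolding unital_algebra_def PQSym_simps
    using sp unit lin by (auto simp: hmult_eq_conv series_conv conv_assoc conv_unit)
qed

lemma coprod_linear:
  "coprod (f + g) = coprod f + coprod g" "coprod (fscale c f) = fscale c (coprod f)"
  by (auto simp: fun_eq_iff plus_fun_def fscale_def coprod_add coprod_scale)

text \<open>Sums over a tensor representation fold back into slices of \<open>coprod f\<close>, so
  the axioms hold for every choice of \<open>ps\<close>.\<close>

lemma sum_list_tensor_rep_slices:
  assumes "tensor_rep A (coprod f) ps"
  shows "(\<lambda>x. coprod f (x, y)) = (\<lambda>x. \<Sum>q\<leftarrow>ps. fst q x * snd q y)"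
    and "(\<lambda>y. coprod f (x, y)) = (\<lambda>y. \<Sum>q\<leftarrow>ps. snd q y * fst q x)"
  using tensor_rep_apply[OF assms] by (auto simp: case_prod_unfold mult.commute)

lemma counital_coalgebra_PQSym:
  "counital_coalgebra (PQSym :: (nat list, 'k::field_char_0) graded_hopf)"
proof -
  note sp = subspace_series[of 1, where 'a = 'k]
  have lin: "linear_on fscale (series 1) (hcomult PQSym :: (nat list \<Rightarrow> 'k) \<Rightarrow> _)"
    unfolding linear_on_def
    by (simp add: hcomult_eq_coprod fun_vs.subspace_add[OF sp] fun_vs.subspace_scale[OF sp] coprod_linear)
  have lin': "linear_on (*) (series 1) (\<lambda>f :: nat list \<Rightarrow> 'k. f [])"
    by (simp add: linear_on_def fscale_def)
  have main: "(\<forall>x y z. (\<Sum>(a, b)\<leftarrow>ps. hcomult PQSym a (x, y) * b z) =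
                 (\<Sum>(a, b)\<leftarrow>ps. a x * hcomult PQSym b (y, z))) \<and>
        (\<Sum>(a, b)\<leftarrow>ps. fscale (a []) b) = f \<and>
        (\<Sum>(a, b)\<leftarrow>ps. fscale (b []) a) = f"
    if f: "f \<in> series 1" and rep: "tensor_rep (series 1) (coprod f) ps"
    for f :: "nat list \<Rightarrow> 'k" and ps
  proof (intro conjI allI)
    note slices = sum_list_tensor_rep_slices[OF rep]
    fix x y z
    have "(\<Sum>(a, b)\<leftarrow>ps. hcomult PQSym a (x, y) * b z) = (\<Sum>(a, b)\<leftarrow>ps. coprod a (x, y) * b z)"
      by (rule sum_list_pair_cong) (use tensor_rep_memD[OF rep] in \<open>simp add: hcomult_eq_coprod\<close>)
    also have "\<dots> = coprod (\<lambda>x. coprod f (x, z)) (x, y)"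
      unfolding slices(1) coprod_sum_list by (simp add: case_prod_unfold)
    also have "\<dots> = coprod (\<lambda>y. coprod f (x, y)) (y, z)" by (rule coprod_coassoc)
    also have "\<dots> = (\<Sum>(a, b)\<leftarrow>ps. a x * coprod b (y, z))"
      unfolding slices(2) coprod_sum_list by (simp add: case_prod_unfold mult.commute)
    also have "\<dots> = (\<Sum>(a, b)\<leftarrow>ps. a x * hcomult PQSym b (y, z))"
      by (rule sum_list_pair_cong) (use tensor_rep_memD[OF rep] in \<open>simp add: hcomult_eq_coprod\<close>)
    finally show "(\<Sum>(a, b)\<leftarrow>ps. hcomult PQSym a (x, y) * b z) =
        (\<Sum>(a, b)\<leftarrow>ps. a x * hcomult PQSym b (y, z))" .
  next
    show "(\<Sum>(a, b)\<leftarrow>ps. fscale (a []) b) = f"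
    proof
      fix y
      have "(\<Sum>(a, b)\<leftarrow>ps. fscale (a []) b) y = coprod f ([], y)"
        unfolding tensor_rep_apply[OF rep] sum_list_fun_apply
        by (simp add: o_def case_prod_unfold fscale_def)
      then show "(\<Sum>(a, b)\<leftarrow>ps. fscale (a []) b) y = f y"
        using coprod_Nil_left[OF seriesD(2,1)[OF f]] by simp
    qed
    show "(\<Sum>(a, b)\<leftarrow>ps. fscale (b []) a) = f"
    proof
      fix x
      have "(\<Sum>(a, b)\<leftarrow>ps. fscale (b []) a) x = coprod f (x, [])"
        unfolding tensor_rep_apply[OF rep] sum_list_fun_apply
        by (simp add: o_def case_prod_unfold fscale_def mult.commute)
      then show "(\<Sum>(a, b)\<leftarrow>ps. fscale (b []) a) x = f x"
        using coprod_Nil_right[OF seriesD(2,1)[OF f]] by simp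
    qed
  qed
  show ?thesis
    unfolding counital_coalgebra_def PQSym_simps
  proof (intro conjI ballI allI impI)
    fix f :: "nat list \<Rightarrow> 'k" assume f: "f \<in> series 1"
    show "hcomult PQSym f \<in> tensor_space (series 1) (series 1)"
      using coprod_tensor_space[OF f] by (simp add: hcomult_eq_coprod f)
  next
    fix f :: "nat list \<Rightarrow> 'k" and ps
    assume f: "f \<in> series 1" and rep: "tensor_rep (series 1) (hcomult PQSym f) ps"
    note * = main[OF f rep[unfolded hcomult_eq_coprod[OF f]]]
    show "(\<Sum>(a, b)\<leftarrow>ps. hcomult PQSym a (x, y) * b z) =
        (\<Sum>(a, b)\<leftarrow>ps. a x * hcomult PQSym b (y, z))" for x y z
      using * by blast
    show "(\<Sum>(a, b)\<leftarrow>ps. fscale (a []) b) = f" "(\<Sum>(a, b)\<leftarrow>ps. fscale (b []) a) = f"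
      using * by blast+
  qed (use sp lin lin' in \<open>simp_all add: PQSym_simps(4)[abs_def]\<close>)
qed

lemma coprod_unit: "coprod (Gser []) = (tensor (Gser []) (Gser []) :: _ \<Rightarrow> 'k::field)"
proof
  fix p :: "nat list \<times> nat list"
  obtain x y where p: "p = (x, y)" by (cases p)
  show "coprod (Gser []) p = (tensor (Gser []) (Gser []) p :: 'k)"
  proof (cases "x = [] \<and> y = []")
    case True
    have "Gser [] \<in> (series 1 :: (nat list \<Rightarrow> 'k) set)" using Gser_series by blast
    then have "coprod (Gser []) ([], []) = (Gser [] [] :: 'k)"
      by (intro coprod_Nil_left seriesD)
    then show ?thesis
      using True by (simp add: p tensor_def Gser_Nil)
  next
    case False
    then have "coprod (Gser []) (x, y) = 0" by (intro coprod_length) (auto simp: Gser_Nil)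
    then show ?thesis using False by (auto simp: p tensor_def Gser_Nil)
  qed
qed

lemma sum_list_product:
  fixes F :: "'a \<Rightarrow> 'c::semiring_0"
  shows "(\<Sum>p\<leftarrow>ps. F p) * (\<Sum>q\<leftarrow>qs. G q) = (\<Sum>p\<leftarrow>ps. \<Sum>q\<leftarrow>qs. F p * G q)"
  by (simp add: sum_list_const_mult sum_list_mult_const)

lemma bialgebra_PQSym: "bialgebra (PQSym :: (nat list, 'k::field_char_0) graded_hopf)"
proof -
  have unit: "Gser [] \<in> (series 1 :: (nat list \<Rightarrow> 'k) set)" using Gser_series by blast
  have mult: "hcomult PQSym (hmult PQSym f g) =
      (\<Sum>(a, b)\<leftarrow>ps. \<Sum>(c, d)\<leftarrow>qs. tensor (hmult PQSym a c) (hmult PQSym b d))"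
    if f: "f \<in> series 1" and g: "g \<in> series 1"
      and ps: "tensor_rep (series 1) (hcomult PQSym f) ps"
      and qs: "tensor_rep (series 1) (hcomult PQSym g) qs"
    for f g :: "nat list \<Rightarrow> 'k" and ps qs
  proof
    fix p :: "nat list \<times> nat list"
    obtain x y where p: "p = (x, y)" by (cases p)
    note reps = tensor_rep_apply[OF ps] tensor_rep_apply[OF qs]
    have "hcomult PQSym (hmult PQSym f g) p = coprod (conv f g) (x, y)"
      by (simp add: p f g hmult_eq_conv hcomult_eq_coprod series_conv)
    also have "\<dots> = (\<Sum>i\<le>length x. \<Sum>j\<le>length y.
        hcomult PQSym f (take i x, take j y) * hcomult PQSym g (drop i x, drop j y))"
      by (simp add: coprod_conv seriesD f g hcomult_eq_coprod)
    also have "\<dots> = (\<Sum>i\<le>length x. \<Sum>j\<le>length y. \<Sum>(a, b)\<leftarrow>ps. \<Sum>(c, d)\<leftarrow>qs.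
        a (take i x) * b (take j y) * (c (drop i x) * d (drop j y)))"
      by (simp add: reps sum_list_product case_prod_unfold)
    also have "\<dots> = (\<Sum>(a, b)\<leftarrow>ps. \<Sum>(c, d)\<leftarrow>qs. \<Sum>i\<le>length x. \<Sum>j\<le>length y.
        a (take i x) * b (take j y) * (c (drop i x) * d (drop j y)))"
      by (simp add: sum_list_sum[symmetric] case_prod_unfold)
    also have "\<dots> = (\<Sum>(a, b)\<leftarrow>ps. \<Sum>(c, d)\<leftarrow>qs. conv a c x * conv b d y)"
      by (simp add: conv_def sum_product ac_simps)
    also have "\<dots> = (\<Sum>(a, b)\<leftarrow>ps. \<Sum>(c, d)\<leftarrow>qs. hmult PQSym a c x * hmult PQSym b d y)"
      by (intro sum_list_pair_cong)
        (use tensor_rep_memD[OF ps] tensor_rep_memD[OF qs] in \<open>simp add: hmult_eq_conv\<close>)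
    also have "\<dots> = (\<Sum>(a, b)\<leftarrow>ps. \<Sum>(c, d)\<leftarrow>qs. tensor (hmult PQSym a c) (hmult PQSym b d)) p"
      by (simp add: p sum_list_fun_apply o_def case_prod_unfold tensor_def)
    finally show "hcomult PQSym (hmult PQSym f g) p =
        (\<Sum>(a, b)\<leftarrow>ps. \<Sum>(c, d)\<leftarrow>qs. tensor (hmult PQSym a c) (hmult PQSym b d)) p" .
  qed
  show ?thesis
    unfolding bialgebra_def PQSym_simps
  proof (intro conjI ballI allI impI)
    show "hcomult PQSym (Gser []) = (tensor (Gser []) (Gser []) :: _ \<Rightarrow> 'k)"
      by (simp add: hcomult_eq_coprod unit coprod_unit)
    show "Gser [] [] = (1 :: 'k)" by (simp add: Gser_Nil)
    show "hmult PQSym f g [] = f [] * g []" if "f \<in> series 1" "g \<in> series 1" for f g :: "nat list \<Rightarrow> 'k"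
      using that by (simp add: hmult_eq_conv conv_def)
  qed (use mult unital_algebra_PQSym counital_coalgebra_PQSym in blast)+
qed

lemma antipode_PQSym: "antipode (PQSym :: (nat list, 'k::field_char_0) graded_hopf) anti"
  unfolding antipode_def PQSym_simps
proof (intro conjI ballI allI impI)
  show "anti f \<in> series 1" if "f \<in> series 1" for f :: "nat list \<Rightarrow> 'k"
    using that by (simp add: series_anti)
  show "linear_on fscale (series 1) (anti :: (nat list \<Rightarrow> 'k) \<Rightarrow> _)"
    by (auto simp: linear_on_def fun_eq_iff plus_fun_def fscale_def anti_add anti_scale)
next
  fix f :: "nat list \<Rightarrow> 'k" and ps
  assume f: "f \<in> series 1" and "tensor_rep (series 1) (hcomult PQSym f) ps"
  then have rep: "tensor_rep (series 1) (coprod f) ps" by (simp add: hcomult_eq_coprod)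
  note slices = sum_list_tensor_rep_slices[OF rep]
  show "(\<Sum>(a, b)\<leftarrow>ps. hmult PQSym (anti a) b) = fscale (f []) (Gser [])"
  proof
    fix w
    have "(\<Sum>(a, b)\<leftarrow>ps. hmult PQSym (anti a) b) = (\<Sum>(a, b)\<leftarrow>ps. conv (anti a) b)"
      by (rule sum_list_pair_cong)
        (use tensor_rep_memD[OF rep] in \<open>simp add: hmult_eq_conv series_anti\<close>)
    then have "(\<Sum>(a, b)\<leftarrow>ps. hmult PQSym (anti a) b) w =
        (\<Sum>q\<leftarrow>ps. \<Sum>k\<le>length w. anti (fst q) (take k w) * snd q (drop k w))"
      by (simp add: sum_list_fun_apply o_def case_prod_unfold conv_def)
    also have "\<dots> = (\<Sum>k\<le>length w. anti (\<lambda>x. coprod f (x, drop k w)) (take k w))"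
      unfolding slices(1) anti_sum_list sum_list_sum ..
    also have "\<dots> = fscale (f []) (Gser []) w"
      using anti_left[OF seriesD(2,1)[OF f]] by (simp add: fscale_def Gser_Nil)
    finally show "(\<Sum>(a, b)\<leftarrow>ps. hmult PQSym (anti a) b) w = fscale (f []) (Gser []) w" .
  qed
  show "(\<Sum>(a, b)\<leftarrow>ps. hmult PQSym a (anti b)) = fscale (f []) (Gser [])"
  proof
    fix w
    have "(\<Sum>(a, b)\<leftarrow>ps. hmult PQSym a (anti b)) = (\<Sum>(a, b)\<leftarrow>ps. conv a (anti b))"
      by (rule sum_list_pair_cong)
        (use tensor_rep_memD[OF rep] in \<open>simp add: hmult_eq_conv series_anti\<close>)
    then have "(\<Sum>(a, b)\<leftarrow>ps. hmult PQSym a (anti b)) w =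
        (\<Sum>q\<leftarrow>ps. \<Sum>k\<le>length w. anti (snd q) (drop k w) * fst q (take k w))"
      by (simp add: sum_list_fun_apply o_def case_prod_unfold conv_def mult.commute)
    also have "\<dots> = (\<Sum>k\<le>length w. anti (\<lambda>y. coprod f (take k w, y)) (drop k w))"
      unfolding slices(2) anti_sum_list sum_list_sum ..
    also have "\<dots> = fscale (f []) (Gser []) w"
      using anti_right[OF seriesD(2,1)[OF f]] by (simp add: fscale_def Gser_Nil)
    finally show "(\<Sum>(a, b)\<leftarrow>ps. hmult PQSym a (anti b)) w = fscale (f []) (Gser []) w" .
  qed
qed

lemma hcomult_graded:
  fixes f :: "nat list \<Rightarrow> 'k::field_char_0"
  assumes "f \<in> homogeneous n"
  shows "hcomult PQSym f \<in>
    fun_vs.span (\<Union>i\<le>n. tensor_space (series 1 \<inter> homogeneous i) (series 1 \<inter> homogeneous (n - i)))"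
proof -
  let ?S = "\<Union>i\<le>n. tensor_space (series 1 \<inter> homogeneous i) (series 1 \<inter> homogeneous (n - i) :: (nat list \<Rightarrow> 'k) set)"
  have "tensor (Gser a) (Gser b) \<in> ?S" if "u \<in> Gsupp f" "u \<in> mix (length a) a b" for u a b
  proof -
    have "length u = n" using that(1) assms by (auto simp: Gsupp_def homogeneous_def)
    then have n: "length b = n - length a" "length a \<le> n" using length_mix[OF that(2)] by auto
    then have "tensor (Gser a) (Gser b) \<in>
        tensor_space (series 1 \<inter> homogeneous (length a)) (series 1 \<inter> homogeneous (n - length a))"
      unfolding tensor_space_def using Gser_series[of a] Gser_series[of b]
      by (intro fun_vs.span_base) auto
    then show ?thesis using n(2) by blast
  qed
  then have "(\<Sum>u\<in>Gsupp f. fscale (f u) (G_comult u)) \<in> fun_vs.span ?S"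
    unfolding G_comult_eq
    by (intro fun_vs.span_sum fun_vs.span_scale, clarify, intro fun_vs.span_base) blast
  then show ?thesis by (simp add: PQSym_def)
qed

lemma graded_hopf_algebra_PQSym:
  "graded_hopf_algebra (PQSym :: (nat list, 'k::field_char_0) graded_hopf)"
  unfolding graded_hopf_algebra_def PQSym_simps
proof (intro conjI ballI allI impI)
  show "graded_space (\<lambda>n. series 1 \<inter> homogeneous n) (series 1 :: (nat list \<Rightarrow> 'k) set)"
    by (rule graded_space_series)
  show "Gser [] \<in> (series 1 \<inter> homogeneous 0 :: (nat list \<Rightarrow> 'k) set)"
    using Gser_series[of "[]"] by simp
  show "hmult PQSym f g \<in> series 1 \<inter> homogeneous (m + n)"
    if "f \<in> series 1 \<inter> homogeneous m" "g \<in> series 1 \<inter> homogeneous n" for m n and f g :: "nat list \<Rightarrow> 'k"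
    using that by (simp add: hmult_eq_conv series_conv conv_homogeneous)
  show "f [] = 0" if "0 < n" "f \<in> series 1 \<inter> homogeneous n" for n and f :: "nat list \<Rightarrow> 'k"
    using that by (auto simp: homogeneous_def)
  have "anti f \<in> series 1 \<inter> homogeneous n" if "f \<in> series 1 \<inter> homogeneous n"
    for n and f :: "nat list \<Rightarrow> 'k"
    using that by (auto simp: series_anti homogeneous_def intro!: anti_length)
  then show "\<exists>S. antipode PQSym S \<and>
      (\<forall>n. \<forall>f\<in>series 1 \<inter> homogeneous n. S f \<in> (series 1 \<inter> homogeneous n :: (nat list \<Rightarrow> 'k) set))"
    using antipode_PQSym by blast
qed (use bialgebra_PQSym hcomult_graded in auto)

section \<open>The invariant subspaces as graded Hopf subalgebras\<close>

lemma graded_hopf_subalgebra_series: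
  assumes "1 \<le> r"
  shows "graded_hopf_subalgebra (series r :: (nat list \<Rightarrow> 'k::field_char_0) set) PQSym"
proof -
  have sub: "series r \<subseteq> (series 1 :: (nat list \<Rightarrow> 'k) set)" using assms by (rule series_antimono)
  have "series r \<inter> (series 1 \<inter> homogeneous n) = (series r \<inter> homogeneous n :: (nat list \<Rightarrow> 'k) set)" for n
    using sub by blast
  then have gr: "graded_space (\<lambda>n. series r \<inter> (series 1 \<inter> homogeneous n)) (series r :: (nat list \<Rightarrow> 'k) set)"
    using graded_space_series by simp
  have unit: "Gser [] \<in> (series r :: (nat list \<Rightarrow> 'k) set)"
  proof -
    have "block_sym r (Gser [] :: nat list \<Rightarrow> 'k)"
      by (simp add: block_sym_def Gser_Nil block_swap_def)
    moreover have "Gser [] \<in> (series 1 :: (nat list \<Rightarrow> 'k) set)" using Gser_series by blast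
    ultimately show ?thesis by (simp add: series_def)
  qed
  show ?thesis
    unfolding graded_hopf_subalgebra_def PQSym_simps
  proof (intro conjI ballI)
    show "hmult PQSym f g \<in> series r" if "f \<in> series r" "g \<in> series r" for f g :: "nat list \<Rightarrow> 'k"
    proof -
      have "hmult PQSym f g = conv f g" using that sub by (intro hmult_eq_conv) auto
      then show ?thesis using series_conv[OF that] by simp
    qed
    show "hcomult PQSym f \<in> tensor_space (series r) (series r)" if "f \<in> series r" for f :: "nat list \<Rightarrow> 'k"
    proof -
      have "hcomult PQSym f = coprod f" using that sub by (intro hcomult_eq_coprod) auto
      then show ?thesis using coprod_tensor_space[OF that assms] by simp
    qed
    show "\<exists>S. antipode PQSym S \<and> (\<forall>f\<in>series r. S f \<in> (series r :: (nat list \<Rightarrow> 'k) set))"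
      using antipode_PQSym series_anti[OF _ assms] by blast
  qed (use graded_hopf_algebra_PQSym sub subspace_series gr unit in auto)
qed

lemma PQSym_inv_eq_series:
  assumes "1 \<le> r" shows "PQSym_inv r = (series r :: (nat list \<Rightarrow> 'k::field_char_0) set)"
proof -
  have "(\<forall>i. series_swap r i f = f) \<longleftrightarrow> block_sym r f" if "f \<in> series 1" for f :: "nat list \<Rightarrow> 'k"
  proof -
    have "(\<forall>i. series_swap r i f = f) \<longleftrightarrow> (\<forall>i. \<forall>w\<in>words. f (word_swap r i w) = f w)"
      using seriesD(1)[OF that] by (auto simp: fun_eq_iff series_swap_apply on_words_def)
    then show ?thesis by (simp add: word_swap_invariant_iff)
  qed
  moreover have "f \<in> series 1 \<and> block_sym r f \<longleftrightarrow> f \<in> series r" for f :: "nat list \<Rightarrow> 'k"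
    using block_sym_antimono[OF _ assms, of f] by (auto simp: series_def)
  ultimately show ?thesis unfolding PQSym_inv_def PQSym_simps by blast
qed

section \<open>Commutativity and cocommutativity\<close>

text \<open>One implication suffices, since the inverse of an admissible swap is again
  admissible.\<close>

lemma block_sym_indicatorI:
  assumes "\<And>w a b c. w \<in> words \<Longrightarrow> a \<le> b \<Longrightarrow> b \<le> c \<Longrightarrow> is_cut w a \<Longrightarrow> is_cut w b \<Longrightarrow> is_cut w c \<Longrightarrow>
     enat (cnt w a b) < r \<or> enat (cnt w b c) < r \<Longrightarrow> P w \<Longrightarrow> P (block_swap a b c w)"
  shows "block_sym r (\<lambda>w. if P w then 1 else 0)"
proof (rule block_symI)
  fix w a b c
  assume w: "w \<in> words" and abc: "a \<le> b" "b \<le> c" and cuts: "is_cut w a" "is_cut w b" "is_cut w c"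
    and small: "enat (cnt w a b) < r \<or> enat (cnt w b c) < r"
  let ?v = "block_swap a b c w" and ?b = "a + (c - b)"
  have "c - (c - b) = b" using abc by simp
  then have "cnt ?v a ?b = cnt w b c" "cnt ?v ?b c = cnt w a b"
    using abc cnt_block_swap(4,5)[OF abc] by simp_all
  then have small': "enat (cnt ?v a ?b) < r \<or> enat (cnt ?v ?b c) < r" using small by auto
  have cuts': "is_cut ?v a" "is_cut ?v ?b" "is_cut ?v c"
    using cut_block_swap[OF abc cuts] cuts by auto
  have "a \<le> ?b" "?b \<le> c" using abc by auto
  then have "P ?v \<Longrightarrow> P (block_swap a ?b c ?v)"
    by (rule assms[OF block_swap_words[OF abc w] _ _ cuts' small'])
  then have "P ?v \<longleftrightarrow> P w"
    using assms[OF w abc cuts small] block_swap_inverse[OF abc, of w] by auto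
  then show "(if P ?v then 1 else 0) = (if P w then 1 else 0)" by simp
qed

text \<open>The sum of all one-letter words and the sum of all words \<open>[k, k]\<close> are
  invariant for every \<open>r\<close>, as any relabelling by positive letters keeps these shapes,
  at most merging letters. The word \<open>[1, 2, 2]\<close> occurs in their product in one order
  only.\<close>

lemma not_commutative_series:
  assumes "1 \<le> r"
  shows "\<not> commutative_on (series r :: (nat list \<Rightarrow> 'k::field_char_0) set) PQSym"
proof
  define f :: "nat list \<Rightarrow> 'k" where "f = (\<lambda>w. if w \<in> words \<and> length w = 1 then 1 else 0)"
  define g :: "nat list \<Rightarrow> 'k" where "g = (\<lambda>w. if w \<in> words \<and> (\<exists>k. w = [k, k]) then 1 else 0)"
  have "block_sym r f" unfolding f_def
    by (rule block_sym_indicatorI) (simp add: block_swap_words)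
  then have f: "f \<in> series r"
    by (auto simp: series_def f_def on_words_def intro!: exI[of _ 1])
  have "block_sym r g" unfolding g_def
    by (rule block_sym_indicatorI) (auto simp: block_swap_words, auto simp: block_swap_def)
  then have g: "g \<in> series r"
    by (auto simp: series_def g_def on_words_def intro!: exI[of _ 2])
  assume "commutative_on (series r :: (nat list \<Rightarrow> 'k) set) PQSym"
  then have "hmult PQSym f g = hmult PQSym g f" using f g by (simp add: commutative_on_def)
  moreover have "f \<in> series 1" "g \<in> series 1" using f g series_antimono[OF assms] by auto
  ultimately have "conv f g [1, 2, 2] = conv g f [1, 2, 2]" by (simp add: hmult_eq_conv)
  moreover have "{..length [1, 2, 2 :: nat]} = {0, 1, 2, 3}" by auto
  ultimately show False
    unfolding conv_def by (simp add: f_def g_def words_iff numeral_2_eq_2 numeral_3_eq_3)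
qed

text \<open>Two different columns of lengths \<open>n\<close> and \<open>n + 1\<close> can never be exchanged by the
  \<open>n\<close>-action, so their order is remembered.\<close>

lemma not_cocommutative_series:
  assumes "1 \<le> n"
  shows "\<not> cocommutative_on (series (enat n) :: (nat list \<Rightarrow> 'k::field_char_0) set) PQSym"
proof
  \<comment> \<open>The distance \<open>n\<close> leaves room for the column of the \<open>n\<close>
    letters \<open>x\<close>, which occupies the values from \<open>x\<close> to
    \<open>x + n - 1\<close>, before the column of the letters \<open>y\<close>.\<close>
  define Q where "Q w \<longleftrightarrow> (\<exists>x y. 0 < x \<and> x + n \<le> y \<and> w = replicate n x @ replicate (Suc n) y)" for w
  define f :: "nat list \<Rightarrow> 'k" where "f = (\<lambda>w. if Q w then 1 else 0)"
  have "block_sym (enat n) f" unfolding f_def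
  proof (rule block_sym_indicatorI)
    fix w a b c
    assume abc: "a \<le> b" "b \<le> c" and cuts: "is_cut w a" "is_cut w b" "is_cut w c"
      and small: "enat (cnt w a b) < enat n \<or> enat (cnt w b c) < enat n" and "Q w"
    then obtain x y where xy: "0 < x" "x + n \<le> y" and w: "w = replicate n x @ replicate (Suc n) y"
      by (auto simp: Q_def)
    have cnt: "cnt w p q = (if p < x \<and> x \<le> q then n else 0) + (if p < y \<and> y \<le> q then Suc n else 0)" for p q
      by (simp add: w cnt_append) (simp add: cnt_def)
    \<comment> \<open>A cut that separates the two letters must lie at or beyond the end of the
      column of \<open>x\<close>.\<close>
    have between: "x + n \<le> Suc k" if "is_cut w k" "x \<le> k" "k < y" for k
      using cut_le[OF that(1), of "x - 1"] that(2,3) xy(1) by (simp add: cnt)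
    \<comment> \<open>A block with fewer than \<open>n\<close> letters contains neither
      \<open>x\<close> nor \<open>y\<close>, since they occur \<open>n\<close> and
      \<open>n + 1\<close> times.\<close>
    have "\<not> (a < x \<and> x \<le> b) \<and> \<not> (a < y \<and> y \<le> b) \<or> \<not> (b < x \<and> x \<le> c) \<and> \<not> (b < y \<and> y \<le> c)"
      using small by (auto simp: cnt split: if_splits)
    then have "0 < block_shift a b c x \<and> block_shift a b c x + n \<le> block_shift a b c y"
      using xy abc between[OF cuts(1)] between[OF cuts(2)] between[OF cuts(3)]
      by (auto simp: block_shift_def)
    moreover have "block_swap a b c w =
        replicate n (block_shift a b c x) @ replicate (Suc n) (block_shift a b c y)"
      by (simp add: w block_swap_def map_replicate)
    ultimately show "Q (block_swap a b c w)" unfolding Q_def by blast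
  qed
  moreover have "w \<in> words" "length w \<le> 2 * n + 1" if "Q w" for w
    using that by (auto simp: Q_def words_iff)
  ultimately have f: "f \<in> series (enat n)"
    by (auto simp: series_def on_words_def f_def intro!: exI[of _ "2 * n + 1"]) (meson leD)
  have "1 \<le> enat n" using assms by (simp add: one_enat_def)
  then have f1: "f \<in> series 1" using f series_antimono by blast
  assume "cocommutative_on (series (enat n) :: (nat list \<Rightarrow> 'k) set) PQSym"
  then have "coprod f \<circ> prod.swap = coprod f"
    using f unfolding cocommutative_on_def by (metis hcomult_eq_coprod[OF f1])
  then have swap: "coprod f (y, x) = coprod f (x, y)" for x y
    by (metis comp_apply swap_simp)
  \<comment> \<open>Among the shuffles with the \<open>n\<close> letters \<open>1\<close> below,
    exactly \<open>?u\<close> satisfies \<open>Q\<close>. In the other order the letter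
    \<open>1\<close> would have to occur \<open>n + 1\<close> times, which \<open>Q\<close> excludes
    for the smaller letter.\<close>
  let ?x = "replicate n (1::nat)" and ?y = "replicate (Suc n) (1::nat)"
  have words: "?x \<in> words" "?y \<in> words" by (auto simp: words_iff)
  have cut: "is_cut ?x n" "is_cut ?y (Suc n)"
    by (auto simp: is_cut_def cnt_def filter_replicate)
  have letters: "\<forall>z\<in>set ?x. z \<le> n" "\<forall>z\<in>set ?y. z \<le> Suc n" using assms by auto
  let ?u = "?x @ replicate (Suc n) (Suc n)"
  have "coprod f (?x, ?y) = sum f (mix n ?x ?y)"
    by (rule coprod_eq_sum_mix[OF seriesD(2)[OF f1] words(2,1) cut(1) letters(1)])
  also have "\<dots> = (\<Sum>v\<in>mix n ?x ?y. if v = ?u then 1 else 0)"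
  proof (rule sum.cong[OF refl])
    fix v assume v: "v \<in> mix n ?x ?y"
    have "v = ?u" if "Q v"
    proof -
      obtain a b where ab: "0 < a" "a + n \<le> b" "v = replicate n a @ replicate (Suc n) b"
        using \<open>Q v\<close> by (auto simp: Q_def)
      then have "{a, b} \<subseteq> {1, Suc n}" using set_mix[OF v] assms by auto
      then have "a = 1" "b = Suc n" using ab(1,2) assms by auto
      then show ?thesis using ab(3) by simp
    qed
    moreover have "Q ?u" unfolding Q_def by (intro exI[of _ 1] exI[of _ "Suc n"]) simp
    ultimately have "Q v \<longleftrightarrow> v = ?u" by metis
    then show "f v = (if v = ?u then 1 else 0)" by (simp only: f_def)
  qed
  also have "?u \<in> mix n ?x ?y"
    using assms by (simp add: mix_def low_def high_def filter_replicate map_replicate)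
  then have "(\<Sum>v\<in>mix n ?x ?y. if v = ?u then 1 else 0 :: 'k) = 1" by simp
  finally have "coprod f (?x, ?y) = 1" .
  moreover have "coprod f (?y, ?x) = 0"
  proof -
    have "f v = 0" if v: "v \<in> mix (Suc n) ?y ?x" for v
    proof (rule ccontr)
      assume "f v \<noteq> 0"
      then obtain a b where ab: "0 < a" "a + n \<le> b" "v = replicate n a @ replicate (Suc n) b"
        by (auto simp: f_def Q_def split: if_splits)
      then have "{a, b} \<subseteq> {1, Suc (Suc n)}" using set_mix[OF v] assms by auto
      then have "a = 1" "b = Suc (Suc n)" using ab assms by auto
      then have "low (Suc n) v = ?x" using ab(3) by (simp add: low_def filter_replicate)
      then show False using v by (auto simp: mix_def dest: arg_cong[where f = length])
    qed
    moreover have "coprod f (?y, ?x) = sum f (mix (Suc n) ?y ?x)"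
      by (rule coprod_eq_sum_mix[OF seriesD(2)[OF f1] words(1,2) cut(2) letters(2)])
    ultimately show ?thesis by simp
  qed
  ultimately show False using swap[of ?y ?x] by simp
qed

lemma cocommutative_series_infinity:
  "cocommutative_on (series \<infinity> :: (nat list \<Rightarrow> 'k::field_char_0) set) PQSym"
  unfolding cocommutative_on_def
proof
  fix f :: "nat list \<Rightarrow> 'k" assume f: "f \<in> series \<infinity>"
  then have f1: "f \<in> series 1" using series_antimono[of 1 \<infinity>] by auto
  have swap: "low l (block_swap 0 k (k + l) v) = high k v"
    "high l (block_swap 0 k (k + l) v) = low k v"
    if "\<forall>z\<in>set v. 0 < z \<and> z \<le> k + l" for k l v
    using that by (induction v) (auto simp: low_def high_def block_swap_def block_shift_def)
  have coprod: "coprod f (y, x) = coprod f (x, y)" for x y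
  proof (cases "x \<in> words \<and> y \<in> words")
    case True
    let ?X = "Park x" and ?Y = "Park y" and ?k = "length x" and ?l = "length y"
    have P: "parking ?X" "parking ?Y" using True parking_Park by auto
    \<comment> \<open>After parkization a shuffle is a parking function of length
      \<open>?k + ?l\<close>, so its letters fill only the two intervals that are exchanged.\<close>
    have letters: "\<forall>z\<in>set v. 0 < z \<and> z \<le> length a + length b"
      if "v \<in> mix (length a) a b" "parking a" "parking b" for v a b
      using parking_mix[OF that(2,3,1)] length_mix[OF that(1)]
      by (auto simp: parking_iff_cut words_iff intro: gr0I)
    have "sum f (mix ?k ?X ?Y) = sum f (mix ?l ?Y ?X)"
    proof (rule sum.reindex_bij_witness[where j = "block_swap 0 ?k (?k + ?l)" and
          i = "block_swap 0 ?l (?l + ?k)"])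
      fix v assume v: "v \<in> mix ?k ?X ?Y"
      note l = letters[of v ?X ?Y, simplified, OF v P]
      show "block_swap 0 ?l (?l + ?k) (block_swap 0 ?k (?k + ?l) v) = v"
        using block_swap_inverse[of 0 ?k "?k + ?l" v] by (simp add: add.commute)
      show "block_swap 0 ?k (?k + ?l) v \<in> mix ?l ?Y ?X"
        using swap[OF l] v by (simp add: mix_def)
      have pv: "parking v" using parking_mix[OF P] v by simp
      have "is_cut v ?k"
        using v P(1) cut_low[of ?k ?k v] by (auto simp: mix_def parking_iff_cut)
      moreover have "is_cut v (?k + ?l)"
        using pv length_mix[OF v] by (simp add: parking_iff_cut)
      ultimately show "f (block_swap 0 ?k (?k + ?l) v) = f v"
        using pv by (intro block_symD[OF seriesD(2)[OF f]] cut_0) (auto simp: parking_words)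
    next
      fix v assume v: "v \<in> mix ?l ?Y ?X"
      note l = letters[of v ?Y ?X, simplified, OF v P(2,1)]
      show "block_swap 0 ?k (?k + ?l) (block_swap 0 ?l (?l + ?k) v) = v"
        using block_swap_inverse[of 0 ?l "?l + ?k" v] by (simp add: add.commute)
      show "block_swap 0 ?l (?l + ?k) v \<in> mix ?k ?X ?Y"
        using swap[OF l] v by (simp add: mix_def)
    qed
    then show ?thesis using True by (simp add: coprod_def)
  qed (auto simp: coprod_def)
  show "hcomult PQSym f \<circ> prod.swap = hcomult PQSym f"
    unfolding hcomult_eq_coprod[OF f1] by (rule ext, clarify) (simp add: coprod)
qed

theorem mainTheorem3:
  shows "(\<forall>r::enat. 1 \<le> r \<longrightarrow>
            graded_hopf_subalgebra (PQSym_inv r :: (nat list \<Rightarrow> 'k::field_char_0) set) PQSym) \<and>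
         hcarrier (PQSym :: (nat list, 'k) graded_hopf) = PQSym_inv 1 \<and>
         (\<forall>r s::enat. 1 \<le> r \<and> r \<le> s \<longrightarrow>
            (PQSym_inv r :: (nat list \<Rightarrow> 'k) set) \<supseteq> PQSym_inv s) \<and>
         (\<forall>r::enat. 1 \<le> r \<longrightarrow>
            \<not> commutative_on (PQSym_inv r :: (nat list \<Rightarrow> 'k) set) PQSym) \<and>
         (\<forall>r::enat. 1 \<le> r \<and> r \<noteq> \<infinity> \<longrightarrow>
            \<not> cocommutative_on (PQSym_inv r :: (nat list \<Rightarrow> 'k) set) PQSym) \<and>
         cocommutative_on (PQSym_inv \<infinity> :: (nat list \<Rightarrow> 'k) set) PQSym"
proof (intro conjI allI impI)
  show "graded_hopf_subalgebra (PQSym_inv r :: (nat list \<Rightarrow> 'k) set) PQSym" if "1 \<le> r" for r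
    using graded_hopf_subalgebra_series[OF that] by (simp add: PQSym_inv_eq_series[OF that])
  show "hcarrier (PQSym :: (nat list, 'k) graded_hopf) = PQSym_inv 1"
    by (simp add: PQSym_simps PQSym_inv_eq_series)
  show "(PQSym_inv s :: (nat list \<Rightarrow> 'k) set) \<subseteq> PQSym_inv r" if "1 \<le> r \<and> r \<le> s" for r s
  proof -
    have "1 \<le> r" "1 \<le> s" using that by (auto intro: order_trans)
    then show ?thesis using that series_antimono[of r s] by (simp add: PQSym_inv_eq_series)
  qed
  show "\<not> commutative_on (PQSym_inv r :: (nat list \<Rightarrow> 'k) set) PQSym" if "1 \<le> r" for r
    using not_commutative_series[OF that] by (simp add: PQSym_inv_eq_series[OF that])
  show "\<not> cocommutative_on (PQSym_inv r :: (nat list \<Rightarrow> 'k) set) PQSym" if r: "1 \<le> r \<and> r \<noteq> \<infinity>" for r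
  proof -
    obtain n where n: "r = enat n" using r by (cases r) auto
    then have "1 \<le> n" using r by (simp add: one_enat_def)
    then show ?thesis using not_cocommutative_series r n by (metis PQSym_inv_eq_series)
  qed
  show "cocommutative_on (PQSym_inv \<infinity> :: (nat list \<Rightarrow> 'k) set) PQSym"
    using cocommutative_series_infinity by (simp add: PQSym_inv_eq_series)
qed

end
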